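(* Let $\alpha,\beta,\gamma\in\mathbb{R}$, $n\in\mathbb{N}$, and let $Lp_n(\alpha,\beta,\gamma)=(k_{ij})_{1\le i,j\le n+1}$ be the matrix whose entries are defined by $k_{1j}=\alpha^{j-1}$ for $1\le j\le n+1$, $k_{i1}=\beta^{i-1}$ for $1\le i\le n+1$, and $$k_{ij}=\alpha k_{i,j-1}+\beta k_{i-1,j}+\gamma k_{i-1,j-1},\qquad 2\le i,j\le n+1.$$ If $\alpha,\beta>0$ and $\alpha\beta+\gamma>0$, then $Lp_n(\alpha,\beta,\gamma)$ is a strictly totally positive matrix. Moreover, if in addition $\gamma\ge 0$, then its bidiagonal decomposition $$\left(\mathcal{BD}(Lp_n(\alpha,\beta,\gamma))\right)_{ij}=\begin{cases}(\alpha\beta+\gamma)^{i-1},& i=j,\\ \beta,& i>j,\\ \alpha,& i<j,\end{cases}$$ can be computed (from $\alpha,\beta,\gamma$) to high relative accuracy, and it can be used to obtain with high relative accuracy the eigenvalues, the singular values and the inverse of $Lp_n(\alpha,\beta,\gamma)$, as well as the solution of the linear systems $Lp_n(\alpha,\beta,\gamma)x=b$ where $b=(b_1,\ldots,b_{n+1})$ has alternating signs.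
   Context: A real matrix is strictly totally positive (STP) if all its minors are positive. Bidiagonal decomposition and the notation $\mathcal{BD}(A)$: for an $N\times N$ real matrix $A$, a bidiagonal decomposition is a factorization $$A=F_{N-1}F_{N-2}\cdots F_1\,D\,G_1\cdots G_{N-2}G_{N-1},$$ where $D=\mathrm{diag}(p_{11},\ldots,p_{NN})$; for each $i\in\{1,\ldots,N-1\}$, $F_i$ is the lower bidiagonal matrix with all diagonal entries equal to $1$ and whose subdiagonal entry in position $(r,r-1)$ is $0$ for $2\le r\le i$ and $m_{r,r-i}$ for $i+1\le r\le N$; and $G_i$ is the upper bidiagonal matrix with all diagonal entries equal to $1$ and whose superdiagonal entry in position $(r-1,r)$ is $0$ for $2\le r\le i$ and $\widetilde m_{r,r-i}$ for $i+1\le r\le N$. The data of the decomposition are stored in the $N\times N$ matrix $\mathcal{BD}(A)$ with $(\mathcal{BD}(A))_{ij}=m_{ij}$ if $i>j$, $\widetilde m_{ji}$ if $i<j$, and $p_{ii}$ if $i=j$. Here $N=n+1$. High relative accuracy (HRA): computations are carried out in floating-point arithmetic with unit round-off $u$ (standard model: each elementary operation is performed with relative error at most $u$). A real value $x$ is obtained with HRA if the computed value $\tilde x$ satisfies $|x-\tilde x|/|x|<Ku$, where $K$ is a positive constant independent of the arithmetic precision. For a matrix, a vector, or a list of eigenvalues or singular values, this is required of each entry. An algorithm can be performed with HRA if it only includes products, divisions, sums of numbers of the same sign, and subtractions of initial data. A vector $b$ has alternating signs if consecutive entries have opposite signs. *)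

theory Defs
  imports "Jordan_Normal_Form.DL_Submatrix" "Jordan_Normal_Form.Char_Poly" Complex_Main
begin

text \<open>Rows and columns of the library's matrices are indexed from 0, so indices below are one less
  than the customary \<open>1, \<dots>, N\<close>.\<close>

section \<open>Matrices\<close>

definition strictly_totally_positive :: "real mat \<Rightarrow> bool" where
  "strictly_totally_positive A \<longleftrightarrow>
     (\<forall>I J. I \<subseteq> {..<dim_row A} \<and> J \<subseteq> {..<dim_col A} \<and> card I = card J \<and> I \<noteq> {}
        \<longrightarrow> 0 < det (submatrix A I J))"

fun Lp_entry :: "real \<Rightarrow> real \<Rightarrow> real \<Rightarrow> nat \<Rightarrow> nat \<Rightarrow> real" where
  "Lp_entry \<alpha> \<beta> \<gamma> 0 j = \<alpha> ^ j"
| "Lp_entry \<alpha> \<beta> \<gamma> (Suc i) 0 = \<beta> ^ Suc i"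
| "Lp_entry \<alpha> \<beta> \<gamma> (Suc i) (Suc j) =
     \<alpha> * Lp_entry \<alpha> \<beta> \<gamma> (Suc i) j + \<beta> * Lp_entry \<alpha> \<beta> \<gamma> i (Suc j) + \<gamma> * Lp_entry \<alpha> \<beta> \<gamma> i j"

definition Lp :: "nat \<Rightarrow> real \<Rightarrow> real \<Rightarrow> real \<Rightarrow> real mat" where
  "Lp n \<alpha> \<beta> \<gamma> = mat (n + 1) (n + 1) (\<lambda>(i, j). Lp_entry \<alpha> \<beta> \<gamma> i j)"

subsection \<open>Bidiagonal decompositions\<close>

text \<open>\<open>B\<close> is the matrix in which the data of a decomposition are stored: \<open>m\<close> below, \<open>p\<close> on, and the
  transposed multipliers of the upper factors above the diagonal.\<close>

definition lower_factor :: "real mat \<Rightarrow> nat \<Rightarrow> real mat" where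
  "lower_factor B i = mat (dim_row B) (dim_row B)
     (\<lambda>(r, c). if r = c then 1 else if r = c + 1 \<and> i \<le> r then B $$ (r, r - i) else 0)"

definition upper_factor :: "real mat \<Rightarrow> nat \<Rightarrow> real mat" where
  "upper_factor B i = mat (dim_row B) (dim_row B)
     (\<lambda>(r, c). if r = c then 1 else if c = r + 1 \<and> i \<le> c then B $$ (c - i, c) else 0)"

definition diagonal_factor :: "real mat \<Rightarrow> real mat" where
  "diagonal_factor B = mat_diag (dim_row B) (\<lambda>r. B $$ (r, r))"

text \<open>\<open>lower_product B k\<close> is \<open>F\<^sub>k \<cdots> F\<^sub>1\<close> and \<open>upper_product B k\<close> is \<open>G\<^sub>1 \<cdots> G\<^sub>k\<close>.\<close>

fun lower_product :: "real mat \<Rightarrow> nat \<Rightarrow> real mat" where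
  "lower_product B 0 = 1\<^sub>m (dim_row B)"
| "lower_product B (Suc k) = lower_factor B (Suc k) * lower_product B k"

fun upper_product :: "real mat \<Rightarrow> nat \<Rightarrow> real mat" where
  "upper_product B 0 = 1\<^sub>m (dim_row B)"
| "upper_product B (Suc k) = upper_product B k * upper_factor B (Suc k)"

definition bidiagonal_decomposition :: "real mat \<Rightarrow> real mat \<Rightarrow> bool" where
  "bidiagonal_decomposition A B \<longleftrightarrow>
     square_mat A \<and> B \<in> carrier_mat (dim_row A) (dim_row A) \<and>
     A = lower_product B (dim_row A - 1) * diagonal_factor B * upper_product B (dim_row A - 1)"

definition Lp_BD :: "nat \<Rightarrow> real \<Rightarrow> real \<Rightarrow> real \<Rightarrow> real mat" where
  "Lp_BD n \<alpha> \<beta> \<gamma> = mat (n + 1) (n + 1)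
     (\<lambda>(i, j). if i = j then (\<alpha> * \<beta> + \<gamma>) ^ i else if i > j then \<beta> else \<alpha>)"

subsection \<open>Spectral data and right-hand sides\<close>

text \<open>All eigenvalues, with algebraic multiplicities; such a list exists only if they are all real.\<close>

definition eigenvalue_list :: "real mat \<Rightarrow> real list \<Rightarrow> bool" where
  "eigenvalue_list A es \<longleftrightarrow> char_poly A = (\<Prod>e\<leftarrow>es. [:- e, 1:])"

definition singular_value_list :: "real mat \<Rightarrow> real list \<Rightarrow> bool" where
  "singular_value_list A ss \<longleftrightarrow>
     (\<exists>es. eigenvalue_list (transpose_mat A * A) es \<and> ss = map sqrt es)"

definition alternating_signs :: "real vec \<Rightarrow> bool" where
  "alternating_signs b \<longleftrightarrow> (\<forall>i. i + 1 < dim_vec b \<longrightarrow> b $ i * b $ (i + 1) < 0)"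

definition entries :: "real mat \<Rightarrow> real list" where
  "entries A = concat (mat_to_list A)"

section \<open>Floating-point computation\<close>

datatype binop = Plus | Minus | Times | Divide

fun exact_op :: "binop \<Rightarrow> real \<Rightarrow> real \<Rightarrow> real" where
  "exact_op Plus x y = x + y"
| "exact_op Minus x y = x - y"
| "exact_op Times x y = x * y"
| "exact_op Divide x y = x / y"

record fp_arith =
  roundoff :: real
  fl_op :: "binop \<Rightarrow> real \<Rightarrow> real \<Rightarrow> real"
  fl_sqrt :: "real \<Rightarrow> real"

text \<open>Division by 0 and square roots of negative numbers return unspecified results.\<close>

definition standard_model :: "fp_arith \<Rightarrow> bool" where
  "standard_model M \<longleftrightarrow> 0 < roundoff M \<and>
     (\<forall>f x y. (f = Divide \<longrightarrow> y \<noteq> 0) \<longrightarrow>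
        \<bar>fl_op M f x y - exact_op f x y\<bar> \<le> roundoff M * \<bar>exact_op f x y\<bar>) \<and>
     (\<forall>x\<ge>0. \<bar>fl_sqrt M x - sqrt x\<bar> \<le> roundoff M * sqrt x)"

text \<open>Algorithms are while programs over real registers. They access the arithmetic only through
  rounded operations, exact comparisons, and the constants 0, 1 and the unit round-off, the latter
  being needed in the stopping criteria of iterations. In particular, a program is independent of
  the precision.\<close>

datatype fp_expr =
    Reg nat
  | Zero
  | One
  | Roundoff
  | Bin binop fp_expr fp_expr
  | Root fp_expr

primrec eval_expr :: "fp_arith \<Rightarrow> fp_expr \<Rightarrow> (nat \<Rightarrow> real) \<Rightarrow> real" where
  "eval_expr M (Reg r) s = s r"
| "eval_expr M Zero s = 0"
| "eval_expr M One s = 1"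
| "eval_expr M Roundoff s = roundoff M"
| "eval_expr M (Bin f a b) s = fl_op M f (eval_expr M a s) (eval_expr M b s)"
| "eval_expr M (Root a) s = fl_sqrt M (eval_expr M a s)"

datatype fp_prog =
    Skip
  | Assign nat fp_expr
  | Seq fp_prog fp_prog
  | If_less fp_expr fp_expr fp_prog fp_prog
  | While_less fp_expr fp_expr fp_prog

inductive exec :: "fp_arith \<Rightarrow> fp_prog \<Rightarrow> (nat \<Rightarrow> real) \<Rightarrow> (nat \<Rightarrow> real) \<Rightarrow> bool" for M where
  Skip: "exec M Skip s s"
| Assign: "exec M (Assign r a) s (s(r := eval_expr M a s))"
| Seq: "exec M p s t \<Longrightarrow> exec M q t w \<Longrightarrow> exec M (Seq p q) s w"
| If_True: "eval_expr M a s < eval_expr M b s \<Longrightarrow> exec M p s t \<Longrightarrow> exec M (If_less a b p q) s t"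
| If_False: "\<not> eval_expr M a s < eval_expr M b s \<Longrightarrow> exec M q s t \<Longrightarrow> exec M (If_less a b p q) s t"
| While_True: "eval_expr M a s < eval_expr M b s \<Longrightarrow> exec M p s t \<Longrightarrow>
    exec M (While_less a b p) t w \<Longrightarrow> exec M (While_less a b p) s w"
| While_False: "\<not> eval_expr M a s < eval_expr M b s \<Longrightarrow> exec M (While_less a b p) s s"

text \<open>\<open>returns M p xs ys\<close>: started on the input \<open>xs\<close>, stored in the first registers, \<open>p\<close> terminates
  with the output \<open>ys\<close> in the first registers.\<close>

definition returns :: "fp_arith \<Rightarrow> fp_prog \<Rightarrow> real list \<Rightarrow> real list \<Rightarrow> bool" where
  "returns M p xs ys \<longleftrightarrow>
     (\<exists>t. exec M p (\<lambda>r. if r < length xs then xs ! r else 0) t \<and> ys = map t [0..<length ys])"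

text \<open>The relative error of an approximation to 0 is undefined; there exactness is required.\<close>

definition hra :: "real \<Rightarrow> fp_arith \<Rightarrow> real \<Rightarrow> real \<Rightarrow> bool" where
  "hra K M x x' \<longleftrightarrow> (if x = 0 then x' = 0 else \<bar>x - x'\<bar> / \<bar>x\<bar> < K * roundoff M)"

definition obtains_hra :: "real \<Rightarrow> fp_arith \<Rightarrow> fp_prog \<Rightarrow> real list \<Rightarrow> real list \<Rightarrow> bool" where
  "obtains_hra K M p xs ys \<longleftrightarrow> (\<exists>ys'. returns M p xs ys' \<and> list_all2 (hra K M) ys ys')"

end

theory Submission
  imports Defs "Jordan_Normal_Form.Schur_Decomposition" "HOL-Library.Nat_Bijection"
begin

text \<open>With the lower triangular Pascal matrix \<open>P\<^sub>x = (binom(i, j) x\<^bsup>i - j\<^esup>)\<close> and \<open>d = \<alpha> \<beta> + \<gamma>\<close> one has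
  \<open>Lp = P\<^sub>\<beta> diag(d\<^sup>i) P\<^sub>\<alpha>\<^sup>T\<close>, and the bidiagonal factors multiply up to the Pascal matrices. By the
  Cauchy--Binet formula every minor of \<open>Lp\<close> is a subtraction-free expression in \<open>\<alpha>\<close>, \<open>\<beta>\<close> and \<open>d\<close>, whose
  coefficients are the minors of \<open>P\<^sub>1\<close>. These are nonnegative, and positive for the initial columns, where
  they are binomial determinants.

  The matrix \<open>Lp\<close> times a positive diagonal matrix is symmetric positive definite, so the eigenvalues
  \<open>\<lambda>\<^sub>1 \<ge> \<dots> \<ge> \<lambda>\<^sub>N\<close> are real and positive. The sum of the principal minors of order \<open>k\<close> of the \<open>p\<close>-th power is the
  \<open>k\<close>-th elementary symmetric polynomial of the \<open>\<lambda>\<^sub>i\<^sup>p\<close>, which agrees with \<open>(\<lambda>\<^sub>1 \<cdots> \<lambda>\<^sub>k)\<^sup>p\<close> up to a factor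
  of at most \<open>2\<^sup>N\<close>. Repeated squaring of the compound matrices is subtraction-free and therefore computes this
  sum for \<open>p = 2\<^sup>m\<close>, where \<open>2\<^sup>m\<close> is at least of the order of the inverse of the round-off. Then \<open>m\<close> successive
  square roots yield \<open>\<lambda>\<^sub>1 \<cdots> \<lambda>\<^sub>k\<close>, with an error that is uniform in the parameters. The singular values are
  treated in the same way. The inverse is explicit, with checkerboard signs.\<close>

section \<open>The Cauchy--Binet formula\<close>

text \<open>The obstacle is uniformity. The constants of the error bounds may depend on
  \<open>n\<close> alone, not on the parameters, the right-hand side or the precision, while the
  relative gaps between eigenvalues can be arbitrarily small. A method whose convergence is governed
  by ratios of eigenvalues would need ever more steps. Comparing a sum of nonnegative powers with
  its largest term involves no gap: the loss is at most the number of terms, and a root of order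
  about \<open>1 / u\<close> turns it into a relative error of order \<open>u\<close>.

  All programs but the first start from a computed decomposition, whose entries carry independent
  errors. Hence minors and inverse are written as expressions in these stored entries, with known
  values at the exact decomposition and free of subtractions apart from changes of sign.

  A program has neither integers nor an exact loop counter, so both loops of the eigenvalue program
  count by rounded doubling. Within one arithmetic this is a fixed function; replaying it from 1
  makes the number of square roots equal to the number of squarings.\<close>

definition ksubsets :: "nat \<Rightarrow> nat \<Rightarrow> nat set set" where
  "ksubsets n k = {K. K \<subseteq> {..<n} \<and> card K = k}"

lemma finite_ksubsets [simp]: "finite (ksubsets n k)"
  unfolding ksubsets_def by (rule finite_subset[of _ "Pow {..<n}"]) auto

lemma ksubsets_finite: "K \<in> ksubsets n k \<Longrightarrow> finite K"
  unfolding ksubsets_def using finite_subset by auto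

lemma ksubsets_pick_less: "K \<in> ksubsets n k \<Longrightarrow> a < k \<Longrightarrow> pick K a < n"
  using pick_in_set_le[of a K] unfolding ksubsets_def by auto

lemma ksubsets_pick_in: "K \<in> ksubsets n k \<Longrightarrow> a < k \<Longrightarrow> pick K a \<in> K"
  using pick_in_set_le[of a K] unfolding ksubsets_def by auto

lemma ksubsets_pick_mono: "K \<in> ksubsets n k \<Longrightarrow> a < b \<Longrightarrow> b < k \<Longrightarrow> pick K a < pick K b"
  using pick_mono_le[of b K a] unfolding ksubsets_def by auto

lemma bij_betw_pick:
  assumes "finite K"
  shows "bij_betw (pick K) {0..<card K} K"
proof -
  have inj: "inj_on (pick K) {0..<card K}"
    by (rule linorder_inj_onI) (use pick_mono_le[of _ K] in \<open>auto simp: less_le\<close>)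
  have "pick K ` {0..<card K} \<subseteq> K" using pick_in_set_le[of _ K] by auto
  with inj assms have "pick K ` {0..<card K} = K"
    by (intro card_subset_eq) (auto simp: card_image)
  with inj show ?thesis by (simp add: bij_betw_def)
qed

lemma submatrix_ksubsets:
  assumes "A \<in> carrier_mat nr nc" "I \<in> ksubsets nr k" "J \<in> ksubsets nc l"
  shows "submatrix A I J = mat k l (\<lambda>(a, b). A $$ (pick I a, pick J b))"
proof -
  have "{i. i < dim_row A \<and> i \<in> I} = I" "{j. j < dim_col A \<and> j \<in> J} = J"
    using assms unfolding ksubsets_def by auto
  then show ?thesis using assms unfolding submatrix_def ksubsets_def by simp
qed

text \<open>Each row of the product is a combination of the rows of \<open>Y\<close>, so
  multilinearity gives one term for every choice \<open>f\<close> of rows. Prescribing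
  \<open>f i = i\<close> outside \<open>{0..<k}\<close> makes the set of choices finite.\<close>

lemma det_rows_of_mult:
  fixes X Y :: "'a :: comm_ring_1 mat"
  assumes X: "X \<in> carrier_mat k n" and Y: "Y \<in> carrier_mat n k"
  shows "det (X * Y) = (\<Sum>f\<in>{f. (\<forall>i\<in>{0..<k}. f i \<in> {0..<n}) \<and> (\<forall>i. i \<notin> {0..<k} \<longrightarrow> f i = i)}.
     (\<Prod>i = 0..<k. X $$ (i, f i)) * det (mat\<^sub>r k k (\<lambda>i. row Y (f i))))"
proof -
  have "det (X * Y) = (\<Sum>f\<in>{f. (\<forall>i\<in>{0..<k}. f i \<in> {0..<n}) \<and> (\<forall>i. i \<notin> {0..<k} \<longrightarrow> f i = i)}.
     det (mat\<^sub>r k k (\<lambda>i. X $$ (i, f i) \<cdot>\<^sub>v row Y (f i))))"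
    unfolding mat_mul_finsum_alt[OF X Y]
    by (rule det_linear_rows_sum) (use X Y in auto)
  also have "\<dots> = (\<Sum>f\<in>{f. (\<forall>i\<in>{0..<k}. f i \<in> {0..<n}) \<and> (\<forall>i. i \<notin> {0..<k} \<longrightarrow> f i = i)}.
     (\<Prod>i = 0..<k. X $$ (i, f i)) * det (mat\<^sub>r k k (\<lambda>i. row Y (f i))))"
    by (intro sum.cong refl det_rows_mul) (use Y in auto)
  finally show ?thesis .
qed

text \<open>An injective choice of rows factors uniquely into its image and a permutation.\<close>

lemma sum_injective_choices:
  fixes g :: "(nat \<Rightarrow> nat) \<Rightarrow> 'b :: comm_monoid_add"
  shows "(\<Sum>f\<in>{f. (\<forall>i\<in>{0..<k}. f i \<in> {0..<n}) \<and> (\<forall>i. i \<notin> {0..<k} \<longrightarrow> f i = i) \<and> inj_on f {0..<k}}. g f)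
    = (\<Sum>K\<in>ksubsets n k. \<Sum>p\<in>{p. p permutes {0..<k}}. g (\<lambda>i. if i < k then pick K (p i) else i))"
proof -
  define h where "h = (\<lambda>(K, p :: nat \<Rightarrow> nat) i. if i < k then pick K (p i) else i)"
  define F where "F = {f. (\<forall>i\<in>{0..<k}. f i \<in> {0..<n}) \<and> (\<forall>i. i \<notin> {0..<k} \<longrightarrow> f i = i) \<and> inj_on f {0..<k}}"
  define S where "S = ksubsets n k \<times> {p. p permutes {0..<k}}"
  have pk: "pick K (p i) \<in> K" "p i < k" if "K \<in> ksubsets n k" "p permutes {0..<k}" "i < k" for K p i
    using that ksubsets_pick_in permutes_in_image[OF that(2), of i] by auto
  have im: "h (K, p) ` {0..<k} = K" if "K \<in> ksubsets n k" "p permutes {0..<k}" for K p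
  proof -
    have "h (K, p) ` {0..<k} = pick K ` p ` {0..<k}" by (auto simp: h_def)
    also have "\<dots> = K" using that bij_betw_pick[OF ksubsets_finite[OF that(1)]]
      by (simp add: permutes_image bij_betw_def ksubsets_def)
    finally show ?thesis .
  qed
  have injp: "inj_on (pick K) {0..<k}" if "K \<in> ksubsets n k" for K
    using bij_betw_pick[OF ksubsets_finite[OF that]] that by (simp add: bij_betw_def ksubsets_def)
  have "bij_betw h S F"
  proof (rule bij_betw_imageI)
    show "inj_on h S"
    proof (rule inj_onI, clarify)
      fix K p K' p' assume *: "(K, p) \<in> S" "(K', p') \<in> S" and eq: "h (K, p) = h (K', p')"
      from * have K: "K \<in> ksubsets n k" "K' \<in> ksubsets n k" and p: "p permutes {0..<k}" "p' permutes {0..<k}"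
        by (auto simp: S_def)
      from im[OF K(1) p(1)] im[OF K(2) p(2)] eq have KK: "K = K'" by simp
      moreover have "p = p'"
      proof
        fix i show "p i = p' i"
        proof (cases "i < k")
          case True
          from fun_cong[OF eq, of i] True KK have "pick K (p i) = pick K (p' i)" by (simp add: h_def)
          with injp[OF K(1)] pk(2)[OF K(1) p(1) True] pk(2)[OF K(2) p(2) True] show ?thesis
            by (auto dest: inj_onD)
        next
          case False then show ?thesis using p by (auto simp: permutes_def)
        qed
      qed
      ultimately show "K = K' \<and> p = p'" by simp
    qed
    show "h ` S = F"
    proof (intro equalityI subsetI)
      fix f assume "f \<in> h ` S"
      then obtain K p where K: "K \<in> ksubsets n k" and p: "p permutes {0..<k}" and f: "f = h (K, p)"
        by (auto simp: S_def)
      have "inj_on f {0..<k}"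
        using im[OF K p] K by (intro eq_card_imp_inj_on) (auto simp: f ksubsets_def)
      then show "f \<in> F" using pk(2)[OF K p] ksubsets_pick_less[OF K] by (auto simp: F_def f h_def)
    next
      fix f assume f: "f \<in> F"
      define K where "K = f ` {0..<k}"
      have inj: "inj_on f {0..<k}" using f by (simp add: F_def)
      have cK: "card K = k" using inj by (simp add: K_def card_image)
      have K: "K \<in> ksubsets n k" using f cK by (auto simp: F_def K_def ksubsets_def)
      have bp: "bij_betw (pick K) {0..<k} K" using bij_betw_pick[of K] cK by (simp add: K_def)
      define p where "p = (\<lambda>i. if i < k then the_inv_into {0..<k} (pick K) (f i) else i)"
      have "bij_betw (\<lambda>i. the_inv_into {0..<k} (pick K) (f i)) {0..<k} {0..<k}"
        using bij_betw_trans[OF inj_on_imp_bij_betw[OF inj, folded K_def] bij_betw_the_inv_into[OF bp]]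
        by (simp add: o_def)
      then have "bij_betw p {0..<k} {0..<k}"
        by (rule bij_betw_cong[THEN iffD1, rotated]) (simp add: p_def)
      then have p: "p permutes {0..<k}" by (rule bij_imp_permutes) (simp add: p_def)
      have "h (K, p) = f"
      proof
        fix i show "h (K, p) i = f i"
          using f f_the_inv_into_f_bij_betw[OF bp, of "f i"] by (auto simp: h_def p_def K_def F_def)
      qed
      with K p show "f \<in> h ` S" by (force simp: S_def)
    qed
  qed
  from sum.reindex_bij_betw[OF this, of g, symmetric] show ?thesis
    unfolding F_def S_def by (simp add: sum.cartesian_product h_def case_prod_unfold)
qed

text \<open>A choice that takes a row of \<open>Y\<close> twice contributes 0. The remaining ones
  are grouped by their image \<open>K\<close>; the signs of the permutations then reassemble the
  determinant of the columns \<open>K\<close> of \<open>X\<close>.\<close>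

lemma Cauchy_Binet:
  fixes X Y :: "'a :: comm_ring_1 mat"
  assumes X: "X \<in> carrier_mat k n" and Y: "Y \<in> carrier_mat n k"
  shows "det (X * Y) = (\<Sum>K\<in>ksubsets n k.
    det (mat k k (\<lambda>(i, j). X $$ (i, pick K j))) * det (mat k k (\<lambda>(i, j). Y $$ (pick K i, j))))"
proof -
  let ?F = "{f. (\<forall>i\<in>{0..<k}. f i \<in> {0..<n}) \<and> (\<forall>i. i \<notin> {0..<k} \<longrightarrow> f i = i)}"
  let ?G = "{f. (\<forall>i\<in>{0..<k}. f i \<in> {0..<n}) \<and> (\<forall>i. i \<notin> {0..<k} \<longrightarrow> f i = i) \<and> inj_on f {0..<k}}"
  let ?t = "\<lambda>f. (\<Prod>i = 0..<k. X $$ (i, f i)) * det (mat\<^sub>r k k (\<lambda>i. row Y (f i)))"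
  have fin: "finite ?F" by (rule finite_bounded_functions) auto
  have "det (X * Y) = sum ?t ?F" by (rule det_rows_of_mult[OF X Y])
  also have "\<dots> = sum ?t ?G"
  proof (rule sum.mono_neutral_right[OF fin])
    show "\<forall>f\<in>?F - ?G. ?t f = 0"
    proof
      fix f assume "f \<in> ?F - ?G"
      then obtain i j where ij: "i < k" "j < k" "i \<noteq> j" "f i = f j" by (auto simp: inj_on_def)
      have "det (mat\<^sub>r k k (\<lambda>i. row Y (f i))) = 0"
        by (rule det_identical_rows[of _ k i j]) (use ij Y in auto)
      then show "?t f = 0" by simp
    qed
  qed auto
  also have "\<dots> = (\<Sum>K\<in>ksubsets n k. \<Sum>p\<in>{p. p permutes {0..<k}}. ?t (\<lambda>i. if i < k then pick K (p i) else i))"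
    by (rule sum_injective_choices)
  also have "\<dots> = (\<Sum>K\<in>ksubsets n k.
    det (mat k k (\<lambda>(i, j). X $$ (i, pick K j))) * det (mat k k (\<lambda>(i, j). Y $$ (pick K i, j))))"
  proof (rule sum.cong[OF refl])
    fix K assume K: "K \<in> ksubsets n k"
    let ?X = "mat k k (\<lambda>(i, j). X $$ (i, pick K j))" and ?Y = "mat k k (\<lambda>(i, j). Y $$ (pick K i, j))"
    have "?t (\<lambda>i. if i < k then pick K (p i) else i) = signof p * (\<Prod>i = 0..<k. ?X $$ (i, p i)) * det ?Y"
      if p: "p permutes {0..<k}" for p
    proof -
      have pi: "p i < k" if "i < k" for i using permutes_in_image[OF p, of i] that by auto
      have "mat\<^sub>r k k (\<lambda>i. row Y (if i < k then pick K (p i) else i)) = mat k k (\<lambda>(i, j). ?Y $$ (p i, j))"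
        by (rule eq_matI) (use pi Y K ksubsets_pick_less in auto)
      then have "det (mat\<^sub>r k k (\<lambda>i. row Y (if i < k then pick K (p i) else i))) = signof p * det ?Y"
        using det_permute_rows[OF _ p, of ?Y] by simp
      then show ?thesis using pi by (simp add: mult_ac)
    qed
    then have "(\<Sum>p\<in>{p. p permutes {0..<k}}. ?t (\<lambda>i. if i < k then pick K (p i) else i))
      = (\<Sum>p\<in>{p. p permutes {0..<k}}. signof p * (\<Prod>i = 0..<k. ?X $$ (i, p i)) * det ?Y)"
      by (intro sum.cong) auto
    also have "\<dots> = det ?X * det ?Y"
      by (subst det_def'[of ?X k]) (auto simp: sum_distrib_right)
    finally show "(\<Sum>p\<in>{p. p permutes {0..<k}}. ?t (\<lambda>i. if i < k then pick K (p i) else i)) = det ?X * det ?Y" .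
  qed
  finally show ?thesis .
qed

section \<open>Minors and compound matrices\<close>

abbreviation minor :: "'a :: comm_ring_1 mat \<Rightarrow> nat set \<Rightarrow> nat set \<Rightarrow> 'a" where
  "minor A I J \<equiv> det (submatrix A I J)"

text \<open>Compound matrices, whose entries are all minors of a fixed order, multiply like the
  matrices themselves. Total nonnegativity of products, the squaring loop and the minors of the Gram
  matrix all rest on this form of Cauchy--Binet.\<close>

lemma minor_mult:
  fixes A B :: "'a :: comm_ring_1 mat"
  assumes A: "A \<in> carrier_mat nr n" and B: "B \<in> carrier_mat n nc"
    and I: "I \<in> ksubsets nr k" and J: "J \<in> ksubsets nc k"
  shows "minor (A * B) I J = (\<Sum>K\<in>ksubsets n k. minor A I K * minor B K J)"
proof -
  let ?X = "mat k n (\<lambda>(a, j). A $$ (pick I a, j))" and ?Y = "mat n k (\<lambda>(i, b). B $$ (i, pick J b))"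
  have "submatrix (A * B) I J = ?X * ?Y"
    unfolding submatrix_ksubsets[OF mult_carrier_mat[OF A B] I J]
    by (rule eq_matI) (use A B ksubsets_pick_less[OF I] ksubsets_pick_less[OF J] in
      \<open>auto simp: scalar_prod_def\<close>)
  then have "minor (A * B) I J = det (?X * ?Y)" by simp
  also have "\<dots> = (\<Sum>K\<in>ksubsets n k.
    det (mat k k (\<lambda>(i, j). ?X $$ (i, pick K j))) * det (mat k k (\<lambda>(i, j). ?Y $$ (pick K i, j))))"
    by (rule Cauchy_Binet) auto
  also have "\<dots> = (\<Sum>K\<in>ksubsets n k. minor A I K * minor B K J)"
  proof (intro sum.cong refl arg_cong2[of _ _ _ _ "(*)"])
    fix K assume K: "K \<in> ksubsets n k"
    show "det (mat k k (\<lambda>(i, j). ?X $$ (i, pick K j))) = minor A I K"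
      unfolding submatrix_ksubsets[OF A I K]
      by (rule arg_cong[of _ _ det], rule eq_matI) (use ksubsets_pick_less[OF K] in auto)
    show "det (mat k k (\<lambda>(i, j). ?Y $$ (pick K i, j))) = minor B K J"
      unfolding submatrix_ksubsets[OF B K J]
      by (rule arg_cong[of _ _ det], rule eq_matI) (use ksubsets_pick_less[OF K] in auto)
  qed
  finally show ?thesis .
qed

lemma minor_transpose:
  assumes A: "A \<in> carrier_mat nr nc" and I: "I \<in> ksubsets nr k" and J: "J \<in> ksubsets nc k"
  shows "minor (transpose_mat A) J I = minor A I J"
proof -
  have "submatrix (transpose_mat A) J I = transpose_mat (submatrix A I J)"
    using A by (simp add: submatrix_ksubsets[OF A I J] submatrix_ksubsets[OF transpose_carrier_mat[THEN iffD2, OF A] J I])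
      (rule eq_matI, use ksubsets_pick_less[OF I] ksubsets_pick_less[OF J] in auto)
  moreover have "submatrix A I J \<in> carrier_mat k k" by (simp add: submatrix_ksubsets[OF A I J])
  ultimately show ?thesis by (simp add: det_transpose)
qed

lemma prod_pick:
  assumes "K \<in> ksubsets n k"
  shows "(\<Prod>a = 0..<k. f (pick K a)) = (\<Prod>i\<in>K. f i)"
  using prod.reindex_bij_betw[OF bij_betw_pick[OF ksubsets_finite[OF assms]], of f] assms
  by (simp add: ksubsets_def)

text \<open>\<open>pick\<close> is increasing, so a principal submatrix inherits the triangular
  shape.\<close>

lemma minor_upper_triangular:
  assumes A: "A \<in> carrier_mat n n" and ut: "upper_triangular A" and I: "I \<in> ksubsets n k"
  shows "minor A I I = (\<Prod>i\<in>I. A $$ (i, i))"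
proof -
  have "upper_triangular (submatrix A I I)"
    unfolding submatrix_ksubsets[OF A I I]
    by (rule upper_triangularI) (use A ut ksubsets_pick_less[OF I] ksubsets_pick_mono[OF I] in auto)
  then have "minor A I I = prod_list (diag_mat (submatrix A I I))"
    by (rule det_upper_triangular[of _ k]) (simp add: submatrix_ksubsets[OF A I I])
  also have "\<dots> = (\<Prod>a = 0..<k. A $$ (pick I a, pick I a))"
    unfolding submatrix_ksubsets[OF A I I] diag_mat_def
    by (simp add: prod.list_conv_set_nth)
  also have "\<dots> = (\<Prod>i\<in>I. A $$ (i, i))" by (rule prod_pick[OF I])
  finally show ?thesis .
qed

lemma minor_mat_diag:
  assumes I: "I \<in> ksubsets n k" and J: "J \<in> ksubsets n k"
  shows "minor (mat_diag n f) I J = (if I = J then \<Prod>i\<in>I. f i else 0)"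
proof (cases "I = J")
  case True
  have "upper_triangular (mat_diag n f)" by (auto simp: mat_diag_def)
  from minor_upper_triangular[OF mat_diag_dim this I] True show ?thesis
    using I by (auto simp: mat_diag_def ksubsets_def intro!: prod.cong)
next
  case False
  \<comment> \<open>For distinct sets of equal size some row index is missing among the columns, and
    its row of the submatrix vanishes.\<close>
  have "\<not> I \<subseteq> J"
    using False I J card_subset_eq[of J I] ksubsets_finite[OF J] by (auto simp: ksubsets_def)
  then obtain i where i: "i \<in> I" "i \<notin> J" by auto
  obtain a where a: "a < k" "pick I a = i"
    using bij_betw_pick[OF ksubsets_finite[OF I]] i I by (force simp: bij_betw_def ksubsets_def)
  let ?M = "submatrix (mat_diag n f) I J"
  have M: "?M = mat k k (\<lambda>(a, b). mat_diag n f $$ (pick I a, pick J b))"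
    by (rule submatrix_ksubsets[OF mat_diag_dim I J])
  have "?M $$ (a, p a) = 0" if p: "p permutes {0..<k}" for p
  proof -
    have "p a < k" using permutes_in_image[OF p, of a] a by auto
    moreover have "pick J (p a) \<noteq> i" using ksubsets_pick_in[OF J \<open>p a < k\<close>] i by auto
    ultimately show ?thesis
      unfolding M using a ksubsets_pick_less[OF I a(1)] ksubsets_pick_less[OF J \<open>p a < k\<close>]
      by (simp add: mat_diag_def)
  qed
  then have "(\<Prod>b = 0..<k. ?M $$ (b, p b)) = 0" if "p permutes {0..<k}" for p
    using that a(1) by (intro prod_zero bexI[of _ a]) auto
  then have "det ?M = 0" by (subst det_def'[of _ k]) (auto simp: M)
  then show ?thesis using False by simp
qed

lemma minor_one:
  assumes I: "I \<in> ksubsets n k" and J: "J \<in> ksubsets n k"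
  shows "minor (1\<^sub>m n :: 'a :: comm_ring_1 mat) I J = (if I = J then 1 else 0)"
  using minor_mat_diag[OF I J, of "\<lambda>_. 1 :: 'a"] by simp

section \<open>Traces of compound matrices\<close>

definition ktrace :: "nat \<Rightarrow> 'a :: comm_ring_1 mat \<Rightarrow> 'a" where
  "ktrace k A = (\<Sum>I\<in>ksubsets (dim_row A) k. minor A I I)"

lemma ktrace_commute:
  assumes A: "A \<in> carrier_mat n n" and B: "B \<in> carrier_mat n n"
  shows "ktrace k (A * B) = ktrace k (B * A)"
proof -
  have "ktrace k (A * B) = (\<Sum>I\<in>ksubsets n k. \<Sum>K\<in>ksubsets n k. minor A I K * minor B K I)"
    using A by (simp add: ktrace_def minor_mult[OF A B])
  also have "\<dots> = (\<Sum>K\<in>ksubsets n k. \<Sum>I\<in>ksubsets n k. minor B K I * minor A I K)"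
    by (subst sum.swap) (simp add: mult.commute)
  also have "\<dots> = ktrace k (B * A)"
    using B by (simp add: ktrace_def minor_mult[OF B A])
  finally show ?thesis .
qed

lemma ktrace_similar:
  assumes "similar_mat_wit A B P Q"
  shows "ktrace k A = ktrace k B"
proof -
  define n where "n = dim_row A"
  note * = similar_mat_witD[OF n_def assms]
  have "ktrace k A = ktrace k (P * (B * Q))" using * assoc_mult_mat[of P n n B n Q n] by simp
  also have "\<dots> = ktrace k (B * Q * P)" by (rule ktrace_commute[of _ n]) (use * in auto)
  also have "B * Q * P = B" using * assoc_mult_mat[of B n n Q n P n] by simp
  finally show ?thesis .
qed

lemma upper_triangular_mult:
  fixes A B :: "'a :: semiring_0 mat"
  assumes "A \<in> carrier_mat n n" "B \<in> carrier_mat n n" "upper_triangular A" "upper_triangular B"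
  shows "upper_triangular (A * B)"
    and "i < n \<Longrightarrow> (A * B) $$ (i, i) = A $$ (i, i) * B $$ (i, i)"
proof -
  have *: "(A * B) $$ (i, j) = (\<Sum>l = 0..<n. A $$ (i, l) * B $$ (l, j))" if "i < n" "j < n" for i j
    using that assms by (simp add: scalar_prod_def)
  have z: "A $$ (i, l) * B $$ (l, j) = 0" if "i < n" "l < n" "l < i \<or> j < l" for i j l
    using that assms by (auto dest: upper_triangularD)
  show "upper_triangular (A * B)"
  proof (rule upper_triangularI)
    fix i j assume ij: "j < i" "i < dim_row (A * B)"
    then have "(A * B) $$ (i, j) = (\<Sum>l = 0..<n. A $$ (i, l) * B $$ (l, j))" using assms by (intro *) auto
    also have "\<dots> = 0" using ij assms by (intro sum.neutral ballI z) auto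
    finally show "(A * B) $$ (i, j) = 0" .
  qed
  show "(A * B) $$ (i, i) = A $$ (i, i) * B $$ (i, i)" if i: "i < n"
  proof -
    have "(A * B) $$ (i, i) = (\<Sum>l\<in>{i}. A $$ (i, l) * B $$ (l, i))"
      unfolding *[OF i i] by (rule sum.mono_neutral_right) (use i in \<open>auto intro!: z\<close>)
    then show ?thesis by simp
  qed
qed

lemma upper_triangular_pow:
  fixes A :: "'a :: comm_ring_1 mat"
  assumes "A \<in> carrier_mat n n" "upper_triangular A"
  shows "upper_triangular (A ^\<^sub>m p) \<and> (\<forall>i<n. (A ^\<^sub>m p) $$ (i, i) = A $$ (i, i) ^ p)"
proof (induction p)
  case (Suc p)
  then show ?case
    using upper_triangular_mult[of "A ^\<^sub>m p" n A] assms by (auto simp: mult.commute)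
qed (use assms in auto)

text \<open>Schur triangularization places \<open>es\<close> on the diagonal, where powers and
  principal minors can be read off. The result is the \<open>k\<close>-th elementary symmetric
  polynomial of the \<open>p\<close>-th powers; the subsets index positions of the list, which
  accounts for multiplicities.\<close>

lemma ktrace_pow:
  fixes A :: "real mat"
  assumes A: "A \<in> carrier_mat n n" and cp: "char_poly A = (\<Prod>e\<leftarrow>es. [:- e, 1:])"
  shows "ktrace k (A ^\<^sub>m p) = (\<Sum>I\<in>ksubsets n k. \<Prod>i\<in>I. es ! i ^ p)"
proof -
  obtain B P Q where sd: "schur_decomposition A es = (B, P, Q)" by (metis prod_cases3)
  from schur_decomposition[OF A cp sd]
  have sim: "similar_mat_wit A B P Q" and ut: "upper_triangular B" and dg: "diag_mat B = es" by auto
  from similar_mat_witD2[OF A sim] have B: "B \<in> carrier_mat n n" by auto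
  have Bii: "B $$ (i, i) = es ! i" if "i < n" for i
    using that B dg[symmetric] by (simp add: diag_mat_def)
  have "ktrace k (A ^\<^sub>m p) = ktrace k (B ^\<^sub>m p)"
    by (rule ktrace_similar[OF similar_mat_wit_pow[OF sim]])
  also have "\<dots> = (\<Sum>I\<in>ksubsets n k. minor (B ^\<^sub>m p) I I)" using B by (simp add: ktrace_def)
  also have "\<dots> = (\<Sum>I\<in>ksubsets n k. \<Prod>i\<in>I. es ! i ^ p)"
  proof (rule sum.cong[OF refl])
    fix I assume I: "I \<in> ksubsets n k"
    have "minor (B ^\<^sub>m p) I I = (\<Prod>i\<in>I. (B ^\<^sub>m p) $$ (i, i))"
      by (rule minor_upper_triangular[OF _ _ I]) (use B ut upper_triangular_pow in auto)
    also have "\<dots> = (\<Prod>i\<in>I. es ! i ^ p)"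
      using upper_triangular_pow[OF B ut, of p] Bii I by (intro prod.cong) (auto simp: ksubsets_def)
    finally show "minor (B ^\<^sub>m p) I I = (\<Prod>i\<in>I. es ! i ^ p)" .
  qed
  finally show ?thesis .
qed

section \<open>Pascal matrices\<close>

definition pascal :: "nat \<Rightarrow> real \<Rightarrow> real mat" where
  "pascal N x = mat N N (\<lambda>(i, j). of_nat (i choose j) * x ^ (i - j))"

lemma pascal_carrier [simp]: "pascal N x \<in> carrier_mat N N"
  by (simp add: pascal_def)

lemma pascal_index [simp]:
  "i < N \<Longrightarrow> j < N \<Longrightarrow> pascal N x $$ (i, j) = of_nat (i choose j) * x ^ (i - j)"
  by (simp add: pascal_def)

lemma pascal_dim [simp]: "dim_row (pascal N x) = N" "dim_col (pascal N x) = N"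
  by (simp_all add: pascal_def)

text \<open>Pascal's rule with weights. Where \<open>i - l\<close> is truncated, the binomial
  coefficient next to it is 0.\<close>

lemma pascal_step:
  fixes x :: real
  shows "of_nat (Suc i choose l) * x ^ (Suc i - l) =
    x * (of_nat (i choose l) * x ^ (i - l)) + (case l of 0 \<Rightarrow> 0 | Suc l' \<Rightarrow> of_nat (i choose l') * x ^ (i - l'))"
proof (cases l)
  case (Suc l')
  show ?thesis
  proof (cases "l \<le> i")
    case True
    then have "i - l' = Suc (i - l)" using Suc by simp
    then show ?thesis by (simp add: Suc algebra_simps)
  qed (use Suc in \<open>auto simp: not_le\<close>)
qed simp

lemma sum_case_nat_shift:
  "(\<Sum>l<Suc M. case l of 0 \<Rightarrow> 0 | Suc l' \<Rightarrow> f l') = (\<Sum>l<M. f l :: real)"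
  by (subst sum.lessThan_Suc_shift) simp

text \<open>Pascal's rule splits the two weighted binomials of the next row and column into
  \<open>\<beta> p + p'\<close> and \<open>\<alpha> q + q'\<close>. In \<open>p' q'\<close> both
  indices are shifted, which yields a factor \<open>d = \<alpha> \<beta> + \<gamma>\<close>. The
  first two terms of the recurrence together count \<open>\<alpha> \<beta> S\<close> twice instead
  of once, and \<open>\<gamma> S = d S - \<alpha> \<beta> S\<close> corrects this. Any
  \<open>M\<close> above \<open>i\<close> is allowed, so that all entries can share one range of
  summation.\<close>

lemma Lp_entry_sum:
  assumes "i < M"
  shows "Lp_entry \<alpha> \<beta> \<gamma> i j = (\<Sum>l<M. (of_nat (i choose l) * \<beta> ^ (i - l)) *
    (\<alpha> * \<beta> + \<gamma>) ^ l * (of_nat (j choose l) * \<alpha> ^ (j - l)))"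
  using assms
proof (induction \<alpha> \<beta> \<gamma> i j arbitrary: M rule: Lp_entry.induct)
  case (1 \<alpha> \<beta> \<gamma> j)
  have "(\<Sum>l<M. (of_nat (0 choose l) * \<beta> ^ (0 - l)) * (\<alpha> * \<beta> + \<gamma>) ^ l * (of_nat (j choose l) * \<alpha> ^ (j - l)))
    = (\<Sum>l\<in>{0}. (of_nat (0 choose l) * \<beta> ^ (0 - l)) * (\<alpha> * \<beta> + \<gamma>) ^ l * (of_nat (j choose l) * \<alpha> ^ (j - l)))"
    by (rule sum.mono_neutral_right) (use 1 in \<open>auto simp: binomial_eq_0\<close>)
  then show ?case by simp
next
  case (2 \<alpha> \<beta> \<gamma> i)
  have "(\<Sum>l<M. (of_nat (Suc i choose l) * \<beta> ^ (Suc i - l)) * (\<alpha> * \<beta> + \<gamma>) ^ l * (of_nat (0 choose l) * \<alpha> ^ (0 - l)))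
    = (\<Sum>l\<in>{0}. (of_nat (Suc i choose l) * \<beta> ^ (Suc i - l)) * (\<alpha> * \<beta> + \<gamma>) ^ l * (of_nat (0 choose l) * \<alpha> ^ (0 - l)))"
    by (rule sum.mono_neutral_right) (use 2 in \<open>auto simp: binomial_eq_0\<close>)
  then show ?case by simp
next
  case (3 \<alpha> \<beta> \<gamma> i j)
  define d where "d = \<alpha> * \<beta> + \<gamma>"
  define p where "p = (\<lambda>i l. real (i choose l) * \<beta> ^ (i - l))"
  define q where "q = (\<lambda>i l. real (i choose l) * \<alpha> ^ (i - l))"
  define p' where "p' = (\<lambda>l. case l of 0 \<Rightarrow> 0 | Suc l' \<Rightarrow> p i l')"
  define q' where "q' = (\<lambda>l. case l of 0 \<Rightarrow> 0 | Suc l' \<Rightarrow> q j l')"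
  have ps: "p (Suc i) l = \<beta> * p i l + p' l" and qs: "q (Suc j) l = \<alpha> * q j l + q' l" for l
    unfolding p_def q_def p'_def q'_def by (rule pascal_step)+
  obtain M' where M: "M = Suc M'" and M': "i < M'" using "3.prems" by (cases M) auto
  have diag: "(\<Sum>l<M. p' l * d ^ l * q' l) = d * (\<Sum>l<M. p i l * d ^ l * q j l)"
  proof -
    have "(\<Sum>l<M. p' l * d ^ l * q' l) = (\<Sum>l<M. case l of 0 \<Rightarrow> 0 | Suc l' \<Rightarrow> p i l' * d ^ Suc l' * q j l')"
      by (intro sum.cong refl) (simp add: p'_def q'_def split: nat.splits)
    also have "\<dots> = (\<Sum>l<M'. p i l * d ^ Suc l * q j l)"
      unfolding M by (rule sum_case_nat_shift)
    also have "\<dots> = (\<Sum>l<M. p i l * d ^ Suc l * q j l)"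
      using M' by (simp add: M p_def)
    also have "\<dots> = d * (\<Sum>l<M. p i l * d ^ l * q j l)"
      unfolding sum_distrib_left by (intro sum.cong refl) (simp add: mult_ac)
    finally show ?thesis .
  qed
  have IH: "Lp_entry \<alpha> \<beta> \<gamma> (Suc i) j = (\<Sum>l<M. p (Suc i) l * d ^ l * q j l)"
    "Lp_entry \<alpha> \<beta> \<gamma> i (Suc j) = (\<Sum>l<M. p i l * d ^ l * q (Suc j) l)"
    "Lp_entry \<alpha> \<beta> \<gamma> i j = (\<Sum>l<M. p i l * d ^ l * q j l)"
    using "3.IH" "3.prems" unfolding p_def q_def d_def by auto
  define S where "S = (\<Sum>l<M. p i l * d ^ l * q j l)"
  define U where "U = (\<Sum>l<M. p' l * d ^ l * q j l)"
  define V where "V = (\<Sum>l<M. p i l * d ^ l * q' l)"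
  have "(\<Sum>l<M. p (Suc i) l * d ^ l * q j l) = \<beta> * S + U"
    unfolding ps S_def U_def by (simp add: algebra_simps sum.distrib sum_distrib_left)
  moreover have "(\<Sum>l<M. p i l * d ^ l * q (Suc j) l) = \<alpha> * S + V"
    unfolding qs S_def V_def by (simp add: algebra_simps sum.distrib sum_distrib_left)
  moreover have "(\<Sum>l<M. p (Suc i) l * d ^ l * q (Suc j) l) = \<alpha> * \<beta> * S + \<alpha> * U + \<beta> * V + (\<Sum>l<M. p' l * d ^ l * q' l)"
    unfolding ps qs S_def U_def V_def
    by (simp add: algebra_simps sum.distrib sum_distrib_left)
  moreover have gS: "\<gamma> * S = d * S - \<alpha> * \<beta> * S" by (simp add: d_def algebra_simps)
  ultimately have "Lp_entry \<alpha> \<beta> \<gamma> (Suc i) (Suc j) = (\<Sum>l<M. p (Suc i) l * d ^ l * q (Suc j) l)"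
    using IH diag gS unfolding S_def[symmetric] Lp_entry.simps by (simp add: algebra_simps)
  then show ?case by (simp add: p_def q_def d_def)
qed

lemma pascal_add_sum:
  assumes "i < M"
  shows "(\<Sum>l<M. (of_nat (i choose l) * x ^ (i - l)) * (of_nat (l choose j) * y ^ (l - j)))
    = of_nat (i choose j) * (x + y :: real) ^ (i - j)"
  using assms
proof (induction i arbitrary: j M)
  case 0
  have "(\<Sum>l<M. (of_nat (0 choose l) * x ^ (0 - l)) * (of_nat (l choose j) * y ^ (l - j)))
    = (\<Sum>l\<in>{0}. (of_nat (0 choose l) * x ^ (0 - l)) * (of_nat (l choose j) * y ^ (l - j)))"
    by (rule sum.mono_neutral_right) (use 0 in \<open>auto simp: binomial_eq_0\<close>)
  then show ?case by (cases j) auto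
next
  case (Suc i)
  define p where "p = (\<lambda>x i l. real (i choose l) * x ^ (i - l))"
  obtain M' where M: "M = Suc M'" and M': "i < M'" using Suc.prems by (cases M) auto
  have step: "p z (Suc i) l = z * p z i l + (case l of 0 \<Rightarrow> 0 | Suc l' \<Rightarrow> p z i l')" for z i l
    unfolding p_def by (rule pascal_step)
  have "(\<Sum>l<M. p x (Suc i) l * p y l j) = (\<Sum>l<M. x * (p x i l * p y l j) +
      (case l of 0 \<Rightarrow> 0 | Suc l' \<Rightarrow> p x i l' * p y (Suc l') j))"
    by (intro sum.cong refl) (simp add: step algebra_simps split: nat.split)
  also have "\<dots> = x * (\<Sum>l<M. p x i l * p y l j) +
      (\<Sum>l<Suc M'. case l of 0 \<Rightarrow> 0 | Suc l' \<Rightarrow> p x i l' * p y (Suc l') j)"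
    by (simp add: sum.distrib sum_distrib_left M del: sum.lessThan_Suc)
  also have "(\<Sum>l<Suc M'. case l of 0 \<Rightarrow> 0 | Suc l' \<Rightarrow> p x i l' * p y (Suc l') j) = (\<Sum>l<M'. p x i l * p y (Suc l) j)"
    by (rule sum_case_nat_shift)
  also have "\<dots> = (\<Sum>l<M'. y * (p x i l * p y l j) + (case j of 0 \<Rightarrow> 0 | Suc j' \<Rightarrow> p x i l * p y l j'))"
    by (intro sum.cong refl) (simp add: step algebra_simps split: nat.split)
  also have "\<dots> = y * (\<Sum>l<M'. p x i l * p y l j) + (case j of 0 \<Rightarrow> 0 | Suc j' \<Rightarrow> \<Sum>l<M'. p x i l * p y l j')"
    by (simp add: sum.distrib sum_distrib_left split: nat.split)
  also have "x * (\<Sum>l<M. p x i l * p y l j) + \<dots> =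
      x * p (x + y) i j + (y * p (x + y) i j + (case j of 0 \<Rightarrow> 0 | Suc j' \<Rightarrow> p (x + y) i j'))"
    using Suc.IH[of M] Suc.IH[of M'] M M' by (auto simp: p_def split: nat.split)
  also have "\<dots> = p (x + y) (Suc i) j" by (simp add: step algebra_simps)
  finally show ?case by (simp add: p_def)
qed

text \<open>The Pascal matrices form a one-parameter group. With \<open>pascal_0\<close> this makes
  \<open>pascal N (- x)\<close> the inverse of \<open>pascal N x\<close>, which is the source of the
  checkerboard signs.\<close>

lemma pascal_mult: "pascal N x * pascal N y = pascal N (x + y)"
proof (rule eq_matI)
  fix i j assume ij: "i < dim_row (pascal N (x + y))" "j < dim_col (pascal N (x + y))"
  then have "(pascal N x * pascal N y) $$ (i, j) =
    (\<Sum>l<N. (of_nat (i choose l) * x ^ (i - l)) * (of_nat (l choose j) * y ^ (l - j)))"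
    by (simp add: scalar_prod_def atLeast0LessThan)
  then show "(pascal N x * pascal N y) $$ (i, j) = pascal N (x + y) $$ (i, j)"
    using ij pascal_add_sum[of i N x j y] by simp
qed simp_all

lemma pascal_0: "pascal N 0 = 1\<^sub>m N"
  by (rule eq_matI) (auto simp: power_0_left not_less binomial_eq_0 le_eq_less_or_eq)

subsection \<open>Bidiagonal factors\<close>

text \<open>Row \<open>r\<close> is affected only by the factors with index at most
  \<open>r\<close>, and each of them adds \<open>\<beta>\<close> times the row above. By Pascal's
  rule the upper index of the binomial grows by 1 per factor until it stops at \<open>r\<close>,
  hence \<open>min r k\<close>.\<close>

lemma lower_product_const:
  assumes B: "B \<in> carrier_mat N N" and c: "\<And>r c. c < r \<Longrightarrow> r < N \<Longrightarrow> B $$ (r, c) = \<beta>"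
  shows "lower_product B k = mat N N (\<lambda>(r, c). if c \<le> r then of_nat (min r k choose (r - c)) * \<beta> ^ (r - c) else 0)"
proof (induction k)
  case 0
  show ?case using B by (intro eq_matI) auto
next
  case (Suc k)
  let ?L = "\<lambda>k. mat N N (\<lambda>(r, c). if c \<le> r then of_nat (min r k choose (r - c)) * \<beta> ^ (r - c) else 0)"
  have "lower_factor B (Suc k) * ?L k = ?L (Suc k)"
  proof (rule eq_matI)
    fix r c assume rc: "r < dim_row (?L (Suc k))" "c < dim_col (?L (Suc k))"
    have "(lower_factor B (Suc k) * ?L k) $$ (r, c) =
      (\<Sum>l = 0..<N. lower_factor B (Suc k) $$ (r, l) * ?L k $$ (l, c))"
      using rc B by (simp add: scalar_prod_def lower_factor_def)
    also have "\<dots> = (\<Sum>l\<in>{l. l < N \<and> (l = r \<or> r = Suc l)}. lower_factor B (Suc k) $$ (r, l) * ?L k $$ (l, c))"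
      by (rule sum.mono_neutral_right) (use rc B in \<open>auto simp: lower_factor_def\<close>)
    also have "\<dots> = ?L (Suc k) $$ (r, c)"
    proof (cases r)
      case 0
      then have "{l. l < N \<and> (l = r \<or> r = Suc l)} = {0}" using rc by auto
      then show ?thesis using 0 rc B by (auto simp: lower_factor_def)
    next
      case (Suc r')
      then have *: "{l. l < N \<and> (l = r \<or> r = Suc l)} = {r, r'}" using rc by auto
      show ?thesis
      proof (cases "c \<le> r'")
        case True
        then have rc': "Suc r' - c = Suc (r' - c)" by simp
        have "B $$ (Suc r', r' - k) = \<beta>" using c[of "r' - k" "Suc r'"] rc Suc by simp
        then show ?thesis unfolding * using rc B Suc True
          by (simp add: lower_factor_def rc' min_def algebra_simps)
      next
        case False
        then show ?thesis unfolding * using rc B Suc by (auto simp: lower_factor_def)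
      qed
    qed
    finally show "(lower_factor B (Suc k) * ?L k) $$ (r, c) = ?L (Suc k) $$ (r, c)" .
  qed (use B in \<open>auto simp: lower_factor_def\<close>)
  then show ?case by (simp add: Suc)
qed

lemma lower_product_pascal:
  assumes B: "B \<in> carrier_mat N N" and c: "\<And>r c. c < r \<Longrightarrow> r < N \<Longrightarrow> B $$ (r, c) = \<beta>"
  shows "lower_product B (N - 1) = pascal N \<beta>"
proof -
  have "lower_product B (N - 1) =
    mat N N (\<lambda>(r, c). if c \<le> r then of_nat (min r (N - 1) choose (r - c)) * \<beta> ^ (r - c) else 0)"
    by (rule lower_product_const[OF assms])
  also have "\<dots> = pascal N \<beta>"
    by (rule eq_matI) (auto simp: min_def binomial_symmetric[symmetric] not_le binomial_eq_0)
  finally show ?thesis .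
qed

lemma upper_product_transpose:
  assumes B: "B \<in> carrier_mat N N"
  shows "upper_product B k = transpose_mat (lower_product (transpose_mat B) k)"
proof (induction k)
  case (Suc k)
  have "upper_factor B (Suc k) = transpose_mat (lower_factor (transpose_mat B) (Suc k))"
    using B by (intro eq_matI) (auto simp: upper_factor_def lower_factor_def)
  moreover have "lower_factor (transpose_mat B) j \<in> carrier_mat N N" for j
    using B by (simp add: lower_factor_def)
  moreover have "lower_product (transpose_mat B) k \<in> carrier_mat N N" for k
    using B by (induction k) (auto simp: lower_factor_def)
  ultimately show ?case using Suc by (simp add: transpose_mult[of _ N N _ N])
qed (use B in auto)

section \<open>Factorization and bidiagonal decomposition of \<open>Lp\<close>\<close>

lemma Lp_carrier [simp]: "Lp n \<alpha> \<beta> \<gamma> \<in> carrier_mat (n + 1) (n + 1)"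
  by (simp add: Lp_def)

lemma Lp_dim [simp]: "dim_row (Lp n \<alpha> \<beta> \<gamma>) = n + 1" "dim_col (Lp n \<alpha> \<beta> \<gamma>) = n + 1"
  by (simp_all add: Lp_def)

lemma Lp_factorization:
  "Lp n \<alpha> \<beta> \<gamma> = pascal (n + 1) \<beta> * mat_diag (n + 1) (\<lambda>i. (\<alpha> * \<beta> + \<gamma>) ^ i) * transpose_mat (pascal (n + 1) \<alpha>)"
  unfolding mat_diag_mult_right[OF pascal_carrier]
  by (rule eq_matI) (auto simp: Lp_def Lp_entry_sum[of _ "n + 1"] scalar_prod_def atLeast0LessThan
      simp del: sum.lessThan_Suc intro!: sum.cong)

lemma Lp_bidiagonal_decomposition: "bidiagonal_decomposition (Lp n \<alpha> \<beta> \<gamma>) (Lp_BD n \<alpha> \<beta> \<gamma>)"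
proof -
  let ?B = "Lp_BD n \<alpha> \<beta> \<gamma>"
  have B: "?B \<in> carrier_mat (n + 1) (n + 1)" by (simp add: Lp_BD_def)
  have "lower_product ?B n = pascal (n + 1) \<beta>"
    using lower_product_pascal[OF B, of \<beta>] by (simp add: Lp_BD_def)
  moreover have "upper_product ?B n = transpose_mat (pascal (n + 1) \<alpha>)"
    using lower_product_pascal[of "transpose_mat ?B" "n + 1" \<alpha>]
    by (simp add: upper_product_transpose[OF B]) (simp add: Lp_BD_def)
  moreover have "diagonal_factor ?B = mat_diag (n + 1) (\<lambda>i. (\<alpha> * \<beta> + \<gamma>) ^ i)"
    by (auto simp: diagonal_factor_def mat_diag_def Lp_BD_def)
  ultimately show ?thesis
    unfolding bidiagonal_decomposition_def using B Lp_factorization[of n \<alpha> \<beta> \<gamma>] by simp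
qed

subsection \<open>Minors of the Pascal matrix\<close>

lemma det_last_row:
  fixes A :: "'a :: comm_ring_1 mat"
  assumes A: "A \<in> carrier_mat (Suc k) (Suc k)" and z: "\<And>b. b < k \<Longrightarrow> A $$ (k, b) = 0"
  shows "det A = A $$ (k, k) * det (mat k k (\<lambda>(a, b). A $$ (a, b)))"
proof -
  have "det A = (\<Sum>b<Suc k. A $$ (k, b) * cofactor A k b)"
    by (rule laplace_expansion_row[OF A]) simp
  also have "\<dots> = A $$ (k, k) * cofactor A k k" using z by simp
  also have "mat_delete A k k = mat k k (\<lambda>(a, b). A $$ (a, b))"
    using A by (intro eq_matI) (auto simp: mat_delete_def)
  then have "cofactor A k k = det (mat k k (\<lambda>(a, b). A $$ (a, b)))"
    by (simp add: cofactor_def flip: mult_2)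
  finally show ?thesis .
qed

lemma det_last_col:
  fixes A :: "'a :: comm_ring_1 mat"
  assumes A: "A \<in> carrier_mat (Suc k) (Suc k)" and z: "\<And>a. a < k \<Longrightarrow> A $$ (a, k) = 0"
  shows "det A = A $$ (k, k) * det (mat k k (\<lambda>(a, b). A $$ (a, b)))"
proof -
  have "det A = (\<Sum>a<Suc k. A $$ (a, k) * cofactor A a k)"
    by (rule laplace_expansion_column[OF A]) simp
  also have "\<dots> = A $$ (k, k) * cofactor A k k" using z by simp
  also have "mat_delete A k k = mat k k (\<lambda>(a, b). A $$ (a, b))"
    using A by (intro eq_matI) (auto simp: mat_delete_def)
  then have "cofactor A k k = det (mat k k (\<lambda>(a, b). A $$ (a, b)))"
    by (simp add: cofactor_def flip: mult_2)
  finally show ?thesis .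
qed

text \<open>Either the last row or the last column vanishes outside the corner. If the last row has
  a nonzero entry in an earlier column \<open>g b\<close>, then
  \<open>f k \<le> Suc (g b) \<le> g k\<close>, and all earlier rows lie strictly above the diagonal
  in column \<open>g k\<close>. Expansion along that line leaves a smaller determinant of the same
  kind.\<close>

lemma det_bidiagonal_nonneg:
  fixes X :: "nat \<Rightarrow> nat \<Rightarrow> real"
  assumes bid: "\<And>i j. i \<noteq> j \<Longrightarrow> i \<noteq> Suc j \<Longrightarrow> X i j = 0" and nn: "\<And>i j. 0 \<le> X i j"
    and f: "\<And>a b. a < b \<Longrightarrow> b < k \<Longrightarrow> f a < f b" and g: "\<And>a b. a < b \<Longrightarrow> b < k \<Longrightarrow> g a < g b"
  shows "0 \<le> det (mat k k (\<lambda>(a, b). X (f a) (g b)))"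
  using f g
proof (induction k)
  case (Suc k)
  let ?A = "mat (Suc k) (Suc k) (\<lambda>(a, b). X (f a) (g b))"
  have "0 \<le> det (mat k k (\<lambda>(a, b). X (f a) (g b)))" by (rule Suc.IH) (use Suc.prems in auto)
  moreover have "mat k k (\<lambda>(a, b). ?A $$ (a, b)) = mat k k (\<lambda>(a, b). X (f a) (g b))"
    by (rule eq_matI) auto
  moreover have "det ?A = ?A $$ (k, k) * det (mat k k (\<lambda>(a, b). ?A $$ (a, b)))"
  proof (cases "\<exists>b<k. X (f k) (g b) \<noteq> 0")
    case True
    then obtain b where b: "b < k" "X (f k) (g b) \<noteq> 0" by auto
    then have "f k = g b \<or> f k = Suc (g b)" using bid by blast
    then have "f k \<le> Suc (g b)" by auto
    also have "\<dots> \<le> g k" using Suc.prems(2)[of b k] b by simp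
    finally have "X (f a) (g k) = 0" if "a < k" for a
      using Suc.prems(1)[of a k] that by (intro bid) auto
    then show ?thesis by (intro det_last_col) auto
  next
    case False
    then show ?thesis by (intro det_last_row) auto
  qed
  ultimately show ?case using nn[of "f k" "g k"] by simp
qed simp

section \<open>Total nonnegativity\<close>

definition totally_nonneg :: "real mat \<Rightarrow> bool" where
  "totally_nonneg A \<longleftrightarrow> (\<forall>k. \<forall>I\<in>ksubsets (dim_row A) k. \<forall>J\<in>ksubsets (dim_col A) k. 0 \<le> minor A I J)"

lemma totally_nonneg_mult:
  assumes "A \<in> carrier_mat nr n" "B \<in> carrier_mat n nc" "totally_nonneg A" "totally_nonneg B"
  shows "totally_nonneg (A * B)"
  using assms by (auto simp: totally_nonneg_def minor_mult intro!: sum_nonneg mult_nonneg_nonneg)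

lemma totally_nonneg_one: "totally_nonneg (1\<^sub>m n)"
  by (auto simp: totally_nonneg_def minor_one)

lemma totally_nonneg_lower_factor:
  assumes B: "B \<in> carrier_mat N N" and nn: "\<And>r c. c < r \<Longrightarrow> r < N \<Longrightarrow> 0 \<le> B $$ (r, c)" and i: "0 < i"
  shows "totally_nonneg (lower_factor B i)"
proof -
  \<comment> \<open>Extension by 0 makes the bidiagonal shape and the signs hold for all indices, as
    \<open>det_bidiagonal_nonneg\<close> requires.\<close>
  define X where "X = (\<lambda>r c. if r < N \<and> c < N then lower_factor B i $$ (r, c) else 0)"
  have L: "lower_factor B i \<in> carrier_mat N N" using B by (simp add: lower_factor_def)
  have "0 \<le> minor (lower_factor B i) I J" if I: "I \<in> ksubsets N k" and J: "J \<in> ksubsets N k" for k I J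
  proof -
    have "submatrix (lower_factor B i) I J = mat k k (\<lambda>(a, b). X (pick I a) (pick J b))"
      unfolding submatrix_ksubsets[OF L I J]
      by (rule eq_matI) (use ksubsets_pick_less[OF I] ksubsets_pick_less[OF J] in \<open>auto simp: X_def\<close>)
    moreover have "0 \<le> det (mat k k (\<lambda>(a, b). X (pick I a) (pick J b)))"
    proof (rule det_bidiagonal_nonneg)
      show "X r c = 0" if "r \<noteq> c" "r \<noteq> Suc c" for r c
        using that B by (simp add: X_def lower_factor_def)
      show "0 \<le> X r c" for r c
        using B nn[of "r - i" r] i by (auto simp: X_def lower_factor_def)
    qed (use ksubsets_pick_mono[OF I] ksubsets_pick_mono[OF J] in auto)
    ultimately show ?thesis by simp
  qed
  then show ?thesis using L by (auto simp: totally_nonneg_def)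
qed

text \<open>The bidiagonal factorization is reused with all multipliers equal to \<open>x\<close>:
  its factors are totally nonnegative, hence so is their product.\<close>

lemma totally_nonneg_pascal:
  assumes "0 \<le> x"
  shows "totally_nonneg (pascal N x)"
proof -
  let ?B = "mat N N (\<lambda>_. x)"
  have "lower_product ?B k \<in> carrier_mat N N \<and> totally_nonneg (lower_product ?B k)" for k
  proof (induction k)
    case 0
    show ?case by (simp add: totally_nonneg_one)
  next
    case (Suc k)
    have "totally_nonneg (lower_factor ?B (Suc k))"
      by (rule totally_nonneg_lower_factor[of _ N]) (use assms in auto)
    moreover have "lower_factor ?B (Suc k) \<in> carrier_mat N N" by (simp add: lower_factor_def)
    ultimately show ?case using Suc by (auto intro: totally_nonneg_mult[of _ N N _ N])
  qed
  moreover have "lower_product ?B (N - 1) = pascal N x" by (rule lower_product_pascal) auto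
  ultimately show ?thesis by metis
qed

lemma pick_lessThan: "a < k \<Longrightarrow> pick {..<k} a = a"
proof -
  assume a: "a < k"
  then have "{b \<in> {..<k}. b < a} = {..<a}" by auto
  then show ?thesis using pick_card_in_set[of a "{..<k}"] a by simp
qed

text \<open>A kernel vector of the matrix of binomial coefficients would be a polynomial of degree below \<open>k\<close>
  with \<open>k\<close> roots.\<close>

lemma det_binomial_nonzero:
  assumes inj: "inj_on f {..<k}"
  shows "det (mat k k (\<lambda>(a, b). real (f a choose b))) \<noteq> 0"
proof
  let ?M = "mat k k (\<lambda>(a, b). real (f a choose b))"
  assume "det ?M = 0"
  then obtain v where v: "v \<in> carrier_vec k" "v \<noteq> 0\<^sub>v k" "?M *\<^sub>v v = 0\<^sub>v k"
    using det_0_iff_vec_prod_zero_field[of ?M k] by auto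
  \<comment> \<open>The products are falling factorials, so that the summand with index
    \<open>b\<close> is \<open>v $ b\<close> times the polynomial \<open>binom(X, b)\<close> of
    degree \<open>b\<close>.\<close>
  define p where "p = (\<Sum>b<k. smult (v $ b / fact b) (\<Prod>t = 0..<b. [:- real t, 1:]))"
  have poly_p: "poly p (real m) = (\<Sum>b<k. real (m choose b) * v $ b)" for m
  proof -
    have "poly (smult (v $ b / fact b) (\<Prod>t = 0..<b. [:- real t, 1:])) (real m) = real (m choose b) * v $ b" for b
      by (simp add: poly_prod binomial_gbinomial gbinomial_prod_rev)
    then show ?thesis by (simp add: p_def poly_sum)
  qed
  have k: "0 < k" using v by (cases k) auto
  have deg: "degree p < k"
  proof -
    have "degree (\<Prod>t = 0..<b. [:- real t, 1:]) \<le> b" for b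
      using degree_prod_sum_le[of "{0..<b}" "\<lambda>t. [:- real t, 1:]"] by simp
    then have "degree (smult (v $ b / fact b) (\<Prod>t = 0..<b. [:- real t, 1:])) \<le> b" for b
      by (rule order_trans[OF degree_smult_le])
    then have "degree (smult (v $ b / fact b) (\<Prod>t = 0..<b. [:- real t, 1:])) \<le> k - 1" if "b < k" for b
      by (rule order_trans) (use that in simp)
    then have "degree p \<le> k - 1" unfolding p_def by (intro degree_sum_le) auto
    then show ?thesis using k by simp
  qed
  have "p = 0"
  proof (rule ccontr)
    assume "p \<noteq> 0"
    have "poly p (real (f a)) = 0" if "a < k" for a
    proof -
      have "poly p (real (f a)) = (?M *\<^sub>v v) $ a"
        using that v(1) by (simp add: poly_p scalar_prod_def atLeast0LessThan)
      then show ?thesis using that v(3) by simp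
    qed
    then have "(\<lambda>a. real (f a)) ` {..<k} \<subseteq> {x. poly p x = 0}" by auto
    then have "card ((\<lambda>a. real (f a)) ` {..<k}) \<le> card {x. poly p x = 0}"
      by (rule card_mono[OF poly_roots_finite[OF \<open>p \<noteq> 0\<close>]])
    also have "\<dots> \<le> degree p" by (rule card_poly_roots_bound[OF \<open>p \<noteq> 0\<close>])
    finally show False using deg inj by (subst (asm) card_image) (auto simp: inj_on_def)
  qed
  \<comment> \<open>Evaluation at 0, 1, 2, ... gives a unitriangular system for \<open>v\<close>,
    because \<open>m choose b\<close> is 0 for \<open>b > m\<close> and 1 for
    \<open>b = m\<close>.\<close>
  have "v $ m = 0" if "m < k" for m
    using that
  proof (induction m rule: less_induct)
    case (less m)
    have "0 = (\<Sum>b<k. real (m choose b) * v $ b)" using poly_p[of m] \<open>p = 0\<close> by simp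
    also have "\<dots> = (\<Sum>b\<in>{m}. real (m choose b) * v $ b)"
    proof (rule sum.mono_neutral_right)
      show "\<forall>b\<in>{..<k} - {m}. real (m choose b) * v $ b = 0"
      proof
        fix b assume "b \<in> {..<k} - {m}"
        then show "real (m choose b) * v $ b = 0" using less.IH[of b] by (cases "b < m") auto
      qed
    qed (use less.prems in auto)
    finally show ?case by simp
  qed
  then show False using v by (auto intro!: eq_vecI)
qed

text \<open>Total nonnegativity already fixes the sign, so it is enough that the binomial
  determinant does not vanish.\<close>

lemma minor_pascal_initial_pos:
  assumes I: "I \<in> ksubsets N k"
  shows "0 < minor (pascal N 1) I {..<k}"
proof -
  have "k \<le> N" using I card_mono[of "{..<N}" I] by (auto simp: ksubsets_def)
  then have K: "{..<k} \<in> ksubsets N k" by (auto simp: ksubsets_def)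
  have "submatrix (pascal N 1) I {..<k} = mat k k (\<lambda>(a, b). real (pick I a choose b))"
    unfolding submatrix_ksubsets[OF pascal_carrier I K]
    by (rule eq_matI) (use ksubsets_pick_less[OF I] \<open>k \<le> N\<close> in \<open>auto simp: pick_lessThan\<close>)
  moreover have "inj_on (pick I) {..<k}"
    using bij_betw_pick[OF ksubsets_finite[OF I]] I by (simp add: bij_betw_def ksubsets_def atLeast0LessThan)
  ultimately have "minor (pascal N 1) I {..<k} \<noteq> 0" using det_binomial_nonzero by metis
  moreover have "0 \<le> minor (pascal N 1) I {..<k}"
    using totally_nonneg_pascal[of 1 N] I K by (auto simp: totally_nonneg_def)
  ultimately show ?thesis by simp
qed

section \<open>Minors, inverse and eigenvalues\<close>

lemma minor_mat_diag_mult: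
  fixes A :: "'a :: comm_ring_1 mat"
  assumes A: "A \<in> carrier_mat nr nc" and I: "I \<in> ksubsets nr k" and J: "J \<in> ksubsets nc k"
  shows "minor (mat_diag nr f * A) I J = (\<Prod>i\<in>I. f i) * minor A I J"
    and "minor (A * mat_diag nc g) I J = minor A I J * (\<Prod>j\<in>J. g j)"
proof -
  have "minor (mat_diag nr f * A) I J = (\<Sum>K\<in>ksubsets nr k. if K = I then (\<Prod>i\<in>I. f i) * minor A I J else 0)"
    unfolding minor_mult[OF mat_diag_dim A I J] by (intro sum.cong refl) (auto simp: minor_mat_diag[OF I])
  then show "minor (mat_diag nr f * A) I J = (\<Prod>i\<in>I. f i) * minor A I J" using I by simp
  have "minor (A * mat_diag nc g) I J = (\<Sum>K\<in>ksubsets nc k. if K = J then minor A I J * (\<Prod>j\<in>J. g j) else 0)"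
    unfolding minor_mult[OF A mat_diag_dim I J] by (intro sum.cong refl) (auto simp: minor_mat_diag[OF _ J])
  then show "minor (A * mat_diag nc g) I J = minor A I J * (\<Prod>j\<in>J. g j)" using J by simp
qed

text \<open>For \<open>x \<noteq> 0\<close>, \<open>pascal N x\<close> is conjugate to
  \<open>pascal N 1\<close> by the diagonal matrix of the powers of \<open>x\<close>. This moves the
  parameters into diagonal factors and leaves \<open>e l = d ^ l / (a * b) ^ l\<close> between the
  two integer matrices. Only for \<open>0 < n\<close> are \<open>a\<close> and \<open>b\<close> tied
  to \<open>\<alpha>\<close> and \<open>\<beta>\<close>: they stand for registers that do not hold
  the parameters when \<open>n = 0\<close>.\<close>

lemma Lp_minor:
  assumes ab: "0 < n \<Longrightarrow> a = \<alpha> \<and> b = \<beta>"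
    and e: "\<And>i. i \<le> n \<Longrightarrow> e i * (a * b) ^ i = (\<alpha> * \<beta> + \<gamma>) ^ i"
    and I: "I \<in> ksubsets (n + 1) k" and J: "J \<in> ksubsets (n + 1) k"
  defines "P \<equiv> pascal (n + 1) 1"
  shows "minor (Lp n \<alpha> \<beta> \<gamma>) I J =
    (\<Prod>i\<in>I. b ^ i) * (\<Sum>K\<in>ksubsets (n + 1) k. minor P I K * (\<Prod>l\<in>K. e l) * minor P J K) * (\<Prod>j\<in>J. a ^ j)"
proof -
  have P: "P \<in> carrier_mat (n + 1) (n + 1)" by (simp add: P_def)
  let ?S = "P * mat_diag (n + 1) e * transpose_mat P"
  have S: "?S \<in> carrier_mat (n + 1) (n + 1)" by (intro mult_carrier_mat[OF mult_carrier_mat[OF P mat_diag_dim]]) (use P in simp)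
  have Lp_eq: "Lp n \<alpha> \<beta> \<gamma> = mat_diag (n + 1) (\<lambda>i. b ^ i) * ?S * mat_diag (n + 1) (\<lambda>j. a ^ j)"
  proof (rule eq_matI)
    fix i j
    assume "i < dim_row (mat_diag (n + 1) (\<lambda>i. b ^ i) * ?S * mat_diag (n + 1) (\<lambda>j. a ^ j))"
      and "j < dim_col (mat_diag (n + 1) (\<lambda>i. b ^ i) * ?S * mat_diag (n + 1) (\<lambda>j. a ^ j))"
    then have ij: "i < n + 1" "j < n + 1" by (auto simp: mat_diag_def)
    have "(of_nat (i choose l) * \<beta> ^ (i - l)) * (\<alpha> * \<beta> + \<gamma>) ^ l * (of_nat (j choose l) * \<alpha> ^ (j - l))
      = b ^ i * (of_nat (i choose l) * e l * of_nat (j choose l)) * a ^ j" if l: "l < n + 1" for l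
    proof (cases "l \<le> i \<and> l \<le> j")
      case True
      have p: "\<beta> ^ (i - l) = b ^ (i - l)" "\<alpha> ^ (j - l) = a ^ (j - l)" using ab ij by (cases n; simp)+
      have "b ^ i = b ^ (i - l) * b ^ l" "a ^ j = a ^ (j - l) * a ^ l"
        using True by (simp_all flip: power_add)
      then show ?thesis unfolding p using e[of l, symmetric] l by (simp add: power_mult_distrib mult_ac)
    qed (auto simp: not_le binomial_eq_0)
    then have "Lp_entry \<alpha> \<beta> \<gamma> i j = b ^ i * (\<Sum>l<n + 1. of_nat (i choose l) * e l * of_nat (j choose l)) * a ^ j"
      unfolding Lp_entry_sum[OF ij(1)] sum_distrib_left sum_distrib_right by (intro sum.cong refl) auto
    also have "(\<Sum>l<n + 1. of_nat (i choose l) * e l * of_nat (j choose l)) = ?S $$ (i, j)"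
      unfolding P_def mat_diag_mult_right[OF pascal_carrier]
      using ij by (simp add: scalar_prod_def atLeast0LessThan del: sum.lessThan_Suc)
    also have "b ^ i * \<dots> * a ^ j = (mat_diag (n + 1) (\<lambda>i. b ^ i) * ?S * mat_diag (n + 1) (\<lambda>j. a ^ j)) $$ (i, j)"
      unfolding mat_diag_mult_left[OF S] mat_diag_mult_right[OF mat_carrier] using ij by simp
    finally show "Lp n \<alpha> \<beta> \<gamma> $$ (i, j) = \<dots>" using ij by (simp add: Lp_def)
  qed (auto simp: mat_diag_def)
  have "minor ?S I J = (\<Sum>K\<in>ksubsets (n + 1) k. minor (P * mat_diag (n + 1) e) I K * minor (transpose_mat P) K J)"
    by (rule minor_mult[OF mult_carrier_mat[OF P mat_diag_dim] _ I J]) (use P in simp)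
  also have "\<dots> = (\<Sum>K\<in>ksubsets (n + 1) k. minor P I K * (\<Prod>l\<in>K. e l) * minor P J K)"
    by (intro sum.cong refl) (simp only: minor_mat_diag_mult(2)[OF P I] minor_transpose[OF P J])
  finally have mS: "minor ?S I J = (\<Sum>K\<in>ksubsets (n + 1) k. minor P I K * (\<Prod>l\<in>K. e l) * minor P J K)" .
  have "minor (Lp n \<alpha> \<beta> \<gamma>) I J = minor (mat_diag (n + 1) (\<lambda>i. b ^ i) * ?S) I J * (\<Prod>j\<in>J. a ^ j)"
    unfolding Lp_eq by (rule minor_mat_diag_mult(2)[OF _ I J]) (rule mult_carrier_mat[OF mat_diag_dim S])
  also have "\<dots> = (\<Prod>i\<in>I. b ^ i) * minor ?S I J * (\<Prod>j\<in>J. a ^ j)"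
    by (simp only: minor_mat_diag_mult(1)[OF S I J])
  finally show ?thesis by (simp only: mS)
qed

lemma minor_pascal_nonneg:
  "I \<in> ksubsets N k \<Longrightarrow> J \<in> ksubsets N k \<Longrightarrow> 0 \<le> minor (pascal N 1) I J"
  using totally_nonneg_pascal[of 1 N] by (auto simp: totally_nonneg_def)

lemma Lp_strictly_totally_positive:
  assumes "0 < \<alpha>" "0 < \<beta>" "0 < \<alpha> * \<beta> + \<gamma>"
  shows "strictly_totally_positive (Lp n \<alpha> \<beta> \<gamma>)"
  unfolding strictly_totally_positive_def
proof (intro allI impI, elim conjE)
  fix I J assume "I \<subseteq> {..<dim_row (Lp n \<alpha> \<beta> \<gamma>)}" "J \<subseteq> {..<dim_col (Lp n \<alpha> \<beta> \<gamma>)}" "card I = card J"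
  define k where "k = card I"
  have I: "I \<in> ksubsets (n + 1) k" and J: "J \<in> ksubsets (n + 1) k"
    using \<open>I \<subseteq> _\<close> \<open>J \<subseteq> _\<close> \<open>card I = card J\<close> by (auto simp: ksubsets_def k_def)
  define e where "e = (\<lambda>i. (\<alpha> * \<beta> + \<gamma>) ^ i / (\<alpha> * \<beta>) ^ i)"
  have e: "0 < e i" "e i * (\<alpha> * \<beta>) ^ i = (\<alpha> * \<beta> + \<gamma>) ^ i" for i
    using assms by (auto simp: e_def)
  define P where "P = pascal (n + 1) 1"
  have "k \<le> n + 1" using I card_mono[of "{..<n+1}" I] by (auto simp: ksubsets_def)
  then have K0: "{..<k} \<in> ksubsets (n + 1) k" by (auto simp: ksubsets_def)
  have "0 < (\<Sum>K\<in>ksubsets (n + 1) k. minor P I K * (\<Prod>l\<in>K. e l) * minor P J K)"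
  proof (rule sum_pos2[OF _ K0])
    show "0 < minor P I {..<k} * (\<Prod>l<k. e l) * minor P J {..<k}"
      unfolding P_def using I J e by (intro mult_pos_pos minor_pascal_initial_pos prod_pos) auto
    show "0 \<le> minor P I K * (\<Prod>l\<in>K. e l) * minor P J K" if "K \<in> ksubsets (n + 1) k" for K
      unfolding P_def using that I J e by (intro mult_nonneg_nonneg minor_pascal_nonneg prod_nonneg) (auto simp: less_imp_le)
  qed simp
  moreover have "0 < (\<Prod>i\<in>I. \<beta> ^ i)" "0 < (\<Prod>j\<in>J. \<alpha> ^ j)" using assms by (auto intro!: prod_pos)
  moreover have "minor (Lp n \<alpha> \<beta> \<gamma>) I J = (\<Prod>i\<in>I. \<beta> ^ i) *
      (\<Sum>K\<in>ksubsets (n + 1) k. minor P I K * (\<Prod>l\<in>K. e l) * minor P J K) * (\<Prod>j\<in>J. \<alpha> ^ j)"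
    unfolding P_def by (rule Lp_minor[OF _ _ I J]) (simp_all add: e)
  ultimately show "0 < minor (Lp n \<alpha> \<beta> \<gamma>) I J" by simp
qed

subsection \<open>The inverse\<close>

text \<open>The sign stands in front of the sum, so that for positive \<open>\<alpha>\<close>,
  \<open>\<beta>\<close> and \<open>\<alpha> * \<beta> + \<gamma>\<close> the rest is a sum of
  nonnegative terms, ready for subtraction-free evaluation.\<close>

definition Lp_inverse :: "nat \<Rightarrow> real \<Rightarrow> real \<Rightarrow> real \<Rightarrow> real mat" where
  "Lp_inverse n \<alpha> \<beta> \<gamma> = mat (n + 1) (n + 1) (\<lambda>(i, j). (-1) ^ (i + j) *
    (\<Sum>l<n + 1. of_nat (l choose i) * \<alpha> ^ (l - i) * (of_nat (l choose j) * \<beta> ^ (l - j)) / (\<alpha> * \<beta> + \<gamma>) ^ l))"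

lemma Lp_inverse_factorization:
  "Lp_inverse n \<alpha> \<beta> \<gamma> =
    transpose_mat (pascal (n + 1) (- \<alpha>)) * mat_diag (n + 1) (\<lambda>i. inverse ((\<alpha> * \<beta> + \<gamma>) ^ i)) * pascal (n + 1) (- \<beta>)"
proof -
  have "(-1) ^ (i + j) * (of_nat (l choose i) * \<alpha> ^ (l - i) * (of_nat (l choose j) * \<beta> ^ (l - j)) / d)
    = of_nat (l choose i) * (- \<alpha>) ^ (l - i) * inverse d * (of_nat (l choose j) * (- \<beta>) ^ (l - j))" for i j l d
  proof (cases "i \<le> l \<and> j \<le> l")
    case True
    \<comment> \<open>The exponents on the right add up to \<open>2 * l - (i + j)\<close>, which has
      the parity of \<open>i + j\<close>.\<close>
    have "(-1 :: real) ^ (i + j) = (-1) ^ (l - i) * (-1) ^ (l - j)"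
      using True by (simp add: minus_one_power_iff even_diff_nat)
    then show ?thesis
      by (simp add: power_minus[of \<alpha>] power_minus[of \<beta>] divide_inverse)
  qed (auto simp: not_le binomial_eq_0)
  then show ?thesis
    unfolding mat_diag_mult_right[OF transpose_carrier_mat[THEN iffD2, OF pascal_carrier]]
    by (intro eq_matI) (simp_all add: Lp_inverse_def scalar_prod_def atLeast0LessThan sum_distrib_left mult_ac del: sum.lessThan_Suc)
qed

lemma mult_mat_regroup:
  fixes A B C D E F :: "'a :: semiring_0 mat"
  assumes "A \<in> carrier_mat N N" "B \<in> carrier_mat N N" "C \<in> carrier_mat N N"
    "D \<in> carrier_mat N N" "E \<in> carrier_mat N N" "F \<in> carrier_mat N N"
  shows "A * B * C * (D * E * F) = A * (B * (C * D) * E) * F"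
  using assms by (simp add: assoc_mult_mat[of _ N N _ N _ N] mult_carrier_mat[of _ N N _ N])

lemma Lp_inverse:
  assumes "\<alpha> * \<beta> + \<gamma> \<noteq> 0"
  shows "Lp n \<alpha> \<beta> \<gamma> * Lp_inverse n \<alpha> \<beta> \<gamma> = 1\<^sub>m (n + 1)"
    and "Lp_inverse n \<alpha> \<beta> \<gamma> * Lp n \<alpha> \<beta> \<gamma> = 1\<^sub>m (n + 1)"
proof -
  let ?N = "n + 1"
  let ?D = "mat_diag ?N (\<lambda>i. (\<alpha> * \<beta> + \<gamma>) ^ i)" and ?E = "mat_diag ?N (\<lambda>i. inverse ((\<alpha> * \<beta> + \<gamma>) ^ i))"
  let ?U = "transpose_mat (pascal ?N \<alpha>)" and ?V = "transpose_mat (pascal ?N (- \<alpha>))"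
  note c = mat_diag_dim[of ?N] pascal_carrier[of ?N] transpose_carrier_mat[THEN iffD2, OF pascal_carrier[of ?N]]
    mult_carrier_mat[of _ ?N ?N _ ?N]
  have VU: "?U * ?V = 1\<^sub>m ?N"
    using transpose_mult[OF pascal_carrier pascal_carrier, of ?N "- \<alpha>" \<alpha>] by (simp add: pascal_mult pascal_0)
  have DE: "?D * ?E = 1\<^sub>m ?N"
    using assms by simp
  have "Lp n \<alpha> \<beta> \<gamma> * Lp_inverse n \<alpha> \<beta> \<gamma> = pascal ?N \<beta> * (?D * (?U * ?V) * ?E) * pascal ?N (- \<beta>)"
    unfolding Lp_factorization Lp_inverse_factorization by (rule mult_mat_regroup) (use c in auto)
  also have "\<dots> = 1\<^sub>m ?N"
    by (simp only: VU DE right_mult_one_mat[OF c(1)] right_mult_one_mat[OF c(2)] pascal_mult) (simp add: pascal_0)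
  finally show *: "Lp n \<alpha> \<beta> \<gamma> * Lp_inverse n \<alpha> \<beta> \<gamma> = 1\<^sub>m ?N" .
  show "Lp_inverse n \<alpha> \<beta> \<gamma> * Lp n \<alpha> \<beta> \<gamma> = 1\<^sub>m ?N"
    by (rule mat_mult_left_right_inverse[OF Lp_carrier _ *]) (simp add: Lp_inverse_def)
qed

lemma det_Lp_nonzero:
  assumes "\<alpha> * \<beta> + \<gamma> \<noteq> 0"
  shows "det (Lp n \<alpha> \<beta> \<gamma>) \<noteq> 0"
proof
  assume "det (Lp n \<alpha> \<beta> \<gamma>) = 0"
  moreover have "Lp_inverse n \<alpha> \<beta> \<gamma> \<in> carrier_mat (n + 1) (n + 1)" by (simp add: Lp_inverse_def)
  ultimately have "det (1\<^sub>m (n + 1) :: real mat) = 0"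
    using det_mult[OF Lp_carrier, of "Lp_inverse n \<alpha> \<beta> \<gamma>" n \<alpha> \<beta> \<gamma>] Lp_inverse(1)[OF assms] by simp
  then show False by simp
qed

subsection \<open>Eigenvalues\<close>

text \<open>If \<open>A W = Q E Q\<^sup>T\<close> with diagonal \<open>W > 0\<close> and \<open>E \<ge> 0\<close>, the eigenvalue of an eigenvector \<open>W y\<close> is
  the quotient of the quadratic forms of \<open>Q E Q\<^sup>T\<close> and \<open>W\<close> at \<open>y\<close>.\<close>

lemma eigenvalue_quotient:
  fixes A :: "real mat" and w e :: "nat \<Rightarrow> real" and Q :: "nat \<Rightarrow> nat \<Rightarrow> real"
  assumes A: "A \<in> carrier_mat N N"
    and w: "\<And>i. i < N \<Longrightarrow> 0 < w i" and e: "\<And>i. i < N \<Longrightarrow> 0 \<le> e i"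
    and AW: "\<And>i j. i < N \<Longrightarrow> j < N \<Longrightarrow> A $$ (i, j) * w j = (\<Sum>l<N. Q i l * e l * Q j l)"
    and z: "eigenvalue (map_mat complex_of_real A) z"
  shows "\<exists>r\<ge>0. z = complex_of_real r"
proof -
  let ?A = "map_mat complex_of_real A"
  from z obtain v where v: "v \<in> carrier_vec N" "v \<noteq> 0\<^sub>v N" "?A *\<^sub>v v = z \<cdot>\<^sub>v v"
    using A by (auto simp: eigenvalue_def eigenvector_def)
  \<comment> \<open>The substitution \<open>v = W y\<close> turns the eigenvector equation into
    \<open>Q E Q\<^sup>T y = z W y\<close>. Below, \<open>c\<close> is \<open>Q\<^sup>T y\<close>,
    and pairing with the conjugate of \<open>y\<close> gives \<open>T = z S\<close>.\<close>
  define y where "y = (\<lambda>i. v $ i / of_real (w i))"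
  have vy: "v $ i = of_real (w i) * y i" if "i < N" for i using w[OF that] by (simp add: y_def)
  define c where "c = (\<lambda>l. \<Sum>j<N. of_real (Q j l) * y j)"
  have row: "(\<Sum>l<N. of_real (Q i l * e l) * c l) = z * v $ i" if i: "i < N" for i
  proof -
    have "z * v $ i = (?A *\<^sub>v v) $ i" using v i by simp
    also have "\<dots> = (\<Sum>j<N. of_real (A $$ (i, j)) * v $ j)"
      using A v(1) i by (simp add: scalar_prod_def atLeast0LessThan)
    also have "\<dots> = (\<Sum>j<N. of_real (A $$ (i, j) * w j) * y j)"
      by (intro sum.cong refl) (simp add: vy)
    also have "\<dots> = (\<Sum>j<N. \<Sum>l<N. of_real (Q i l * e l) * (of_real (Q j l) * y j))"
    proof (rule sum.cong[OF refl])
      fix j assume "j \<in> {..<N}"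
      then have "complex_of_real (A $$ (i, j) * w j) = of_real (\<Sum>l<N. Q i l * e l * Q j l)"
        by (subst AW[OF i]) auto
      then show "of_real (A $$ (i, j) * w j) * y j = (\<Sum>l<N. of_real (Q i l * e l) * (of_real (Q j l) * y j))"
        by (simp only: of_real_sum of_real_mult sum_distrib_right mult.assoc)
    qed
    also have "\<dots> = (\<Sum>l<N. of_real (Q i l * e l) * c l)"
      by (subst sum.swap) (simp add: c_def sum_distrib_left)
    finally show ?thesis by simp
  qed
  define T where "T = (\<Sum>l<N. e l * (cmod (c l))\<^sup>2)"
  define S where "S = (\<Sum>i<N. w i * (cmod (y i))\<^sup>2)"
  have "of_real T = (\<Sum>l<N. of_real (e l) * (cnj (c l) * c l))"
    unfolding T_def of_real_sum by (intro sum.cong refl) (simp add: complex_norm_square mult.commute del: of_real_power)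
  also have "\<dots> = (\<Sum>l<N. \<Sum>i<N. cnj (y i) * (of_real (Q i l * e l) * c l))"
    by (intro sum.cong refl) (simp add: c_def[of] sum_distrib_left sum_distrib_right mult_ac)
  also have "\<dots> = (\<Sum>i<N. cnj (y i) * (\<Sum>l<N. of_real (Q i l * e l) * c l))"
    by (subst sum.swap) (simp add: sum_distrib_left)
  also have "\<dots> = (\<Sum>i<N. z * (of_real (w i) * (y i * cnj (y i))))"
  proof (rule sum.cong[OF refl])
    fix i assume "i \<in> {..<N}"
    then have i: "i < N" by simp
    show "cnj (y i) * (\<Sum>l<N. of_real (Q i l * e l) * c l) = z * (of_real (w i) * (y i * cnj (y i)))"
      unfolding row[OF i] vy[OF i] by (simp only: mult_ac)
  qed
  also have "\<dots> = z * of_real S"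
    unfolding S_def of_real_sum sum_distrib_left
    by (intro sum.cong refl) (simp add: complex_norm_square del: of_real_power)
  finally have TS: "of_real T = z * of_real S" .
  obtain i where i: "i < N" "v $ i \<noteq> 0" using v by (auto simp: vec_eq_iff)
  have "0 < S" unfolding S_def
  proof (rule sum_pos2[of _ i])
    show "0 < w i * (cmod (y i))\<^sup>2" using i w by (auto simp: vy)
    show "0 \<le> w j * (cmod (y j))\<^sup>2" if "j \<in> {..<N}" for j using w[of j] that by simp
  qed (use i in auto)
  moreover have "0 \<le> T" unfolding T_def using e by (intro sum_nonneg) auto
  moreover have "z = of_real (T / S)" using TS \<open>0 < S\<close> by (simp add: field_simps)
  ultimately show ?thesis by (intro exI[of _ "T / S"]) auto
qed

text \<open>Over the complex numbers the characteristic polynomial splits. Its roots are nonnegative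
  reals by \<open>eigenvalue_quotient\<close> and nonzero because of the determinant, so the
  factorization descends to the reals. The decreasing order makes the product of the first
  \<open>k\<close> entries the largest one of \<open>k\<close> eigenvalues.\<close>

lemma positive_eigenvalue_list:
  fixes A :: "real mat" and w e :: "nat \<Rightarrow> real" and Q :: "nat \<Rightarrow> nat \<Rightarrow> real"
  assumes A: "A \<in> carrier_mat N N" and det: "det A \<noteq> 0"
    and w: "\<And>i. i < N \<Longrightarrow> 0 < w i" and e: "\<And>i. i < N \<Longrightarrow> 0 \<le> e i"
    and AW: "\<And>i j. i < N \<Longrightarrow> j < N \<Longrightarrow> A $$ (i, j) * w j = (\<Sum>l<N. Q i l * e l * Q j l)"
  obtains es where "eigenvalue_list A es" "length es = N" "\<And>x. x \<in> set es \<Longrightarrow> 0 < x" "sorted (rev es)"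
proof -
  let ?A = "map_mat complex_of_real A"
  have cA: "?A \<in> carrier_mat N N" using A by simp
  obtain zs where zs: "char_poly ?A = (\<Prod>a\<leftarrow>zs. [:- a, 1:])" and len: "length zs = N"
    using char_poly_factorized[OF cA] by auto
  have pos: "\<exists>r>0. z = complex_of_real r" if "z \<in> set zs" for z
  proof -
    have "poly (char_poly ?A) z = 0" unfolding zs using that by (auto simp: poly_prod_list prod_list_zero_iff)
    then have ev: "eigenvalue ?A z" using eigenvalue_root_char_poly[OF cA] by simp
    from eigenvalue_quotient[OF A w e AW this] obtain r where r: "0 \<le> r" "z = complex_of_real r" by auto
    have "r \<noteq> 0"
    proof
      assume "r = 0"
      with ev r obtain v where v: "v \<in> carrier_vec N" "v \<noteq> 0\<^sub>v N" "?A *\<^sub>v v = 0 \<cdot>\<^sub>v v"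
        using A by (auto simp: eigenvalue_def eigenvector_def)
      moreover have "0 \<cdot>\<^sub>v v = 0\<^sub>v N" using v(1) by (intro eq_vecI) auto
      ultimately have "det ?A = 0" using det_0_iff_vec_prod_zero_field[OF cA] by auto
      then show False using det by (simp add: of_real_hom.hom_det)
    qed
    with r show ?thesis by (intro exI[of _ r]) auto
  qed
  define es where "es = map Re zs"
  have zs_es: "zs = map complex_of_real es"
    unfolding es_def map_map by (rule map_idI[symmetric]) (use pos in force)
  have "map_poly complex_of_real (\<Prod>e\<leftarrow>es. [:- e, 1:]) = (\<Prod>e\<leftarrow>es. [:- complex_of_real e, 1:])"
  proof -
    interpret map_poly_comm_ring_hom complex_of_real ..
    show ?thesis by (induction es) (simp_all add: hom_mult del: mult_pCons_left)
  qed
  then have "map_poly complex_of_real (char_poly A) = map_poly complex_of_real (\<Prod>e\<leftarrow>es. [:- e, 1:])"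
    unfolding of_real_hom.char_poly_hom[OF A, symmetric] zs zs_es
    by (simp add: hom_distribs o_def)
  then have cp: "char_poly A = (\<Prod>e\<leftarrow>es. [:- e, 1:])"
    by (simp add: poly_eq_iff coeff_map_poly)
  define es' where "es' = rev (sort es)"
  have ms: "mset es' = mset es" by (simp add: es'_def)
  show ?thesis
  proof (rule that[of es'])
    have "(\<Prod>e\<leftarrow>es'. [:- e, 1:]) = (\<Prod>e\<leftarrow>es. [:- e, 1:])"
      using ms by (metis mset_map prod_mset_prod_list)
    then show "eigenvalue_list A es'" by (simp add: eigenvalue_list_def cp)
    show "length es' = N" by (simp add: es'_def es_def len)
    show "0 < x" if "x \<in> set es'" for x
      using that pos by (force simp: es'_def es_def)
    show "sorted (rev es')" by (simp add: es'_def)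
  qed
qed

text \<open>Scaling column \<open>j\<close> by \<open>(\<beta> / \<alpha>) ^ j\<close> turns the
  right Pascal factor for \<open>\<alpha>\<close> into the one for \<open>\<beta>\<close>, at the
  cost of a factor \<open>(\<beta> / \<alpha>) ^ l\<close> in the middle. The scaled matrix is
  therefore symmetric, of the form \<open>Q E Q\<^sup>T\<close>.\<close>

lemma Lp_eigenvalue_list:
  assumes "0 < \<alpha>" "0 < \<beta>" "0 < \<alpha> * \<beta> + \<gamma>"
  obtains es where "eigenvalue_list (Lp n \<alpha> \<beta> \<gamma>) es" "length es = n + 1"
    "\<And>x. x \<in> set es \<Longrightarrow> 0 < x" "sorted (rev es)"
proof (rule positive_eigenvalue_list[OF Lp_carrier, of n \<alpha> \<beta> \<gamma> "\<lambda>j. (\<beta> / \<alpha>) ^ j"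
      "\<lambda>l. ((\<alpha> * \<beta> + \<gamma>) * (\<beta> / \<alpha>)) ^ l" "\<lambda>i l. of_nat (i choose l) * \<beta> ^ (i - l)"])
  fix i j assume ij: "i < n + 1" "j < n + 1"
  have Lp_ij: "Lp n \<alpha> \<beta> \<gamma> $$ (i, j) = Lp_entry \<alpha> \<beta> \<gamma> i j" using ij by (simp add: Lp_def)
  show "Lp n \<alpha> \<beta> \<gamma> $$ (i, j) * (\<beta> / \<alpha>) ^ j = (\<Sum>l<n + 1. of_nat (i choose l) * \<beta> ^ (i - l) *
    ((\<alpha> * \<beta> + \<gamma>) * (\<beta> / \<alpha>)) ^ l * (of_nat (j choose l) * \<beta> ^ (j - l)))"
    unfolding Lp_ij Lp_entry_sum[OF ij(1)] sum_distrib_right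
  proof (intro sum.cong refl)
    fix l
    show "of_nat (i choose l) * \<beta> ^ (i - l) * (\<alpha> * \<beta> + \<gamma>) ^ l * (of_nat (j choose l) * \<alpha> ^ (j - l)) * (\<beta> / \<alpha>) ^ j
      = of_nat (i choose l) * \<beta> ^ (i - l) * ((\<alpha> * \<beta> + \<gamma>) * (\<beta> / \<alpha>)) ^ l * (of_nat (j choose l) * \<beta> ^ (j - l))"
    proof (cases "l \<le> j")
      case True
      then have "\<alpha> ^ (j - l) * (\<beta> / \<alpha>) ^ j = (\<beta> / \<alpha>) ^ l * (\<alpha> ^ (j - l) * (\<beta> / \<alpha>) ^ (j - l))"
        by (simp flip: power_add)
      also have "\<dots> = (\<beta> / \<alpha>) ^ l * \<beta> ^ (j - l)" using assms by (simp flip: power_mult_distrib)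
      finally have *: "\<alpha> ^ (j - l) * (\<beta> / \<alpha>) ^ j = (\<beta> / \<alpha>) ^ l * \<beta> ^ (j - l)" .
      have "of_nat (i choose l) * \<beta> ^ (i - l) * (\<alpha> * \<beta> + \<gamma>) ^ l * (of_nat (j choose l) * \<alpha> ^ (j - l)) * (\<beta> / \<alpha>) ^ j
        = of_nat (i choose l) * \<beta> ^ (i - l) * (\<alpha> * \<beta> + \<gamma>) ^ l * of_nat (j choose l) * (\<alpha> ^ (j - l) * (\<beta> / \<alpha>) ^ j)"
        by (simp only: mult.assoc)
      then show ?thesis unfolding * power_mult_distrib by (simp only: mult_ac)
    qed (simp add: not_le binomial_eq_0)
  qed
qed (use assms det_Lp_nonzero that in auto)

lemma Gram_eigenvalue_list:
  fixes A :: "real mat"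
  assumes A: "A \<in> carrier_mat N N" and det: "det A \<noteq> 0"
  obtains es where "eigenvalue_list (transpose_mat A * A) es" "length es = N"
    "\<And>x. x \<in> set es \<Longrightarrow> 0 < x" "sorted (rev es)"
proof (rule positive_eigenvalue_list[of "transpose_mat A * A" N "\<lambda>_. 1" "\<lambda>_. 1" "\<lambda>i l. A $$ (l, i)"])
  show "det (transpose_mat A * A) \<noteq> 0" using A det by (simp add: det_mult[of _ N] det_transpose)
  show "(transpose_mat A * A) $$ (i, j) * 1 = (\<Sum>l<N. A $$ (l, i) * 1 * A $$ (l, j))" if "i < N" "j < N" for i j
    using that A by (simp add: scalar_prod_def atLeast0LessThan)
qed (use A that in auto)

text \<open>The element of \<open>I\<close> in position \<open>a\<close>, counted from 0, is at
  least \<open>a\<close>, and \<open>es\<close> decreases; the factors are compared one by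
  one.\<close>

lemma prod_sorted_le:
  fixes es :: "real list"
  assumes I: "I \<in> ksubsets (length es) k" and pos: "\<And>x. x \<in> set es \<Longrightarrow> 0 < x" and s: "sorted (rev es)"
  shows "(\<Prod>i\<in>I. es ! i) \<le> (\<Prod>i<k. es ! i)"
proof -
  have dec: "es ! j \<le> es ! i" if "i \<le> j" "j < length es" for i j
    using sorted_rev_nth_mono[OF s that(1,2)] .
  have le: "a \<le> pick I a" if "a < k" for a
    using that
  proof (induction a)
    case (Suc a)
    then show ?case using ksubsets_pick_mono[OF I, of a "Suc a"] by simp
  qed simp
  have "(\<Prod>i\<in>I. es ! i) = (\<Prod>a = 0..<k. es ! pick I a)" by (rule prod_pick[OF I, symmetric])
  also have "\<dots> \<le> (\<Prod>a = 0..<k. es ! a)"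
    using le ksubsets_pick_less[OF I] dec pos by (intro prod_mono) (auto simp: less_imp_le)
  finally show ?thesis by (simp add: atLeast0LessThan)
qed

text \<open>There are at most \<open>2 ^ N\<close> terms, all nonnegative, and the bound for each of
  them is itself one of the terms. The factor does not depend on \<open>p\<close>, hence a
  \<open>p\<close>-th root makes it harmless.\<close>

lemma ktrace_pow_bounds:
  fixes A :: "real mat"
  assumes A: "A \<in> carrier_mat N N" and es: "eigenvalue_list A es" "length es = N"
    and pos: "\<And>x. x \<in> set es \<Longrightarrow> 0 < x" and s: "sorted (rev es)" and k: "k \<le> N"
  shows "(\<Prod>i<k. es ! i) ^ p \<le> ktrace k (A ^\<^sub>m p)" and "ktrace k (A ^\<^sub>m p) \<le> 2 ^ N * (\<Prod>i<k. es ! i) ^ p"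
proof -
  have kt: "ktrace k (A ^\<^sub>m p) = (\<Sum>I\<in>ksubsets N k. (\<Prod>i\<in>I. es ! i) ^ p)"
    using ktrace_pow[OF A, of es k p] es by (simp add: eigenvalue_list_def prod_power_distrib)
  have nn: "0 \<le> (\<Prod>i\<in>I. es ! i)" if "I \<in> ksubsets N k" for I
    using that pos es by (intro prod_nonneg) (auto simp: ksubsets_def less_imp_le)
  have "{..<k} \<in> ksubsets N k" using k by (auto simp: ksubsets_def)
  then show "(\<Prod>i<k. es ! i) ^ p \<le> ktrace k (A ^\<^sub>m p)"
    unfolding kt by (intro member_le_sum) (auto intro!: zero_le_power nn)
  have "ktrace k (A ^\<^sub>m p) \<le> of_nat (card (ksubsets N k)) * (\<Prod>i<k. es ! i) ^ p"
    unfolding kt by (intro sum_bounded_above power_mono nn prod_sorted_le) (use pos s es in auto)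
  also have "card (ksubsets N k) \<le> card (Pow {..<N})"
    by (rule card_mono) (auto simp: ksubsets_def)
  then have "real (card (ksubsets N k)) \<le> 2 ^ N" using of_nat_mono[where 'a = real] by (fastforce simp: card_Pow)
  then have "real (card (ksubsets N k)) * (\<Prod>i<k. es ! i) ^ p \<le> 2 ^ N * (\<Prod>i<k. es ! i) ^ p"
    using pos es k by (intro mult_right_mono zero_le_power prod_nonneg) (auto simp: less_imp_le)
  finally show "ktrace k (A ^\<^sub>m p) \<le> 2 ^ N * (\<Prod>i<k. es ! i) ^ p" .
qed

section \<open>Floating-point programs\<close>

subsection \<open>Multiplicative closeness\<close>

text \<open>For positive numbers this says that the logarithms differ by at most \<open>q\<close>,
  and 0 is near to 0 only. Compared with a bound on relative errors, it composes additively, is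
  exactly halved by square roots, and stays meaningful for the large \<open>q\<close> that repeated
  squaring produces.\<close>

definition near :: "real \<Rightarrow> real \<Rightarrow> real \<Rightarrow> bool" where
  "near q x y \<longleftrightarrow> 0 \<le> x \<and> 0 \<le> y \<and> x \<le> exp q * y \<and> y \<le> exp q * x"

lemma near_nonneg: "near q x y \<Longrightarrow> 0 \<le> x" "near q x y \<Longrightarrow> 0 \<le> y"
  by (simp_all add: near_def)

lemma near_refl: "0 \<le> x \<Longrightarrow> 0 \<le> q \<Longrightarrow> near q x x"
  by (simp add: near_def mult_le_cancel_right1)

lemma near_mono:
  assumes "near q x y" "q \<le> q'"
  shows "near q' x y"
proof -
  have "exp q * z \<le> exp q' * z" if "0 \<le> z" for z using assms(2) that by (intro mult_right_mono) auto
  then show ?thesis using assms(1) by (auto simp: near_def intro: order_trans)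
qed

lemma near_trans:
  assumes "near q x y" "near q' y z"
  shows "near (q + q') x z"
proof -
  have "exp q * y \<le> exp q * (exp q' * z)" "exp q' * y \<le> exp q' * (exp q * x)"
    using assms by (auto simp: near_def)
  then have "x \<le> exp q * (exp q' * z)" "z \<le> exp q' * (exp q * x)"
    using assms unfolding near_def by linarith+
  then show ?thesis using assms by (simp add: near_def exp_add mult_ac)
qed

lemma near_add: "near q x y \<Longrightarrow> near q x' y' \<Longrightarrow> near q (x + x') (y + y')"
  by (auto simp: near_def distrib_left)

lemma near_mult:
  assumes "near q x y" "near q' x' y'"
  shows "near (q + q') (x * x') (y * y')"
proof -
  have "x * x' \<le> (exp q * y) * (exp q' * y')" "y * y' \<le> (exp q * x) * (exp q' * x')"
    using assms by (auto simp: near_def intro!: mult_mono)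
  then show ?thesis using assms by (auto simp: near_def exp_add mult_ac)
qed

lemma near_inverse:
  assumes "near q x y"
  shows "near q (inverse x) (inverse y)"
proof (cases "x = 0")
  \<comment> \<open>Then \<open>y = 0\<close> as well, and \<open>inverse 0 = 0\<close>.\<close>
  case True
  then show ?thesis using assms by (auto simp: near_def)
next
  case False
  then have "0 < x" using assms by (simp add: near_def)
  moreover from this have "y \<noteq> 0" "0 \<le> y" using assms by (auto simp: near_def)
  then have "0 < y" by simp
  ultimately show ?thesis using assms by (auto simp: near_def field_simps)
qed

lemma near_divide: "near q x y \<Longrightarrow> near q' x' y' \<Longrightarrow> near (q + q') (x / x') (y / y')"
  unfolding divide_inverse by (intro near_mult near_inverse)

lemma near_sqrt:
  assumes "near q x y"
  shows "near (q / 2) (sqrt x) (sqrt y)"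
proof -
  have e: "sqrt (exp q) = exp (q / 2)"
    by (rule real_sqrt_unique) (simp_all add: power2_eq_square flip: exp_add)
  have "sqrt x \<le> sqrt (exp q * y)" "sqrt y \<le> sqrt (exp q * x)"
    using assms by (auto simp: near_def)
  then show ?thesis using assms by (auto simp: near_def real_sqrt_mult e)
qed

lemma near_nonzero: "near q x y \<Longrightarrow> x \<noteq> 0 \<Longrightarrow> y \<noteq> 0"
  by (auto simp: near_def)

text \<open>The factor 2 comes from below: \<open>1 / (1 - u) \<le> 1 + 2 * u\<close> holds for
  \<open>u \<le> 1 / 2\<close>.\<close>

lemma near_round:
  assumes x: "0 \<le> x" and u: "0 \<le> u" "u \<le> 1 / 2" and y: "\<bar>y - x\<bar> \<le> u * \<bar>x\<bar>"
  shows "near (2 * u) x y"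
proof -
  have lo: "(1 - u) * x \<le> y" and hi: "y \<le> (1 + u) * x"
    using y x by (auto simp: abs_le_iff algebra_simps)
  have e: "1 + 2 * u \<le> exp (2 * u)" by simp
  have "0 \<le> u * (1 - 2 * u)" using u by (intro mult_nonneg_nonneg) auto
  then have "1 \<le> (1 + 2 * u) * (1 - u)" by (simp add: algebra_simps)
  also have "\<dots> \<le> exp (2 * u) * (1 - u)" using e u by (intro mult_right_mono) auto
  finally have "x \<le> exp (2 * u) * (1 - u) * x" using x by (simp add: mult_le_cancel_right1)
  also have "\<dots> \<le> exp (2 * u) * y" using lo by (simp add: mult.assoc)
  finally have "x \<le> exp (2 * u) * y" .
  moreover have "y \<le> exp (2 * u) * x"
    using hi e u x mult_right_mono[of "1 + u" "exp (2 * u)" x] by linarith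
  moreover have "0 \<le> y" using lo x u mult_nonneg_nonneg[of "1 - u" x] by linarith
  ultimately show ?thesis using x by (simp add: near_def)
qed

text \<open>On \<open>[0, 1]\<close> one has
  \<open>exp q \<le> 1 + q + q\<^sup>2 \<le> 1 + 2 * q\<close>, whence the factor 2 between the
  constants; the strict inequality in \<open>hra\<close> is paid for by \<open>2 * C < K\<close>.
  For \<open>x = 0\<close> nearness forces the exact result that \<open>hra\<close> demands.\<close>

lemma hra_near:
  assumes near: "near (C * roundoff M) x y" and u: "0 < roundoff M" and C: "0 \<le> C" "C * roundoff M \<le> 1" "2 * C < K"
  shows "hra K M x y"
proof (cases "x = 0")
  case True
  then show ?thesis using near by (simp add: hra_def near_def)
next
  case False
  define q where "q = C * roundoff M"
  have x: "0 < x" using False near by (simp add: near_def)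
  have q: "0 \<le> q" "q \<le> 1" using C u by (auto simp: q_def)
  have "q\<^sup>2 \<le> q" using q by (simp add: power2_eq_square mult_left_le)
  then have e: "exp q \<le> 1 + 2 * q" using exp_bound[OF q] by linarith
  have "y \<le> exp q * x" using near by (simp add: near_def q_def)
  also have "\<dots> \<le> (1 + 2 * q) * x" using e x by (intro mult_right_mono) auto
  finally have hi: "y - x \<le> 2 * q * x" by (simp add: algebra_simps)
  have "x * exp (- q) \<le> y" using near by (simp add: near_def q_def exp_minus field_simps)
  moreover have "(1 - q) * x \<le> exp (- q) * x"
    using x exp_ge_add_one_self[of "- q"] by (intro mult_right_mono) auto
  ultimately have "(1 - q) * x \<le> y" by (simp add: mult.commute)
  then have "x - y \<le> q * x" by (simp add: algebra_simps)
  also have "q * x \<le> 2 * q * x" using q x by simp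
  finally have "\<bar>x - y\<bar> \<le> 2 * q * x" using hi by simp
  then have "\<bar>x - y\<bar> / \<bar>x\<bar> \<le> 2 * q" using x by (simp add: field_simps)
  also have "\<dots> < K * roundoff M" using C(3) u by (simp add: q_def)
  finally show ?thesis using False by (simp add: hra_def)
qed

lemma hra_minus: "hra K M (- x) (- y) \<longleftrightarrow> hra K M x y"
  by (simp add: hra_def abs_minus_commute)

subsection \<open>Subtraction-free expressions\<close>

text \<open>Evaluating the same expression without rounding defines the ideal value with which the
  rounded one is compared. Its round-off is 0, so it does not satisfy
  \<open>standard_model\<close>.\<close>

definition exact_arith :: fp_arith where
  "exact_arith = \<lparr>roundoff = 0, fl_op = exact_op, fl_sqrt = sqrt\<rparr>"

abbreviation exact_eval :: "fp_expr \<Rightarrow> (nat \<Rightarrow> real) \<Rightarrow> real" where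
  "exact_eval \<equiv> eval_expr exact_arith"

lemma exact_arith_simps [simp]: "fl_op exact_arith = exact_op" "fl_sqrt exact_arith = sqrt"
  by (simp_all add: exact_arith_def)

primrec registers :: "fp_expr \<Rightarrow> nat set" where
  "registers (Reg r) = {r}"
| "registers Zero = {}"
| "registers One = {}"
| "registers Roundoff = {}"
| "registers (Bin f a b) = registers a \<union> registers b"
| "registers (Root a) = registers a"

lemma finite_registers [simp]: "finite (registers e)"
  by (induction e) auto

lemma eval_expr_cong: "(\<And>r. r \<in> registers e \<Longrightarrow> s r = t r) \<Longrightarrow> eval_expr M e s = eval_expr M e t"
  by (induction e) auto

text \<open>\<open>Roundoff\<close> is excluded because its value differs between the two
  arithmetics. Divisors are tested in exact evaluation only, since a number near to a nonzero one is
  nonzero.\<close>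

primrec subtraction_free :: "(nat \<Rightarrow> real) \<Rightarrow> fp_expr \<Rightarrow> bool" where
  "subtraction_free s (Reg r) \<longleftrightarrow> True"
| "subtraction_free s Zero \<longleftrightarrow> True"
| "subtraction_free s One \<longleftrightarrow> True"
| "subtraction_free s Roundoff \<longleftrightarrow> False"
| "subtraction_free s (Bin f a b) \<longleftrightarrow> f \<noteq> Minus \<and> (f = Divide \<longrightarrow> exact_eval b s \<noteq> 0) \<and>
     subtraction_free s a \<and> subtraction_free s b"
| "subtraction_free s (Root a) \<longleftrightarrow> subtraction_free s a"

primrec error :: "real \<Rightarrow> real \<Rightarrow> fp_expr \<Rightarrow> real" where
  "error q u (Reg r) = q"
| "error q u Zero = 0"
| "error q u One = 0"
| "error q u Roundoff = 0"
| "error q u (Bin f a b) = (if f = Plus then max (error q u a) (error q u b) else error q u a + error q u b) + 2 * u"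
| "error q u (Root a) = error q u a / 2 + 2 * u"

lemma error_nonneg: "0 \<le> q \<Longrightarrow> 0 \<le> u \<Longrightarrow> 0 \<le> error q u e"
  by (induction e) auto

text \<open>By homogeneity the bound is the round-off times a number that depends only on the
  expression and on \<open>c\<close>. This is how the constants become independent of the arithmetic
  and the parameters.\<close>

lemma error_scale: "0 \<le> u \<Longrightarrow> error (c * u) u e = error c 1 e * u"
  by (induction e) (auto simp: algebra_simps max_mult_distrib_left)

lemma standard_modelD:
  assumes "standard_model M"
  shows "0 < roundoff M"
    and "(f = Divide \<longrightarrow> y \<noteq> 0) \<Longrightarrow> \<bar>fl_op M f x y - exact_op f x y\<bar> \<le> roundoff M * \<bar>exact_op f x y\<bar>"
    and "0 \<le> x \<Longrightarrow> \<bar>fl_sqrt M x - sqrt x\<bar> \<le> roundoff M * sqrt x"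
  using assms by (auto simp: standard_model_def)

lemma near_fl_op:
  assumes M: "standard_model M" and u: "roundoff M \<le> 1 / 2"
    and "0 \<le> exact_op f x y" "f = Divide \<longrightarrow> y \<noteq> 0"
  shows "near (2 * roundoff M) (exact_op f x y) (fl_op M f x y)"
  by (rule near_round) (use assms standard_modelD(1)[OF M] standard_modelD(2)[OF M, of f y x] in simp_all)

lemma near_fl_sqrt:
  assumes M: "standard_model M" and u: "roundoff M \<le> 1 / 2" and "0 \<le> x"
  shows "near (2 * roundoff M) (sqrt x) (fl_sqrt M x)"
  by (rule near_round) (use assms standard_modelD(1)[OF M] standard_modelD(3)[OF M, of x] in simp_all)

lemma near_eval:
  assumes M: "standard_model M" and u: "roundoff M \<le> 1 / 2"
    and q: "\<And>r. r \<in> registers e \<Longrightarrow> near q (s r) (s' r)" and e: "subtraction_free s e"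
  shows "near (error q (roundoff M) e) (exact_eval e s) (eval_expr M e s')"
  using q e
proof (induction e)
  case (Bin f a b)
  let ?x = "exact_eval a s" and ?y = "exact_eval b s" and ?x' = "eval_expr M a s'" and ?y' = "eval_expr M b s'"
  let ?p = "error q (roundoff M) a" and ?r = "error q (roundoff M) b"
  have a: "near ?p ?x ?x'" and b: "near ?r ?y ?y'" using Bin by auto
  have f: "f \<noteq> Minus" "f = Divide \<longrightarrow> ?y' \<noteq> 0" using Bin.prems(2) near_nonzero[OF b] by auto
  let ?e = "if f = Plus then max ?p ?r else ?p + ?r"
  have ne: "near ?e (exact_op f ?x ?y) (exact_op f ?x' ?y')"
    using f(1) near_mult[OF a b] near_divide[OF a b]
      near_add[OF near_mono[OF a, of "max ?p ?r"] near_mono[OF b, of "max ?p ?r"]]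
    by (cases f) auto
  have "near (2 * roundoff M) (exact_op f ?x' ?y') (fl_op M f ?x' ?y')"
    by (rule near_fl_op[OF M u near_nonneg(2)[OF ne] f(2)])
  from near_trans[OF ne this] show ?case by simp
next
  case (Root a)
  then have a: "near (error q (roundoff M) a) (exact_eval a s) (eval_expr M a s')" by simp
  from near_trans[OF near_sqrt[OF a] near_fl_sqrt[OF M u near_nonneg(2)[OF a]]] show ?case by simp
qed (auto simp: near_refl)

section \<open>Sums, products and integer constants as expressions\<close>

definition sum_expr :: "fp_expr list \<Rightarrow> fp_expr" where
  "sum_expr es = foldr (Bin Plus) es Zero"

definition prod_expr :: "fp_expr list \<Rightarrow> fp_expr" where
  "prod_expr es = foldr (Bin Times) es One"

lemma exact_eval_sum_expr [simp]: "exact_eval (sum_expr es) s = (\<Sum>e\<leftarrow>es. exact_eval e s)"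
  by (induction es) (simp_all add: sum_expr_def)

lemma exact_eval_prod_expr [simp]: "exact_eval (prod_expr es) s = (\<Prod>e\<leftarrow>es. exact_eval e s)"
  by (induction es) (simp_all add: prod_expr_def)

lemma subtraction_free_sum_expr [simp]:
  "subtraction_free s (sum_expr es) \<longleftrightarrow> (\<forall>e\<in>set es. subtraction_free s e)"
  by (induction es) (simp_all add: sum_expr_def)

lemma subtraction_free_prod_expr [simp]:
  "subtraction_free s (prod_expr es) \<longleftrightarrow> (\<forall>e\<in>set es. subtraction_free s e)"
  by (induction es) (simp_all add: prod_expr_def)

lemma registers_sum_expr [simp]: "registers (sum_expr es) = (\<Union>e\<in>set es. registers e)"
  by (induction es) (simp_all add: sum_expr_def)

lemma error_sum_expr:
  assumes "\<And>e. e \<in> set es \<Longrightarrow> error q u e \<le> E" "0 \<le> E" "0 \<le> u"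
  shows "error q u (sum_expr es) \<le> E + 2 * u * length es"
  using assms
proof (induction es)
  case (Cons e es)
  then have "error q u (sum_expr es) \<le> E + 2 * u * length es" "error q u e \<le> E" by auto
  moreover have "0 \<le> u * length es" using Cons.prems by simp
  ultimately show ?case by (simp add: sum_expr_def algebra_simps)
qed (simp add: sum_expr_def)

text \<open>Besides the round-off only 0 and 1 are available as constants. The sum of ones is
  rounded like any other sum.\<close>

definition nat_expr :: "nat \<Rightarrow> fp_expr" where
  "nat_expr m = sum_expr (replicate m One)"

definition power_expr :: "nat \<Rightarrow> fp_expr \<Rightarrow> fp_expr" where
  "power_expr m e = prod_expr (replicate m e)"

lemma nat_expr_simps [simp]: "exact_eval (nat_expr m) s = real m" "subtraction_free s (nat_expr m)"
  by (simp_all add: nat_expr_def sum_list_replicate)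

lemma power_expr_simps [simp]:
  "exact_eval (power_expr m e) s = exact_eval e s ^ m"
  "subtraction_free s e \<Longrightarrow> subtraction_free s (power_expr m e)"
  by (simp_all add: power_expr_def prod_list_replicate)

definition enumeration :: "'a set \<Rightarrow> 'a list" where
  "enumeration A = (SOME xs. set xs = A \<and> distinct xs)"

lemma enumeration:
  assumes "finite A"
  shows "set (enumeration A) = A" "distinct (enumeration A)" "length (enumeration A) = card A"
proof -
  have *: "set (enumeration A) = A \<and> distinct (enumeration A)"
    unfolding enumeration_def using finite_distinct_list[OF assms] by (rule someI_ex)
  then show "set (enumeration A) = A" "distinct (enumeration A)" "length (enumeration A) = card A"
    by (auto simp: distinct_card[symmetric])
qed

lemma sum_list_enumeration: "finite A \<Longrightarrow> (\<Sum>x\<leftarrow>enumeration A. f x) = (\<Sum>x\<in>A. f x)"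
  by (simp add: sum_list_distinct_conv_sum_set enumeration)

lemma prod_list_enumeration: "finite A \<Longrightarrow> (\<Prod>x\<leftarrow>enumeration A. f x) = (\<Prod>x\<in>A. f x)"
  by (simp add: prod.distinct_set_conv_list[symmetric] enumeration)

subsection \<open>Parallel assignments and loops\<close>

primrec assign_block :: "nat \<Rightarrow> (nat \<Rightarrow> nat) \<Rightarrow> (nat \<Rightarrow> fp_expr) \<Rightarrow> fp_prog" where
  "assign_block 0 f g = Skip"
| "assign_block (Suc m) f g = Seq (assign_block m f g) (Assign (f m) (g m))"

text \<open>All values are first computed into scratch registers above every register involved and
  only then copied. Every right-hand side thus sees the old state, even where targets and sources
  overlap.\<close>

definition parallel_assign :: "(nat \<times> fp_expr) list \<Rightarrow> fp_prog" where
  "parallel_assign ps = (let T = Suc (Max (insert 0 (\<Union>(r, e)\<in>set ps. insert r (registers e)))) in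
     Seq (assign_block (length ps) (\<lambda>i. T + i) (\<lambda>i. snd (ps ! i)))
         (assign_block (length ps) (\<lambda>i. fst (ps ! i)) (\<lambda>i. Reg (T + i))))"

lemma exec_parallel_assign:
  assumes dist: "distinct (map fst ps)"
  obtains t where "exec M (parallel_assign ps) s t" "\<And>r e. (r, e) \<in> set ps \<Longrightarrow> t r = eval_expr M e s"
proof -
  define R where "R = insert 0 (\<Union>(r, e)\<in>set ps. insert r (registers e))"
  define T where "T = Suc (Max R)"
  have "finite R" by (auto simp: R_def)
  then have R: "r < T" if "r \<in> R" for r using that by (simp add: T_def le_imp_less_Suc)
  have T: "fst (ps ! i) < T" "registers (snd (ps ! i)) \<subseteq> {..<T}" if "i < length ps" for i
    using nth_mem[OF that] by (force intro!: R simp: R_def)+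
  define s1 where "s1 = (\<lambda>m r. if T \<le> r \<and> r < T + m then eval_expr M (snd (ps ! (r - T))) s else s r)"
  have "exec M (assign_block m (\<lambda>i. T + i) (\<lambda>i. snd (ps ! i))) s (s1 m)" if "m \<le> length ps" for m
    using that
  proof (induction m)
    case 0
    have "s1 0 = s" by (auto simp: s1_def)
    then show ?case by (simp add: exec.Skip)
  next
    case (Suc m)
    have "eval_expr M (snd (ps ! m)) (s1 m) = eval_expr M (snd (ps ! m)) s"
      by (rule eval_expr_cong) (use T(2)[of m] Suc.prems in \<open>auto simp: s1_def\<close>)
    then have "s1 (Suc m) = (s1 m)(T + m := eval_expr M (snd (ps ! m)) (s1 m))"
      by (auto simp: s1_def fun_eq_iff)
    then have "exec M (Assign (T + m) (snd (ps ! m))) (s1 m) (s1 (Suc m))" using exec.Assign by metis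
    moreover have "exec M (assign_block m (\<lambda>i. T + i) (\<lambda>i. snd (ps ! i))) s (s1 m)" using Suc by simp
    ultimately show ?case by (auto intro: exec.Seq)
  qed
  then have e1: "exec M (assign_block (length ps) (\<lambda>i. T + i) (\<lambda>i. snd (ps ! i))) s (s1 (length ps))" by simp
  define S where "S = s1 (length ps)"
  have "\<exists>t. exec M (assign_block m (\<lambda>i. fst (ps ! i)) (\<lambda>i. Reg (T + i))) S t \<and>
    (\<forall>i<m. t (fst (ps ! i)) = S (T + i)) \<and> (\<forall>r\<ge>T. t r = S r)" if "m \<le> length ps" for m
    using that
  proof (induction m)
    case (Suc m)
    then obtain t where t: "exec M (assign_block m (\<lambda>i. fst (ps ! i)) (\<lambda>i. Reg (T + i))) S t"
      "\<And>i. i < m \<Longrightarrow> t (fst (ps ! i)) = S (T + i)" "\<And>r. T \<le> r \<Longrightarrow> t r = S r" by auto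
    have "fst (ps ! i) \<noteq> fst (ps ! m)" if "i < m" for i
      using dist that Suc.prems by (auto simp: distinct_conv_nth)
    then have "(\<forall>i<Suc m. (t(fst (ps ! m) := t (T + m))) (fst (ps ! i)) = S (T + i)) \<and>
      (\<forall>r\<ge>T. (t(fst (ps ! m) := t (T + m))) r = S r)"
      using t(2,3) T(1)[of m] Suc.prems by (auto simp: less_Suc_eq)
    moreover have "exec M (assign_block (Suc m) (\<lambda>i. fst (ps ! i)) (\<lambda>i. Reg (T + i))) S (t(fst (ps ! m) := t (T + m)))"
      using exec.Seq[OF t(1) exec.Assign[of M "fst (ps ! m)" "Reg (T + m)" t]] by (simp only: assign_block.simps eval_expr.simps)
    ultimately show ?case by blast
  qed (auto intro: exec.Skip)
  then obtain t where t: "exec M (assign_block (length ps) (\<lambda>i. fst (ps ! i)) (\<lambda>i. Reg (T + i))) S t"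
    "\<And>i. i < length ps \<Longrightarrow> t (fst (ps ! i)) = S (T + i)" by blast
  have "exec M (parallel_assign ps) s t"
    unfolding parallel_assign_def Let_def R_def[symmetric] T_def[symmetric]
    by (rule exec.Seq[OF e1 t(1)[unfolded S_def]])
  moreover have "t r = eval_expr M e s" if "(r, e) \<in> set ps" for r e
  proof -
    from that obtain i where "i < length ps" "ps ! i = (r, e)" by (auto simp: in_set_conv_nth)
    then show ?thesis using t(2)[of i] by (simp add: S_def s1_def)
  qed
  ultimately show ?thesis by (rule that)
qed

text \<open>The invariant carries the number of iterations, so it determines the outcome of every
  test and yields termination after exactly \<open>m\<close> rounds, by downward induction from
  \<open>m\<close>.\<close>

lemma exec_while:
  assumes "Inv 0 s"
    and step: "\<And>i s. i < m \<Longrightarrow> Inv i s \<Longrightarrow> eval_expr M a s < eval_expr M b s \<and> (\<exists>t. exec M p s t \<and> Inv (Suc i) t)"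
    and stop: "\<And>s. Inv m s \<Longrightarrow> \<not> eval_expr M a s < eval_expr M b s"
  obtains t where "exec M (While_less a b p) s t" "Inv m t"
proof -
  have "\<exists>t. exec M (While_less a b p) s t \<and> Inv m t" if "i \<le> m" "Inv i s" for i s
    using that
  proof (induction i arbitrary: s rule: inc_induct)
    case base
    then show ?case using stop exec.While_False by blast
  next
    case (step i)
    then show ?case using assms(2)[of i s] exec.While_True by (metis less_Suc_eq_le)
  qed
  from this[of 0 s] assms(1) that show ?thesis by auto
qed

subsection \<open>Counters\<close>

definition double_expr :: "nat \<Rightarrow> fp_expr" where
  "double_expr r = Bin Plus (Reg r) (Reg r)"

text \<open>The powers of 2 as a program sees them. \<open>fl_op\<close> is a function, so doubling
  from 1 a second time runs through the same values.\<close>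

primrec counter :: "fp_arith \<Rightarrow> nat \<Rightarrow> real" where
  "counter M 0 = 1"
| "counter M (Suc i) = fl_op M Plus (counter M i) (counter M i)"

text \<open>Rounded doubling multiplies by a factor between 3/2 and 5/2. The coarser upper bound 4
  is convenient because \<open>4 ^ m = (2 ^ m)\<^sup>2\<close> fits a test against the squared
  round-off.\<close>

lemma counter_bounds:
  assumes M: "standard_model M" and u: "roundoff M \<le> 1 / 4"
  shows "0 < counter M i" "3 / 2 * counter M i \<le> counter M (Suc i)" "counter M (Suc i) \<le> 4 * counter M i"
proof -
  have step: "3 / 2 * c \<le> fl_op M Plus c c \<and> fl_op M Plus c c \<le> 4 * c" if "0 < c" for c
  proof -
    have "\<bar>fl_op M Plus c c - 2 * c\<bar> \<le> roundoff M * (2 * c)"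
      using standard_modelD(2)[OF M, of Plus c c] that by simp
    also have "\<dots> \<le> 1 / 4 * (2 * c)" using u that by (intro mult_right_mono) auto
    finally have "\<bar>fl_op M Plus c c - 2 * c\<bar> \<le> c / 2" by simp
    then show ?thesis using that by linarith
  qed
  show pos: "0 < counter M i" by (induction i) (use step in \<open>force simp: less_le_trans\<close>)+
  show "3 / 2 * counter M i \<le> counter M (Suc i)" "counter M (Suc i) \<le> 4 * counter M i" using step[OF pos] by auto
qed

lemma counter_strict_mono:
  assumes "standard_model M" "roundoff M \<le> 1 / 4" "i < j"
  shows "counter M i < counter M j"
proof -
  have "counter M i < counter M (Suc i)" for i
    using counter_bounds(1,2)[OF assms(1,2), of i] by linarith
  then show ?thesis using assms(3) by (rule lift_Suc_mono_less)
qed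

text \<open>The squaring loop may stop once \<open>2\<^sup>m\<close> exceeds the order of \<open>1 / u\<close>. The counter is only bounded by
  \<open>4\<^sup>m\<close>, hence the test against \<open>1 / u\<^sup>2\<close>.\<close>

definition counter_test :: fp_expr where
  "counter_test = Bin Times (Bin Times (Reg 0) Roundoff) Roundoff"

lemma counter_stop:
  assumes M: "standard_model M" and u: "roundoff M \<le> 1 / 4"
  obtains m where "\<And>i s. i < m \<Longrightarrow> s 0 = counter M i \<Longrightarrow> eval_expr M counter_test s < 1"
    and "\<And>s. s 0 = counter M m \<Longrightarrow> \<not> eval_expr M counter_test s < 1"
    and "1 / (2 * roundoff M) \<le> 2 ^ m"
proof -
  define v where "v = roundoff M"
  define g where "g = (\<lambda>c. fl_op M Times (fl_op M Times c v) v)"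
  have v: "0 < v" "v \<le> 1 / 4" using standard_modelD(1)[OF M] u by (auto simp: v_def)
  have rnd: "(1 - v) * (c * v) \<le> fl_op M Times c v \<and> fl_op M Times c v \<le> (1 + v) * (c * v)" if "0 < c" for c
  proof -
    have "\<bar>fl_op M Times c v - c * v\<bar> \<le> v * (c * v)"
      using standard_modelD(2)[OF M, of Times v c] that v by (simp add: v_def)
    then show ?thesis by (auto simp: abs_le_iff algebra_simps)
  qed
  \<comment> \<open>Each of the two roundings changes the value at most by a factor between 1/2 and
    2.\<close>
  have g: "c * v\<^sup>2 / 4 \<le> g c \<and> g c \<le> 4 * (c * v\<^sup>2)" if c: "0 < c" for c
  proof -
    define d where "d = fl_op M Times c v"
    have "1 / 2 * (c * v) \<le> (1 - v) * (c * v)" "(1 + v) * (c * v) \<le> 2 * (c * v)"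
      using v c by (intro mult_right_mono; simp)+
    then have d: "1 / 2 * (c * v) \<le> d" "d \<le> 2 * (c * v)" using rnd[OF c] by (auto simp: d_def)
    have "0 < c * v" using c v by simp
    then have d0: "0 < d" using d(1) by linarith
    have "1 / 2 * (d * v) \<le> (1 - v) * (d * v)" "(1 + v) * (d * v) \<le> 2 * (d * v)"
      using v d0 by (intro mult_right_mono; simp)+
    then have gd: "1 / 2 * (d * v) \<le> g c" "g c \<le> 2 * (d * v)" using rnd[OF d0] by (auto simp: g_def d_def)
    have "1 / 2 * (c * v) * v \<le> d * v" "d * v \<le> 2 * (c * v) * v"
      using d v by (intro mult_right_mono; simp)+
    then show ?thesis using gd by (simp add: power2_eq_square)
  qed
  have grow: "(3 / 2) ^ i \<le> counter M i" for i
  proof (induction i)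
    case (Suc i)
    then show ?case using counter_bounds(2)[OF M u, of i] by simp
  qed simp
  have upper: "counter M i \<le> 4 ^ i" for i
  proof (induction i)
    case (Suc i)
    then show ?case using counter_bounds(3)[OF M u, of i] by simp
  qed simp
  obtain i0 where i0: "4 / v\<^sup>2 < (3 / 2) ^ i0" using real_arch_pow[of "3 / 2" "4 / v\<^sup>2"] by auto
  have "4 / v\<^sup>2 \<le> counter M i0" using i0 grow[of i0] by linarith
  then have "1 \<le> counter M i0 * v\<^sup>2 / 4" using v by (simp add: field_simps)
  then have ex: "\<not> g (counter M i0) < 1" using g[OF counter_bounds(1)[OF M u], of i0] by linarith
  \<comment> \<open>The rounded test need not be monotone in the counter. The loop ends at the first
    failure, and minimality gives success at all smaller indices.\<close>
  define m where "m = (LEAST i. \<not> g (counter M i) < 1)"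
  have m1: "\<not> g (counter M m) < 1" unfolding m_def by (rule LeastI[of "\<lambda>i. \<not> g (counter M i) < 1", OF ex])
  have m2: "g (counter M i) < 1" if "i < m" for i using not_less_Least[of i "\<lambda>i. \<not> g (counter M i) < 1"] that m_def by auto
  have ev: "eval_expr M counter_test s = g (s 0)" for s by (simp add: counter_test_def g_def v_def)
  \<comment> \<open>Failure of the test bounds the counter from below. With
    \<open>counter M m \<le> (2 ^ m)\<^sup>2\<close> both sides are squares, and the root gives the
    bound on \<open>2 ^ m\<close>.\<close>
  have "1 \<le> 4 * (counter M m * v\<^sup>2)" using m1 g[OF counter_bounds(1)[OF M u], of m] by linarith
  also have "\<dots> \<le> 4 * (4 ^ m * v\<^sup>2)" using upper[of m] by (intro mult_left_mono mult_right_mono) auto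
  also have "(4 :: real) ^ m = (2 ^ m)\<^sup>2" by (simp add: power2_eq_square flip: power_mult_distrib)
  also have "4 * ((2 ^ m)\<^sup>2 * v\<^sup>2) = (2 * 2 ^ m * v)\<^sup>2" by (simp add: power_mult_distrib)
  finally have "1\<^sup>2 \<le> (2 * 2 ^ m * v)\<^sup>2" by simp
  then have "1 \<le> 2 * 2 ^ m * v" using v by (subst (asm) power_mono_iff) auto
  then have "1 / (2 * v) \<le> 2 ^ m" using v by (simp add: field_simps)
  then show ?thesis using that[of m] m1 m2 by (simp add: ev v_def)
qed

section \<open>Computation with high relative accuracy\<close>

subsection \<open>Eigenvalues from minors\<close>

text \<open>Registers 0 and 1 stay free for the loop counter and for its final value in the squaring
  loop.\<close>

definition minor_reg :: "nat set \<Rightarrow> nat set \<Rightarrow> nat" where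
  "minor_reg I J = 2 + prod_encode (set_encode I, set_encode J)"

definition minor_state :: "real mat \<Rightarrow> nat \<Rightarrow> real" where
  "minor_state X r = (let (a, b) = prod_decode (r - 2) in minor X (set_decode a) (set_decode b))"

lemma minor_state [simp]: "finite I \<Longrightarrow> finite J \<Longrightarrow> minor_state X (minor_reg I J) = minor X I J"
  by (simp add: minor_state_def minor_reg_def)

definition minor_pairs :: "nat \<Rightarrow> (nat set \<times> nat set) set" where
  "minor_pairs N = (\<Union>k. ksubsets N k \<times> ksubsets N k)"

lemma finite_minor_pairs: "finite (minor_pairs N)"
  by (rule finite_subset[of _ "Pow {..<N} \<times> Pow {..<N}"]) (auto simp: minor_pairs_def ksubsets_def)

definition store_minors :: "nat \<Rightarrow> (nat set \<Rightarrow> nat set \<Rightarrow> fp_expr) \<Rightarrow> (nat \<times> fp_expr) list" where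
  "store_minors N f = map (\<lambda>(I, J). (minor_reg I J, f I J)) (enumeration (minor_pairs N))"

lemma store_minors:
  shows "distinct (map fst (store_minors N f))"
    and "I \<in> ksubsets N k \<Longrightarrow> J \<in> ksubsets N k \<Longrightarrow> (minor_reg I J, f I J) \<in> set (store_minors N f)"
    and "r \<in> fst ` set (store_minors N f) \<Longrightarrow> 2 \<le> r"
proof -
  have fin: "finite I" "finite J" if "(I, J) \<in> minor_pairs N" for I J
    using that ksubsets_finite by (auto simp: minor_pairs_def)
  have inj: "inj_on (\<lambda>(I, J). minor_reg I J) (minor_pairs N)"
    by (rule inj_onI) (use fin in \<open>auto simp: minor_reg_def set_encode_eq\<close>)
  have "map fst (store_minors N f) = map (\<lambda>(I, J). minor_reg I J) (enumeration (minor_pairs N))"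
    by (auto simp: store_minors_def)
  then show "distinct (map fst (store_minors N f))"
    using inj by (simp add: distinct_map enumeration[OF finite_minor_pairs])
  show "(minor_reg I J, f I J) \<in> set (store_minors N f)" if "I \<in> ksubsets N k" "J \<in> ksubsets N k"
  proof -
    have "(I, J) \<in> minor_pairs N" using that by (auto simp: minor_pairs_def)
    then show ?thesis by (auto simp: store_minors_def enumeration[OF finite_minor_pairs] image_iff intro!: bexI[of _ "(I, J)"])
  qed
  show "2 \<le> r" if "r \<in> fst ` set (store_minors N f)"
    using that by (auto simp: store_minors_def minor_reg_def)
qed

definition near_minors :: "nat \<Rightarrow> real \<Rightarrow> real mat \<Rightarrow> (nat \<Rightarrow> real) \<Rightarrow> bool" where
  "near_minors N q X s \<longleftrightarrow> (\<forall>k. \<forall>I\<in>ksubsets N k. \<forall>J\<in>ksubsets N k. near q (minor X I J) (s (minor_reg I J)))"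

definition product_expr :: "nat \<Rightarrow> nat set \<Rightarrow> nat set \<Rightarrow> fp_expr" where
  "product_expr N I J = sum_expr (map (\<lambda>K. Bin Times (Reg (minor_reg I K)) (Reg (minor_reg K J)))
     (enumeration (ksubsets N (card I))))"

lemma card_ksubsets_le: "card (ksubsets N k) \<le> 2 ^ N"
  using card_mono[of "Pow {..<N}" "ksubsets N k"] by (auto simp: card_Pow ksubsets_def)

text \<open>The two factors contribute \<open>2 * q\<close>, the multiplication twice the round-off,
  and so does each of at most \<open>2 ^ N\<close> additions. The errors of the summands enter the
  sum only through their maximum.\<close>

lemma near_product_expr:
  assumes M: "standard_model M" and u: "roundoff M \<le> 1 / 4" and X: "X \<in> carrier_mat N N"
    and q: "0 \<le> q" and s: "near_minors N q X s"
    and I: "I \<in> ksubsets N k" and J: "J \<in> ksubsets N k"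
  shows "near (2 * q + (2 + 2 * 2 ^ N) * roundoff M) (minor (X * X) I J) (eval_expr M (product_expr N I J) s)"
proof -
  let ?u = "roundoff M"
  have u0: "0 < ?u" by (rule standard_modelD(1)[OF M])
  have kI: "card I = k" using I by (simp add: ksubsets_def)
  note fin = ksubsets_finite[OF I] ksubsets_finite[OF J]
  have "near (error q ?u (product_expr N I J)) (exact_eval (product_expr N I J) (minor_state X)) (eval_expr M (product_expr N I J) s)"
  proof (rule near_eval[OF M])
    show "near q (minor_state X r) (s r)" if "r \<in> registers (product_expr N I J)" for r
    proof -
      from that obtain K where K: "K \<in> ksubsets N k" and r: "r = minor_reg I K \<or> r = minor_reg K J"
        by (auto simp: product_expr_def kI enumeration)
      have "near q (minor X I K) (s (minor_reg I K))" "near q (minor X K J) (s (minor_reg K J))"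
        using s I J K unfolding near_minors_def by blast+
      then show ?thesis using r fin ksubsets_finite[OF K] by auto
    qed
  qed (use u in \<open>auto simp: product_expr_def\<close>)
  also have "exact_eval (product_expr N I J) (minor_state X) = minor (X * X) I J"
    unfolding minor_mult[OF X X I J] product_expr_def kI exact_eval_sum_expr
    by (simp add: o_def sum_list_enumeration) (intro sum.cong refl, use fin ksubsets_finite in simp)
  finally show ?thesis
  proof (rule near_mono)
    have "error q ?u (product_expr N I J) \<le> (2 * q + 2 * ?u) +
      2 * ?u * length (map (\<lambda>K. Bin Times (Reg (minor_reg I K)) (Reg (minor_reg K J))) (enumeration (ksubsets N (card I))))"
      unfolding product_expr_def by (rule error_sum_expr) (use q u0 in auto)
    also have "\<dots> = 2 * q + 2 * ?u + 2 * ?u * real (card (ksubsets N k))"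
      by (simp add: enumeration kI)
    also have "\<dots> \<le> 2 * q + 2 * ?u + 2 * ?u * 2 ^ N"
      using u0 of_nat_mono[OF card_ksubsets_le[of N k], where 'a = real] by (intro add_left_mono mult_left_mono) auto
    finally show "error q ?u (product_expr N I J) \<le> 2 * q + (2 + 2 * 2 ^ N) * ?u" by (simp add: algebra_simps)
  qed
qed

definition trace_expr :: "nat \<Rightarrow> nat \<Rightarrow> fp_expr" where
  "trace_expr N k = sum_expr (map (\<lambda>I. Reg (minor_reg I I)) (enumeration (ksubsets N k)))"

lemma near_trace_expr:
  assumes M: "standard_model M" and u: "roundoff M \<le> 1 / 4" and X: "X \<in> carrier_mat N N"
    and q: "0 \<le> q" and s: "near_minors N q X s"
  shows "near (q + 2 * 2 ^ N * roundoff M) (ktrace k X) (eval_expr M (trace_expr N k) s)"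
proof -
  let ?u = "roundoff M"
  have u0: "0 < ?u" by (rule standard_modelD(1)[OF M])
  have "near (error q ?u (trace_expr N k)) (exact_eval (trace_expr N k) (minor_state X)) (eval_expr M (trace_expr N k) s)"
  proof (rule near_eval[OF M])
    show "near q (minor_state X r) (s r)" if "r \<in> registers (trace_expr N k)" for r
      using that s ksubsets_finite by (fastforce simp: trace_expr_def enumeration near_minors_def)
  qed (use u in \<open>auto simp: trace_expr_def\<close>)
  also have "exact_eval (trace_expr N k) (minor_state X) = ktrace k X"
    using X unfolding ktrace_def trace_expr_def exact_eval_sum_expr
    by (simp add: o_def sum_list_enumeration) (intro sum.cong refl, use ksubsets_finite in simp)
  finally show ?thesis
  proof (rule near_mono)
    have "error q ?u (trace_expr N k) \<le> q + 2 * ?u * length (map (\<lambda>I. Reg (minor_reg I I)) (enumeration (ksubsets N k)))"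
      unfolding trace_expr_def by (rule error_sum_expr) (use q u0 in auto)
    also have "\<dots> = q + 2 * ?u * real (card (ksubsets N k))" by (simp add: enumeration)
    also have "\<dots> \<le> q + 2 * ?u * 2 ^ N"
      using u0 of_nat_mono[OF card_ksubsets_le[of N k], where 'a = real] by (intro add_left_mono mult_left_mono) auto
    finally show "error q ?u (trace_expr N k) \<le> q + 2 * 2 ^ N * ?u" by (simp add: algebra_simps)
  qed
qed

lemma pow_mat_add:
  fixes A :: "'a :: semiring_1 mat"
  assumes "A \<in> carrier_mat n n"
  shows "A ^\<^sub>m (i + j) = A ^\<^sub>m i * A ^\<^sub>m j"
  using assms by (induction j) (simp_all add: assoc_mult_mat[of _ n n _ n _ n])

definition square_step :: "nat \<Rightarrow> fp_prog" where
  "square_step N = parallel_assign ((0, double_expr 0) # store_minors N (product_expr N))"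

text \<open>The final counter value moves to register 1 as the limit of the second loop, and the
  counter restarts at 1. The range includes \<open>k = 0\<close>, whose trace is an empty minor and
  serves as the denominator of the first quotient.\<close>

definition trace_step :: "nat \<Rightarrow> fp_prog" where
  "trace_step N = parallel_assign ((0, One) # (1, Reg 0) # map (\<lambda>k. (2 + k, trace_expr N k)) [0..<N + 1])"

definition root_step :: "nat \<Rightarrow> fp_prog" where
  "root_step N = parallel_assign ((0, double_expr 0) # (1, Reg 1) # map (\<lambda>k. (2 + k, Root (Reg (2 + k)))) [0..<N + 1])"

definition quotient_step :: "nat \<Rightarrow> fp_prog" where
  "quotient_step N = parallel_assign (map (\<lambda>k. (k, Bin Divide (Reg (3 + k)) (Reg (2 + k)))) [0..<N])"

definition eigenvalue_program :: "nat \<Rightarrow> fp_prog" where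
  "eigenvalue_program N = Seq (While_less counter_test One (square_step N))
     (Seq (trace_step N) (Seq (While_less (Reg 0) (Reg 1) (root_step N)) (quotient_step N)))"

text \<open>Squaring doubles the multiplicative error, but the final \<open>m\<close>-fold square root divides it by \<open>2\<^sup>m\<close> again.
  It also reduces the distance between \<open>ktrace k (X\<^bsup>p\<^esup>)\<close>, for \<open>p = 2\<^sup>m\<close>, and the \<open>p\<close>-th power of the product of the
  \<open>k\<close> largest eigenvalues to the order of the unit round-off.\<close>

lemma exec_eigenvalue_program:
  fixes N :: nat and c0 :: real
  defines "C \<equiv> 2 * (c0 + 2 + 4 * 2 ^ N + 2 * real N + 4) + 2"
  assumes M: "standard_model M" and u: "roundoff M \<le> 1 / 4" and X: "X \<in> carrier_mat N N"
    and es: "eigenvalue_list X es" "length es = N" "\<And>x. x \<in> set es \<Longrightarrow> 0 < x" "sorted (rev es)"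
    and c0: "0 \<le> c0" and s: "near_minors N (c0 * roundoff M) X s" "s 0 = 1"
  obtains t where "exec M (eigenvalue_program N) s t" "\<And>k. k < N \<Longrightarrow> near (C * roundoff M) (es ! k) (t k)"
proof -
  define v where "v = roundoff M"
  have v: "0 < v" using standard_modelD(1)[OF M] by (simp add: v_def)
  obtain m where m: "\<And>i s. i < m \<Longrightarrow> s 0 = counter M i \<Longrightarrow> eval_expr M counter_test s < 1"
    "\<And>s. s 0 = counter M m \<Longrightarrow> \<not> eval_expr M counter_test s < 1" "1 / (2 * v) \<le> 2 ^ m"
    using counter_stop[OF M u] unfolding v_def by blast
  define C1 where "C1 = (2 + 2 * 2 ^ N :: real)"
  \<comment> \<open>Solution of \<open>q (Suc i) = 2 * q i + C1 * v\<close> with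
    \<open>q 0 = c0 * v\<close>.\<close>
  define q where "q = (\<lambda>i :: nat. 2 ^ i * (c0 + C1) * v - C1 * v)"
  have C1: "0 \<le> C1" by (simp add: C1_def)
  have q0: "0 \<le> q i" for i
  proof -
    have "1 * C1 \<le> 2 ^ i * (c0 + C1)" using C1 c0 by (intro mult_mono) auto
    then have "1 * C1 * v \<le> 2 ^ i * (c0 + C1) * v" using v by (intro mult_right_mono) auto
    then show ?thesis by (simp add: q_def)
  qed
  have double: "eval_expr M (double_expr r) s = counter M (Suc i)" if "s r = counter M i" for r s i
    using that by (simp add: double_expr_def)
  define Inv where "Inv = (\<lambda>i s. s 0 = counter M i \<and> near_minors N (q i) (X ^\<^sub>m (2 ^ i)) s)"
  have pow2: "X ^\<^sub>m (2 ^ Suc i) = X ^\<^sub>m (2 ^ i) * X ^\<^sub>m (2 ^ i)" for i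
    using X by (simp add: mult_2 pow_mat_add[OF X])
  obtain s1 where s1: "exec M (While_less counter_test One (square_step N)) s s1" "Inv m s1"
  proof (rule exec_while[of Inv s m M counter_test One "square_step N"])
    show "Inv 0 s" using s X by (simp add: Inv_def q_def v_def algebra_simps)
    show "\<not> eval_expr M counter_test t < eval_expr M One t" if "Inv m t" for t
      using that m(2)[of t] by (simp add: Inv_def)
    fix i t assume i: "i < m" and t: "Inv i t"
    have dist: "distinct (map fst ((0, double_expr 0) # store_minors N (product_expr N)))"
      using store_minors(1)[of N] store_minors(3)[of 0 N] by auto
    obtain t' where t': "exec M (square_step N) t t'"
      "\<And>r e. (r, e) \<in> set ((0, double_expr 0) # store_minors N (product_expr N)) \<Longrightarrow> t' r = eval_expr M e t"
      unfolding square_step_def by (rule exec_parallel_assign[OF dist, of M t]) blast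
    have "t' 0 = counter M (Suc i)" using t'(2)[of 0 "double_expr 0"] double[of t 0 i] t by (simp add: Inv_def)
    moreover have "near_minors N (q (Suc i)) (X ^\<^sub>m (2 ^ Suc i)) t'"
      unfolding near_minors_def
    proof (intro allI ballI)
      fix k I J assume I: "I \<in> ksubsets N k" and J: "J \<in> ksubsets N k"
      have "near (2 * q i + (2 + 2 * 2 ^ N) * roundoff M) (minor (X ^\<^sub>m (2 ^ i) * X ^\<^sub>m (2 ^ i)) I J) (eval_expr M (product_expr N I J) t)"
        by (rule near_product_expr[OF M u _ q0 _ I J]) (use X t in \<open>auto simp: Inv_def\<close>)
      moreover have "t' (minor_reg I J) = eval_expr M (product_expr N I J) t"
        using t'(2) store_minors(2)[OF I J, of "product_expr N"] by simp
      moreover have "2 * q i + (2 + 2 * 2 ^ N) * roundoff M = q (Suc i)"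
        by (simp add: q_def v_def C1_def algebra_simps)
      ultimately show "near (q (Suc i)) (minor (X ^\<^sub>m (2 ^ Suc i)) I J) (t' (minor_reg I J))"
        unfolding pow2 by simp
    qed
    ultimately have "Inv (Suc i) t'" by (simp add: Inv_def)
    then show "eval_expr M counter_test t < eval_expr M One t \<and> (\<exists>t'. exec M (square_step N) t t' \<and> Inv (Suc i) t')"
      using m(1)[OF i, of t] t t'(1) by (auto simp: Inv_def)
  qed blast
  define P where "P = (\<lambda>k. \<Prod>i<k. es ! i)"
  have es_pos: "0 < es ! i" if "i < N" for i using es(2,3) that by simp
  have P_pos: "0 < P k" if "k \<le> N" for k unfolding P_def using that es_pos by (intro prod_pos) auto
  \<comment> \<open>Logarithmic error of the computed traces as approximations to
    \<open>P k ^ (2 ^ m)\<close>: \<open>q m\<close> from the squarings, then the additions in the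
    trace, then \<open>real N\<close> because \<open>2 ^ N \<le> exp (real N)\<close>.\<close>
  define r where "r = q m + 2 * 2 ^ N * v + real N"
  have dist2: "distinct (map fst ((0, a) # (1, b) # map (\<lambda>k. (2 + k, f k)) [0..<N + 1]))" for a b :: fp_expr and f
    by (auto simp: distinct_map o_def inj_on_def)
  obtain s2 where s2: "exec M (trace_step N) s1 s2" "s2 0 = 1" "s2 1 = counter M m"
    "\<And>k. k \<le> N \<Longrightarrow> near r (P k ^ (2 ^ m)) (s2 (2 + k))"
  proof -
    obtain s2 where s2: "exec M (trace_step N) s1 s2"
      "\<And>r e. (r, e) \<in> set ((0, One) # (1, Reg 0) # map (\<lambda>k. (2 + k, trace_expr N k)) [0..<N + 1]) \<Longrightarrow> s2 r = eval_expr M e s1"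
      unfolding trace_step_def
      by (rule exec_parallel_assign[OF dist2[of One "Reg 0" "trace_expr N"], of M s1]) blast
    have "near r (P k ^ (2 ^ m)) (s2 (2 + k))" if k: "k \<le> N" for k
    proof -
      have "s2 (2 + k) = eval_expr M (trace_expr N k) s1" by (rule s2(2)) (use k in \<open>auto simp: image_iff\<close>)
      moreover have "near (q m + 2 * 2 ^ N * v) (ktrace k (X ^\<^sub>m (2 ^ m))) (eval_expr M (trace_expr N k) s1)"
        unfolding v_def by (rule near_trace_expr[OF M u _ q0]) (use X s1(2) in \<open>auto simp: Inv_def\<close>)
      moreover have "near (real N) (P k ^ (2 ^ m)) (ktrace k (X ^\<^sub>m (2 ^ m)))"
      proof -
        have b: "P k ^ (2 ^ m) \<le> ktrace k (X ^\<^sub>m (2 ^ m))" "ktrace k (X ^\<^sub>m (2 ^ m)) \<le> 2 ^ N * P k ^ (2 ^ m)"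
          unfolding P_def using ktrace_pow_bounds[OF X es k] by blast+
        have "(2 :: real) \<le> exp 1" using exp_ge_add_one_self[of 1] by simp
        then have "(2 :: real) ^ N \<le> exp 1 ^ N" by (intro power_mono) auto
        then have e: "2 ^ N \<le> exp (real N)" by (simp flip: exp_of_nat_mult)
        have Pp: "0 \<le> P k ^ (2 ^ m)" using P_pos[OF k] by simp
        have "2 ^ N * P k ^ (2 ^ m) \<le> exp (real N) * P k ^ (2 ^ m)" using e Pp by (rule mult_right_mono)
        moreover have "1 * ktrace k (X ^\<^sub>m (2 ^ m)) \<le> exp (real N) * ktrace k (X ^\<^sub>m (2 ^ m))"
          using b(1) Pp by (intro mult_right_mono) auto
        ultimately show ?thesis using b Pp by (simp add: near_def)
      qed
      ultimately show ?thesis using near_trans[of "real N"] by (fastforce simp: r_def add_ac)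
    qed
    then show ?thesis using that[of s2] s2(1) s2(2)[of 0 One] s2(2)[of 1 "Reg 0"] s1(2) by (simp add: Inv_def)
  qed
  have r0: "0 \<le> r" unfolding r_def using q0[of m] v by simp
  \<comment> \<open>A root halves the error and adds \<open>2 * v\<close>. The map sending
    \<open>x\<close> to \<open>x / 2 + 2 * v\<close> has the fixed point \<open>4 * v\<close>, while
    the initial error \<open>r\<close> is halved in every round.\<close>
  define Inv' where "Inv' = (\<lambda>i s. s 0 = counter M i \<and> s 1 = counter M m \<and>
    (\<forall>k\<le>N. near (r / 2 ^ i + 4 * v) (P k ^ (2 ^ (m - i))) (s (2 + k))))"
  obtain s3 where s3: "exec M (While_less (Reg 0) (Reg 1) (root_step N)) s2 s3" "Inv' m s3"
  proof (rule exec_while[of Inv' s2 m M "Reg 0" "Reg 1" "root_step N"])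
    show "Inv' 0 s2" using s2(2,3) v near_mono[OF s2(4), of _ "r + 4 * v"] by (simp add: Inv'_def)
    show "\<not> eval_expr M (Reg 0) t < eval_expr M (Reg 1) t" if "Inv' m t" for t
      using that by (simp add: Inv'_def)
    fix i t assume i: "i < m" and t: "Inv' i t"
    obtain t' where t': "exec M (root_step N) t t'"
      "\<And>r e. (r, e) \<in> set ((0, double_expr 0) # (1, Reg 1) # map (\<lambda>k. (2 + k, Root (Reg (2 + k)))) [0..<N + 1]) \<Longrightarrow> t' r = eval_expr M e t"
      unfolding root_step_def
      by (rule exec_parallel_assign[OF dist2[of "double_expr 0" "Reg 1" "\<lambda>k. Root (Reg (2 + k))"], of M t]) blast
    have "near (r / 2 ^ Suc i + 4 * v) (P k ^ (2 ^ (m - Suc i))) (t' (2 + k))" if k: "k \<le> N" for k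
    proof -
      have n: "near (r / 2 ^ i + 4 * v) (P k ^ (2 ^ (m - i))) (t (2 + k))" using t k by (simp add: Inv'_def)
      have "m - i = Suc (m - Suc i)" using i by simp
      then have "P k ^ (2 ^ (m - i)) = (P k ^ (2 ^ (m - Suc i)))\<^sup>2" by (simp add: mult.commute flip: power_mult)
      then have sq: "sqrt (P k ^ (2 ^ (m - i))) = P k ^ (2 ^ (m - Suc i))" using P_pos[OF k] by simp
      have "near ((r / 2 ^ i + 4 * v) / 2 + 2 * v) (sqrt (P k ^ (2 ^ (m - i)))) (fl_sqrt M (t (2 + k)))"
        unfolding v_def using near_trans[OF near_sqrt[OF n] near_fl_sqrt[OF M _ near_nonneg(2)[OF n]]] u by (simp add: v_def)
      moreover have "t' (2 + k) = eval_expr M (Root (Reg (2 + k))) t" by (rule t'(2)) (use k in \<open>auto simp: image_iff\<close>)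
      ultimately show ?thesis unfolding sq by (simp add: field_simps)
    qed
    then have "Inv' (Suc i) t'"
      using t'(2)[of 0 "double_expr 0"] t'(2)[of 1 "Reg 1"] double[of t 0 i] t by (simp add: Inv'_def)
    then show "eval_expr M (Reg 0) t < eval_expr M (Reg 1) t \<and> (\<exists>t'. exec M (root_step N) t t' \<and> Inv' (Suc i) t')"
      using counter_strict_mono[OF M u i] t t'(1) by (auto simp: Inv'_def)
  qed blast
  define C2 where "C2 = c0 + 2 + 4 * 2 ^ N + 2 * real N + 4"
  have rho: "near (C2 * v) (P k) (s3 (2 + k))" if k: "k \<le> N" for k
  proof -
    have "near (r / 2 ^ m + 4 * v) (P k) (s3 (2 + k))" using s3(2) k by (simp add: Inv'_def)
    moreover have "r / 2 ^ m + 4 * v \<le> C2 * v"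
    proof -
      have "r / 2 ^ m \<le> (2 ^ m * (c0 + C1) * v + 2 * 2 ^ N * v + real N) / 2 ^ m"
        unfolding r_def q_def using C1 v by (intro divide_right_mono) auto
      also have "\<dots> = (c0 + C1) * v + 2 * 2 ^ N * v / 2 ^ m + real N * (1 / 2 ^ m)"
        by (simp add: add_divide_distrib)
      \<comment> \<open>Only \<open>real N\<close> is not proportional to \<open>v\<close> by
        itself; the stopping bound \<open>1 / 2 ^ m \<le> 2 * v\<close> supplies the factor.\<close>
      also have "\<dots> \<le> (c0 + C1) * v + 2 * 2 ^ N * v + real N * (2 * v)"
      proof (intro add_mono mult_left_mono order_refl)
        have "2 * 2 ^ N * v / 2 ^ m \<le> 2 * 2 ^ N * v / 1" using v by (intro divide_left_mono) auto
        then show "2 * 2 ^ N * v / 2 ^ m \<le> 2 * 2 ^ N * v" by simp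
        show "1 / 2 ^ m \<le> 2 * v" using m(3) v by (simp add: field_simps)
      qed (use c0 C1 in auto)
      finally show ?thesis by (simp add: C2_def C1_def algebra_simps)
    qed
    ultimately show ?thesis by (rule near_mono)
  qed
  have "distinct (map fst (map (\<lambda>k. (k, Bin Divide (Reg (3 + k)) (Reg (2 + k)))) [0..<N]))" by (simp add: o_def)
  then obtain t where t: "exec M (quotient_step N) s3 t"
    "\<And>r e. (r, e) \<in> set (map (\<lambda>k. (k, Bin Divide (Reg (3 + k)) (Reg (2 + k)))) [0..<N]) \<Longrightarrow> t r = eval_expr M e s3"
    unfolding quotient_step_def by (rule exec_parallel_assign[of _ M s3]) blast+
  have "near (C * v) (es ! k) (t k)" if k: "k < N" for k
  proof -
    have n: "near (C2 * v) (P (Suc k)) (s3 (3 + k))" "near (C2 * v) (P k) (s3 (2 + k))"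
      using rho[of "Suc k"] rho[of k] k by (simp_all add: eval_nat_numeral)
    have "s3 (2 + k) \<noteq> 0" using near_nonzero[OF n(2)] P_pos[of k] k by simp
    then have "near (2 * v) (s3 (3 + k) / s3 (2 + k)) (fl_op M Divide (s3 (3 + k)) (s3 (2 + k)))"
      using near_fl_op[OF M, of Divide "s3 (3 + k)" "s3 (2 + k)"] u near_nonneg(2)[OF n(1)] near_nonneg(2)[OF n(2)]
      by (simp add: v_def)
    from near_trans[OF near_divide[OF n] this]
    have "near (C * v) (P (Suc k) / P k) (fl_op M Divide (s3 (3 + k)) (s3 (2 + k)))"
      by (simp add: C_def C2_def algebra_simps)
    moreover have "P (Suc k) = P k * es ! k" by (simp add: P_def)
    then have "P (Suc k) / P k = es ! k" using P_pos[of k] k by simp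
    moreover have "t k = fl_op M Divide (s3 (3 + k)) (s3 (2 + k))"
      using t(2)[of k "Bin Divide (Reg (3 + k)) (Reg (2 + k))"] k by (simp add: image_iff)
    ultimately show ?thesis by simp
  qed
  moreover have "exec M (eigenvalue_program N) s t"
    unfolding eigenvalue_program_def using s1(1) s2(1) s3(1) t(1) by (blast intro: exec.Seq)
  ultimately show ?thesis using that by (simp add: v_def)
qed

subsection \<open>Programs for the matrix of the decomposition\<close>

text \<open>\<open>near\<close> compares nonnegative numbers only. A signed result is therefore
  handled as a magnitude together with a sign that is known in advance.\<close>

definition signed :: "bool \<Rightarrow> real \<Rightarrow> real" where
  "signed b x = (if b then x else - x)"

definition signed_expr :: "bool \<Rightarrow> fp_expr \<Rightarrow> fp_expr" where
  "signed_expr b e = (if b then e else Bin Minus Zero e)"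

lemma hra_signed: "hra K M (signed b x) (signed b y) \<longleftrightarrow> hra K M x y"
  by (simp add: signed_def hra_minus)

lemma near_signed_expr:
  assumes M: "standard_model M" and u: "roundoff M \<le> 1 / 4" and e: "near q x (eval_expr M e s)"
  shows "near (q + 2 * roundoff M) x (signed b (eval_expr M (signed_expr b e) s))"
proof (cases b)
  case True
  then show ?thesis using near_mono[OF e] standard_modelD(1)[OF M] by (simp add: signed_def signed_expr_def)
next
  case False
  let ?y = "eval_expr M e s"
  have "near (2 * roundoff M) ?y (- fl_op M Minus 0 ?y)"
  proof (rule near_round)
    show "0 \<le> ?y" by (rule near_nonneg(2)[OF e])
    have "\<bar>fl_op M Minus 0 ?y - exact_op Minus 0 ?y\<bar> \<le> roundoff M * \<bar>exact_op Minus 0 ?y\<bar>"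
      by (rule standard_modelD(2)[OF M]) simp
    then show "\<bar>- fl_op M Minus 0 ?y - ?y\<bar> \<le> roundoff M * \<bar>?y\<bar>" by (simp add: abs_le_iff)
  qed (use standard_modelD(1)[OF M] u in auto)
  with near_trans[OF e this] False show ?thesis by (simp add: signed_def signed_expr_def)
qed

definition emit :: "nat \<Rightarrow> (nat \<Rightarrow> fp_expr) \<Rightarrow> fp_prog" where
  "emit L f = parallel_assign (map (\<lambda>r. (r, f r)) [0..<L])"

lemma exec_output:
  obtains t where "exec M (emit L f) s t" "\<And>r. r < L \<Longrightarrow> t r = eval_expr M (f r) s"
proof -
  have "distinct (map fst (map (\<lambda>r. (r, f r)) [0..<L]))" by (simp add: o_def)
  then obtain t where t: "exec M (emit L f) s t"
    "\<And>r e. (r, e) \<in> set (map (\<lambda>r. (r, f r)) [0..<L]) \<Longrightarrow> t r = eval_expr M e s"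
    unfolding emit_def by (rule exec_parallel_assign[of _ M s]) blast
  have "t r = eval_expr M (f r) s" if "r < L" for r by (rule t(2)) (use that in auto)
  with t(1) show ?thesis by (rule that)
qed

text \<open>The sum bounds the error of each single output; the 2 pays for the rounded subtraction
  from 0 by which a sign is changed.\<close>

definition total_error :: "real \<Rightarrow> (nat \<Rightarrow> fp_expr) \<Rightarrow> nat \<Rightarrow> real" where
  "total_error c f L = (\<Sum>r<L. error c 1 (f r)) + 2"

lemma total_error_nonneg: "0 \<le> c \<Longrightarrow> 0 \<le> total_error c f L"
  by (auto simp: total_error_def intro!: add_nonneg_nonneg sum_nonneg error_nonneg)

lemma exec_signed_output:
  assumes M: "standard_model M" and u: "roundoff M \<le> 1 / 4" and c: "0 \<le> c"
    and near: "\<And>r k. r < L \<Longrightarrow> k \<in> registers (f r) \<Longrightarrow> near (c * roundoff M) (s k) (s' k)"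
    and free: "\<And>r. r < L \<Longrightarrow> subtraction_free s (f r)"
  obtains t where "exec M (emit L (\<lambda>r. signed_expr (b r) (f r))) s' t"
    "\<And>r. r < L \<Longrightarrow> near (total_error c f L * roundoff M) (exact_eval (f r) s) (signed (b r) (t r))"
proof -
  have u0: "0 < roundoff M" by (rule standard_modelD(1)[OF M])
  obtain t where t: "exec M (emit L (\<lambda>r. signed_expr (b r) (f r))) s' t"
    "\<And>r. r < L \<Longrightarrow> t r = eval_expr M (signed_expr (b r) (f r)) s'"
    by (rule exec_output[of M L "\<lambda>r. signed_expr (b r) (f r)" s']) blast
  have "near (total_error c f L * roundoff M) (exact_eval (f r) s) (signed (b r) (t r))" if r: "r < L" for r
  proof -
    have "near (error (c * roundoff M) (roundoff M) (f r)) (exact_eval (f r) s) (eval_expr M (f r) s')"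
      by (rule near_eval[OF M]) (use u near free r in auto)
    from near_signed_expr[OF M u this, of "b r"]
    have "near (error (c * roundoff M) (roundoff M) (f r) + 2 * roundoff M) (exact_eval (f r) s) (signed (b r) (t r))"
      by (simp add: t(2)[OF r])
    moreover have "error c 1 (f r) \<le> (\<Sum>r<L. error c 1 (f r))"
      using c r by (intro member_le_sum) (auto intro: error_nonneg)
    then have "(error c 1 (f r) + 2) * roundoff M \<le> total_error c f L * roundoff M"
      unfolding total_error_def using u0 by (intro mult_right_mono) auto
    ultimately show ?thesis
      using u0 by (elim near_mono) (simp add: error_scale distrib_right)
  qed
  with t(1) show ?thesis by (rule that)
qed

lemma exec_near_output:
  assumes M: "standard_model M" and u: "roundoff M \<le> 1 / 4" and c: "0 \<le> c"
    and near: "\<And>r k. r < L \<Longrightarrow> k \<in> registers (f r) \<Longrightarrow> near (c * roundoff M) (s k) (s' k)"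
    and free: "\<And>r. r < L \<Longrightarrow> subtraction_free s (f r)"
  obtains t where "exec M (emit L f) s' t"
    "\<And>r. r < L \<Longrightarrow> near (total_error c f L * roundoff M) (exact_eval (f r) s) (t r)"
proof (rule exec_signed_output[OF M u c, where b = "\<lambda>_. True" and f = f and L = L and s = s and s' = s'])
  fix t assume "exec M (emit L (\<lambda>r. signed_expr True (f r))) s' t"
    "\<And>r. r < L \<Longrightarrow> near (total_error c f L * roundoff M) (exact_eval (f r) s) (signed True (t r))"
  then show ?thesis using that by (simp add: signed_expr_def signed_def)
qed (use near free in auto)

definition load_minors :: "nat \<Rightarrow> (nat set \<Rightarrow> nat set \<Rightarrow> fp_expr) \<Rightarrow> fp_prog" where
  "load_minors N f = parallel_assign ((0, One) # store_minors N f)"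

definition minors_error :: "real \<Rightarrow> nat \<Rightarrow> (nat set \<Rightarrow> nat set \<Rightarrow> fp_expr) \<Rightarrow> real" where
  "minors_error c N f = (\<Sum>(I, J)\<in>minor_pairs N. error c 1 (f I J))"

lemma minors_error_nonneg: "0 \<le> c \<Longrightarrow> 0 \<le> minors_error c N f"
  by (auto simp: minors_error_def intro!: sum_nonneg error_nonneg)

lemma exec_load_minors:
  assumes M: "standard_model M" and u: "roundoff M \<le> 1 / 4" and c: "0 \<le> c"
    and near: "\<And>k I J r. I \<in> ksubsets N k \<Longrightarrow> J \<in> ksubsets N k \<Longrightarrow> r \<in> registers (f I J) \<Longrightarrow>
      near (c * roundoff M) (s r) (s' r)"
    and free: "\<And>k I J. I \<in> ksubsets N k \<Longrightarrow> J \<in> ksubsets N k \<Longrightarrow> subtraction_free s (f I J)"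
    and X: "\<And>k I J. I \<in> ksubsets N k \<Longrightarrow> J \<in> ksubsets N k \<Longrightarrow> exact_eval (f I J) s = minor X I J"
  obtains t where "exec M (load_minors N f) s' t" "t 0 = 1" "near_minors N (minors_error c N f * roundoff M) X t"
proof -
  have u0: "0 < roundoff M" by (rule standard_modelD(1)[OF M])
  have dist: "distinct (map fst ((0, One) # store_minors N f))"
    using store_minors(1)[of N] store_minors(3)[of 0 N] by auto
  obtain t where t: "exec M (load_minors N f) s' t"
    "\<And>r e. (r, e) \<in> set ((0, One) # store_minors N f) \<Longrightarrow> t r = eval_expr M e s'"
    unfolding load_minors_def by (rule exec_parallel_assign[OF dist, of M s']) blast
  have "near (minors_error c N f * roundoff M) (minor X I J) (t (minor_reg I J))"
    if I: "I \<in> ksubsets N k" and J: "J \<in> ksubsets N k" for k I J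
  proof -
    have "near (error (c * roundoff M) (roundoff M) (f I J)) (exact_eval (f I J) s) (eval_expr M (f I J) s')"
      by (rule near_eval[OF M]) (use u near[OF I J] free[OF I J] in auto)
    moreover have "(I, J) \<in> minor_pairs N" using I J by (auto simp: minor_pairs_def)
    then have "(case (I, J) of (I, J) \<Rightarrow> error c 1 (f I J)) \<le> minors_error c N f"
      unfolding minors_error_def using c finite_minor_pairs
      by (intro member_le_sum) (auto intro: error_nonneg)
    then have "error c 1 (f I J) * roundoff M \<le> minors_error c N f * roundoff M"
      using u0 by (intro mult_right_mono) auto
    moreover have "t (minor_reg I J) = eval_expr M (f I J) s'"
      by (rule t(2)) (use store_minors(2)[OF I J] in auto)
    ultimately show ?thesis
      unfolding X[OF I J] using u0 by (auto simp: error_scale elim: near_mono)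
  qed
  then have "near_minors N (minors_error c N f * roundoff M) X t" by (auto simp: near_minors_def)
  moreover have "t 0 = 1" using t(2)[of 0 One] by simp
  ultimately show ?thesis using that t(1) by blast
qed

definition initial_state :: "real list \<Rightarrow> nat \<Rightarrow> real" where
  "initial_state xs r = (if r < length xs then xs ! r else 0)"

lemma obtains_hraI:
  assumes "exec M p (initial_state xs) t" "\<And>k. k < length ys \<Longrightarrow> hra K M (ys ! k) (t k)"
  shows "obtains_hra K M p xs ys"
  unfolding obtains_hra_def returns_def
  using assms by (intro exI[of _ "map t [0..<length ys]"] conjI exI[of _ t])
    (auto simp: list_all2_conv_all_nth initial_state_def[abs_def])

lemma concat_map_upt:
  "concat (map (\<lambda>i. map (f i) [0..<N]) [0..<m]) = map (\<lambda>r. f (r div N) (r mod N)) [0..<m * N]"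
proof (induction m)
  case (Suc m)
  have "[0..<Suc m * N] = [0..<m * N] @ [m * N..<N + m * N]"
    using upt_add_eq_append[of 0 "m * N" N] by (simp add: add.commute)
  moreover have "map (\<lambda>r. f (r div N) (r mod N)) [m * N..<N + m * N] = map (f m) [0..<N]"
    unfolding map_add_upt[symmetric] by (auto simp: div_add1_eq)
  ultimately show ?case using Suc by simp
qed simp

lemma entries_eq:
  assumes "A \<in> carrier_mat m N"
  shows "entries A = map (\<lambda>r. A $$ (r div N, r mod N)) [0..<m * N]"
  using assms unfolding entries_def mat_to_list_def by (simp add: concat_map_upt)

lemma Lp_BD_carrier: "Lp_BD n \<alpha> \<beta> \<gamma> \<in> carrier_mat (n + 1) (n + 1)"
  by (simp add: Lp_BD_def)

definition Lp_BD_expr :: "nat \<Rightarrow> nat \<Rightarrow> fp_expr" where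
  "Lp_BD_expr N r = (if r div N = r mod N then power_expr (r div N) (Bin Plus (Bin Times (Reg 0) (Reg 1)) (Reg 2))
     else if r div N > r mod N then Reg 1 else Reg 0)"

text \<open>What the programs use of the input. For \<open>n = 0\<close> the parameters \<open>\<alpha>\<close> and \<open>\<beta>\<close> do not occur in the
  decomposition, and the registers holding them otherwise are only raised to the power 0.\<close>

definition holds_BD :: "nat \<Rightarrow> real \<Rightarrow> real \<Rightarrow> real \<Rightarrow> (nat \<Rightarrow> real) \<Rightarrow> bool" where
  "holds_BD n \<alpha> \<beta> d s \<longleftrightarrow> (0 < n \<longrightarrow> s 1 = \<alpha> \<and> s (n + 1) = \<beta>) \<and> (\<forall>l\<le>n. s (l * (n + 1) + l) = d ^ l)"

lemma holds_BD_initial_state: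
  "holds_BD n \<alpha> \<beta> (\<alpha> * \<beta> + \<gamma>) (initial_state (entries (Lp_BD n \<alpha> \<beta> \<gamma>)))"
proof -
  have *: "initial_state (entries (Lp_BD n \<alpha> \<beta> \<gamma>)) (i * (n + 1) + j) = Lp_BD n \<alpha> \<beta> \<gamma> $$ (i, j)"
    if ij: "i \<le> n" "j \<le> n" for i j
  proof -
    have "i * (n + 1) + j < Suc i * (n + 1)" using ij by simp
    also have "\<dots> \<le> (n + 1) * (n + 1)" using ij by (intro mult_right_mono) auto
    finally have "i * (n + 1) + j < (n + 1) * (n + 1)" .
    moreover have "(i * (n + 1) + j) div (n + 1) = i" "(i * (n + 1) + j) mod (n + 1) = j"
      using ij by (simp_all add: div_add1_eq del: mult_Suc_right add_Suc_right)
    ultimately show ?thesis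
      by (simp add: initial_state_def entries_eq[OF Lp_BD_carrier] del: mult_Suc mult_Suc_right)
  qed
  show ?thesis
    unfolding holds_BD_def using *[of 0 1] *[of 1 0] * by (auto simp: Lp_BD_def)
qed

text \<open>These minors are nonnegative integers that depend on \<open>n\<close> only, so they can
  be written into the program as sums of ones.\<close>

definition pascal_minor :: "nat \<Rightarrow> nat set \<Rightarrow> nat set \<Rightarrow> nat" where
  "pascal_minor N I J = nat \<lfloor>minor (pascal N 1) I J\<rfloor>"

lemma pascal_minor:
  assumes I: "I \<in> ksubsets N k" and J: "J \<in> ksubsets N k"
  shows "real (pascal_minor N I J) = minor (pascal N 1) I J"
proof -
  have "submatrix (pascal N 1) I J = map_mat real_of_int (mat k k (\<lambda>(a, b). int (pick I a choose pick J b)))"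
    unfolding submatrix_ksubsets[OF pascal_carrier I J]
    by (rule eq_matI) (use ksubsets_pick_less[OF I] ksubsets_pick_less[OF J] in auto)
  then have "minor (pascal N 1) I J = real_of_int (det (mat k k (\<lambda>(a, b). int (pick I a choose pick J b))))"
    by (simp only: of_int_hom.hom_det)
  then show ?thesis using minor_pascal_nonneg[OF I J] by (simp add: pascal_minor_def)
qed

definition scaled_expr :: "nat \<Rightarrow> nat \<Rightarrow> fp_expr" where
  "scaled_expr N l = Bin Divide (Reg (l * N + l)) (power_expr l (Bin Times (Reg 1) (Reg N)))"

definition Lp_minor_expr :: "nat \<Rightarrow> nat set \<Rightarrow> nat set \<Rightarrow> fp_expr" where
  "Lp_minor_expr N I J = Bin Times (Bin Times
     (prod_expr (map (\<lambda>i. power_expr i (Reg N)) (enumeration I)))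
     (sum_expr (map (\<lambda>K. Bin Times (Bin Times (nat_expr (pascal_minor N I K))
        (prod_expr (map (scaled_expr N) (enumeration K)))) (nat_expr (pascal_minor N J K)))
        (enumeration (ksubsets N (card I))))))
     (prod_expr (map (\<lambda>j. power_expr j (Reg 1)) (enumeration J)))"

lemma Lp_minor_expr:
  assumes pos: "0 < \<alpha>" "0 < \<beta>" and s: "holds_BD n \<alpha> \<beta> (\<alpha> * \<beta> + \<gamma>) s"
    and I: "I \<in> ksubsets (n + 1) k" and J: "J \<in> ksubsets (n + 1) k"
  shows "subtraction_free s (Lp_minor_expr (n + 1) I J)"
    and "exact_eval (Lp_minor_expr (n + 1) I J) s = minor (Lp n \<alpha> \<beta> \<gamma>) I J"
proof -
  have kI: "card I = k" using I by (simp add: ksubsets_def)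
  \<comment> \<open>If \<open>n = 0\<close> then \<open>l = 0\<close>, and the power is 1 whatever
    the registers hold.\<close>
  have ab: "(s 1 * s (n + 1)) ^ l \<noteq> 0" if "l \<le> n" for l
    using s pos that by (cases n) (auto simp: holds_BD_def)
  have lK: "l \<le> n" if "l \<in> K" "K \<in> ksubsets (n + 1) k" for l K
    using that by (auto simp: ksubsets_def less_Suc_eq_le)
  show "subtraction_free s (Lp_minor_expr (n + 1) I J)"
    using ab lK ksubsets_finite[OF I] ksubsets_finite[OF J] ksubsets_finite
    by (auto simp: Lp_minor_expr_def scaled_expr_def enumeration kI)
  define e where "e = (\<lambda>l. s (l * (n + 1) + l) / (s 1 * s (n + 1)) ^ l)"
  have sc: "exact_eval (scaled_expr (n + 1) l) s = e l" for l by (simp add: scaled_expr_def e_def)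
  have "exact_eval (Lp_minor_expr (n + 1) I J) s = (\<Prod>i\<in>I. s (n + 1) ^ i) *
    (\<Sum>K\<in>ksubsets (n + 1) k. real (pascal_minor (n + 1) I K) * (\<Prod>l\<in>K. e l) * real (pascal_minor (n + 1) J K)) *
    (\<Prod>j\<in>J. s 1 ^ j)"
    unfolding Lp_minor_expr_def kI
    by (simp only: exact_eval_sum_expr exact_eval_prod_expr map_map o_def sum_list_enumeration finite_ksubsets
        prod_list_enumeration ksubsets_finite[OF I] ksubsets_finite[OF J] nat_expr_simps power_expr_simps eval_expr.simps exact_arith_simps exact_op.simps sc)
      (intro arg_cong2[of _ _ _ _ "(*)"] refl sum.cong, simp add: prod_list_enumeration ksubsets_finite)
  also have "\<dots> = (\<Prod>i\<in>I. s (n + 1) ^ i) *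
    (\<Sum>K\<in>ksubsets (n + 1) k. minor (pascal (n + 1) 1) I K * (\<Prod>l\<in>K. e l) * minor (pascal (n + 1) 1) J K) *
    (\<Prod>j\<in>J. s 1 ^ j)"
    by (intro arg_cong2[of _ _ _ _ "(*)"] refl sum.cong pascal_minor[OF I] pascal_minor[OF J]) auto
  also have "\<dots> = minor (Lp n \<alpha> \<beta> \<gamma>) I J"
  proof (rule Lp_minor[symmetric, OF _ _ I J])
    show "s 1 = \<alpha> \<and> s (n + 1) = \<beta>" if "0 < n" using s that by (simp add: holds_BD_def)
    show "e l * (s 1 * s (n + 1)) ^ l = (\<alpha> * \<beta> + \<gamma>) ^ l" if "l \<le> n" for l
      using s ab[OF that] that by (simp add: e_def holds_BD_def)
  qed
  finally show "exact_eval (Lp_minor_expr (n + 1) I J) s = minor (Lp n \<alpha> \<beta> \<gamma>) I J" .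
qed

definition Gram_expr :: "nat \<Rightarrow> nat set \<Rightarrow> nat set \<Rightarrow> fp_expr" where
  "Gram_expr N I J = sum_expr (map (\<lambda>K. Bin Times (Reg (minor_reg K I)) (Reg (minor_reg K J)))
     (enumeration (ksubsets N (card I))))"

text \<open>By Cauchy--Binet the minors of \<open>A\<^sup>T A\<close> are sums of products of minors
  of \<open>A\<close>. They are thus obtained from the stored minors without subtraction.\<close>

lemma Gram_expr:
  assumes A: "A \<in> carrier_mat N N" and I: "I \<in> ksubsets N k" and J: "J \<in> ksubsets N k"
  shows "subtraction_free s (Gram_expr N I J)"
    and "exact_eval (Gram_expr N I J) (minor_state A) = minor (transpose_mat A * A) I J"
    and "near_minors N q A t \<Longrightarrow> r \<in> registers (Gram_expr N I J) \<Longrightarrow> near q (minor_state A r) (t r)"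
proof -
  have kI: "card I = k" using I by (simp add: ksubsets_def)
  note fin = ksubsets_finite[OF I] ksubsets_finite[OF J]
  show "subtraction_free s (Gram_expr N I J)" by (auto simp: Gram_expr_def)
  have "exact_eval (Gram_expr N I J) (minor_state A) = (\<Sum>K\<in>ksubsets N k. minor A K I * minor A K J)"
    unfolding Gram_expr_def kI exact_eval_sum_expr
    by (simp add: o_def sum_list_enumeration) (intro sum.cong refl, use fin ksubsets_finite in simp)
  also have "\<dots> = minor (transpose_mat A * A) I J"
    unfolding minor_mult[OF transpose_carrier_mat[THEN iffD2, OF A] A I J]
    by (intro sum.cong refl) (simp add: minor_transpose[OF A _ I])
  finally show "exact_eval (Gram_expr N I J) (minor_state A) = minor (transpose_mat A * A) I J" .
  show "near q (minor_state A r) (t r)" if t: "near_minors N q A t" and r: "r \<in> registers (Gram_expr N I J)"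
  proof -
    from r obtain K where K: "K \<in> ksubsets N k" and r: "r = minor_reg K I \<or> r = minor_reg K J"
      by (auto simp: Gram_expr_def kI enumeration)
    have "near q (minor A K I) (t (minor_reg K I))" "near q (minor A K J) (t (minor_reg K J))"
      using t I J K unfolding near_minors_def by blast+
    then show ?thesis using r fin ksubsets_finite[OF K] by auto
  qed
qed

definition inverse_expr :: "nat \<Rightarrow> nat \<Rightarrow> nat \<Rightarrow> fp_expr" where
  "inverse_expr N i j = sum_expr (map (\<lambda>l. Bin Divide
     (Bin Times (Bin Times (nat_expr (l choose i)) (power_expr (l - i) (Reg 1)))
       (Bin Times (nat_expr (l choose j)) (power_expr (l - j) (Reg N))))
     (Reg (l * N + l))) [0..<N])"

lemma inverse_expr:
  assumes d: "\<alpha> * \<beta> + \<gamma> \<noteq> 0" and s: "holds_BD n \<alpha> \<beta> (\<alpha> * \<beta> + \<gamma>) s" and ij: "i \<le> n" "j \<le> n"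
  shows "subtraction_free s (inverse_expr (n + 1) i j)"
    and "Lp_inverse n \<alpha> \<beta> \<gamma> $$ (i, j) = signed (even (i + j)) (exact_eval (inverse_expr (n + 1) i j) s)"
proof -
  show "subtraction_free s (inverse_expr (n + 1) i j)"
    using s d by (auto simp: inverse_expr_def holds_BD_def less_Suc_eq_le)
  have "s 1 ^ (l - i) = \<alpha> ^ (l - i)" "s (n + 1) ^ (l - j) = \<beta> ^ (l - j)" if "l \<le> n" for l
    using s that by (cases n; simp add: holds_BD_def)+
  then have "exact_eval (inverse_expr (n + 1) i j) s =
    (\<Sum>l<n + 1. of_nat (l choose i) * \<alpha> ^ (l - i) * (of_nat (l choose j) * \<beta> ^ (l - j)) / (\<alpha> * \<beta> + \<gamma>) ^ l)"
    unfolding inverse_expr_def exact_eval_sum_expr map_map interv_sum_list_conv_sum_set_nat atLeast0LessThan set_upt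
    by (intro sum.cong refl) (use s in \<open>auto simp: holds_BD_def less_Suc_eq_le\<close>)
  then show "Lp_inverse n \<alpha> \<beta> \<gamma> $$ (i, j) = signed (even (i + j)) (exact_eval (inverse_expr (n + 1) i j) s)"
    using ij by (simp add: Lp_inverse_def signed_def minus_one_power_iff)
qed

lemma registers_prod_expr [simp]: "registers (prod_expr es) = (\<Union>e\<in>set es. registers e)"
  by (induction es) (simp_all add: prod_expr_def)

text \<open>Ensures that solving reads only registers which \<open>solve_branch\<close> has
  rewritten before: the decomposition, followed by the magnitudes of the right-hand side.\<close>

lemma registers_inverse_expr:
  "registers (inverse_expr (n + 1) i j) \<subseteq> {..<(n + 1) * (n + 1) + (n + 1)}"
proof -
  have "l * (n + 1) + l < (n + 1) * (n + 1) + (n + 1)" if "l < n + 1" for l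
    using that mult_le_mono1[of l "n + 1" "n + 1"] by linarith
  then show ?thesis
    by (auto simp: inverse_expr_def nat_expr_def power_expr_def split: if_splits)
qed

definition solve_expr :: "nat \<Rightarrow> nat \<Rightarrow> fp_expr" where
  "solve_expr N i = sum_expr (map (\<lambda>j. Bin Times (inverse_expr N i j) (Reg (N * N + j))) [0..<N])"

section \<open>The five programs and their error constants\<close>

definition BD_program :: "nat \<Rightarrow> fp_prog" where
  "BD_program n = emit ((n + 1) * (n + 1)) (Lp_BD_expr (n + 1))"

definition BD_error :: "nat \<Rightarrow> real" where
  "BD_error n = total_error 0 (Lp_BD_expr (n + 1)) ((n + 1) * (n + 1))"

text \<open>The later programs receive the computed \<open>B\<close>, and their analysis sees it
  only through this closeness. It extends to the registers beyond the data, which hold 0 on both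
  sides.\<close>

definition near_BD :: "fp_arith \<Rightarrow> nat \<Rightarrow> real \<Rightarrow> real \<Rightarrow> real \<Rightarrow> real list \<Rightarrow> bool" where
  "near_BD M n \<alpha> \<beta> \<gamma> B \<longleftrightarrow> length B = (n + 1) * (n + 1) \<and>
     (\<forall>r. near (BD_error n * roundoff M) (initial_state (entries (Lp_BD n \<alpha> \<beta> \<gamma>)) r) (initial_state B r))"

lemma BD_error_nonneg: "0 \<le> BD_error n"
  by (simp add: BD_error_def total_error_nonneg)

lemma length_entries_Lp_BD: "length (entries (Lp_BD n \<alpha> \<beta> \<gamma>)) = (n + 1) * (n + 1)"
  unfolding entries_eq[OF Lp_BD_carrier] by (simp only: length_map length_upt diff_zero)

text \<open>With \<open>0 \<le> \<gamma>\<close> the diagonal base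
  \<open>\<alpha> * \<beta> + \<gamma>\<close> is a sum of numbers of the same sign. The initial
  registers are nonnegative and near to themselves with error 0.\<close>

lemma BD_program:
  assumes M: "standard_model M" and u: "roundoff M \<le> 1 / 4"
    and pos: "0 < \<alpha>" "0 < \<beta>" "0 \<le> \<gamma>"
  obtains B where "returns M (BD_program n) [\<alpha>, \<beta>, \<gamma>] B" "near_BD M n \<alpha> \<beta> \<gamma> B"
proof -
  let ?N = "n + 1" and ?s = "initial_state [\<alpha>, \<beta>, \<gamma>]"
  have "0 \<le> ?s k" for k using pos by (auto simp: initial_state_def less_Suc_eq nth_Cons')
  then have nn: "near (0 * roundoff M) (?s k) (?s k)" for k by (simp add: near_refl)
  have free: "subtraction_free ?s (Lp_BD_expr ?N r)" for r by (simp add: Lp_BD_expr_def)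
  obtain t where t: "exec M (BD_program n) ?s t"
    "\<And>r. r < ?N * ?N \<Longrightarrow> near (BD_error n * roundoff M) (exact_eval (Lp_BD_expr ?N r) ?s) (t r)"
    unfolding BD_program_def BD_error_def
    by (rule exec_near_output[OF M u order_refl, where f = "Lp_BD_expr ?N" and L = "?N * ?N" and s = ?s and s' = ?s,
          OF nn free]) blast+
  define B where "B = map t [0..<?N * ?N]"
  have len: "length B = ?N * ?N" by (simp only: B_def length_map length_upt diff_zero)
  have "near (BD_error n * roundoff M) (initial_state (entries (Lp_BD n \<alpha> \<beta> \<gamma>)) r) (initial_state B r)" for r
  proof (cases "r < ?N * ?N")
    case True
    have "r div ?N < ?N" "r mod ?N < ?N"
      using True by (auto simp: less_mult_imp_div_less)
    then have "initial_state (entries (Lp_BD n \<alpha> \<beta> \<gamma>)) r = exact_eval (Lp_BD_expr ?N r) ?s"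
      using True unfolding initial_state_def length_entries_Lp_BD
      unfolding entries_eq[OF Lp_BD_carrier] by (simp add: Lp_BD_expr_def Lp_BD_def del: mult_Suc mult_Suc_right)
    moreover have "initial_state B r = t r"
      using True unfolding initial_state_def len by (simp add: B_def del: mult_Suc mult_Suc_right)
    ultimately show ?thesis using t(2)[OF True] by simp
  next
    case False
    then show ?thesis unfolding initial_state_def len length_entries_Lp_BD
      using near_refl[of 0] BD_error_nonneg[of n] standard_modelD(1)[OF M] by auto
  qed
  then have "near_BD M n \<alpha> \<beta> \<gamma> B" by (simp only: near_BD_def len) simp
  moreover have "returns M (BD_program n) [\<alpha>, \<beta>, \<gamma>] B"
    unfolding returns_def len using t(1) by (auto simp: B_def initial_state_def[abs_def])
  ultimately show ?thesis using that by blast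
qed

definition eigenvalue_error :: "nat \<Rightarrow> real \<Rightarrow> real" where
  "eigenvalue_error N c = 2 * (c + 2 + 4 * 2 ^ N + 2 * real N + 4) + 2"

definition Lp_minors_error :: "nat \<Rightarrow> real" where
  "Lp_minors_error n = minors_error (BD_error n) (n + 1) (Lp_minor_expr (n + 1))"

lemma Lp_minors_error_nonneg: "0 \<le> Lp_minors_error n"
  by (simp add: Lp_minors_error_def minors_error_nonneg BD_error_nonneg)

lemma exec_load_Lp_minors:
  assumes M: "standard_model M" and u: "roundoff M \<le> 1 / 4"
    and pos: "0 < \<alpha>" "0 < \<beta>" and B: "near_BD M n \<alpha> \<beta> \<gamma> B"
  obtains t where "exec M (load_minors (n + 1) (Lp_minor_expr (n + 1))) (initial_state B) t" "t 0 = 1"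
    "near_minors (n + 1) (Lp_minors_error n * roundoff M) (Lp n \<alpha> \<beta> \<gamma>) t"
  unfolding Lp_minors_error_def
proof (rule exec_load_minors[OF M u BD_error_nonneg, where f = "Lp_minor_expr (n + 1)" and N = "n + 1"
      and s = "initial_state (entries (Lp_BD n \<alpha> \<beta> \<gamma>))" and s' = "initial_state B" and X = "Lp n \<alpha> \<beta> \<gamma>"])
  let ?s = "initial_state (entries (Lp_BD n \<alpha> \<beta> \<gamma>))"
  fix k I J assume IJ: "I \<in> ksubsets (n + 1) k" "J \<in> ksubsets (n + 1) k"
  show "near (BD_error n * roundoff M) (?s r) (initial_state B r)" for r
    using B by (simp add: near_BD_def)
  show "subtraction_free ?s (Lp_minor_expr (n + 1) I J)"
    "exact_eval (Lp_minor_expr (n + 1) I J) ?s = minor (Lp n \<alpha> \<beta> \<gamma>) I J"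
    by (rule Lp_minor_expr[OF pos holds_BD_initial_state IJ])+
qed (rule that[unfolded Lp_minors_error_def])

definition Lp_eigenvalue_program :: "nat \<Rightarrow> fp_prog" where
  "Lp_eigenvalue_program n = Seq (load_minors (n + 1) (Lp_minor_expr (n + 1))) (eigenvalue_program (n + 1))"

lemma Lp_eigenvalue_program:
  assumes M: "standard_model M" and u: "roundoff M \<le> 1 / 4"
    and pos: "0 < \<alpha>" "0 < \<beta>" "0 < \<alpha> * \<beta> + \<gamma>" and B: "near_BD M n \<alpha> \<beta> \<gamma> B"
  obtains es t where "eigenvalue_list (Lp n \<alpha> \<beta> \<gamma>) es" "exec M (Lp_eigenvalue_program n) (initial_state B) t"
    "\<And>k. k < length es \<Longrightarrow> near (eigenvalue_error (n + 1) (Lp_minors_error n) * roundoff M) (es ! k) (t k)"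
proof -
  obtain t1 where t1: "exec M (load_minors (n + 1) (Lp_minor_expr (n + 1))) (initial_state B) t1" "t1 0 = 1"
    "near_minors (n + 1) (Lp_minors_error n * roundoff M) (Lp n \<alpha> \<beta> \<gamma>) t1"
    using exec_load_Lp_minors[OF M u pos(1,2) B] by blast
  obtain es where es: "eigenvalue_list (Lp n \<alpha> \<beta> \<gamma>) es" "length es = n + 1"
    "\<And>x. x \<in> set es \<Longrightarrow> 0 < x" "sorted (rev es)"
    using Lp_eigenvalue_list[OF pos, of n] by blast
  obtain t where t: "exec M (eigenvalue_program (n + 1)) t1 t"
    "\<And>k. k < n + 1 \<Longrightarrow> near (eigenvalue_error (n + 1) (Lp_minors_error n) * roundoff M) (es ! k) (t k)"
    unfolding eigenvalue_error_def
    using exec_eigenvalue_program[OF M u Lp_carrier es Lp_minors_error_nonneg t1(3,2)] by blast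
  show ?thesis
    by (rule that[OF es(1)]) (use t t1(1) es(2) in \<open>auto simp: Lp_eigenvalue_program_def intro: exec.Seq\<close>)
qed

definition Gram_error :: "nat \<Rightarrow> real" where
  "Gram_error n = minors_error (Lp_minors_error n) (n + 1) (Gram_expr (n + 1))"

lemma Gram_error_nonneg: "0 \<le> Gram_error n"
  by (simp add: Gram_error_def minors_error_nonneg Lp_minors_error_nonneg)

definition Lp_singular_program :: "nat \<Rightarrow> fp_prog" where
  "Lp_singular_program n = Seq (load_minors (n + 1) (Lp_minor_expr (n + 1))) (Seq (load_minors (n + 1) (Gram_expr (n + 1)))
     (Seq (eigenvalue_program (n + 1)) (emit (n + 1) (\<lambda>k. Root (Reg k)))))"

definition singular_error :: "nat \<Rightarrow> real" where
  "singular_error n = total_error (eigenvalue_error (n + 1) (Gram_error n)) (\<lambda>k. Root (Reg k)) (n + 1)"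

lemma eigenvalue_error_nonneg: "0 \<le> c \<Longrightarrow> 0 \<le> eigenvalue_error N c"
  by (auto simp: eigenvalue_error_def intro!: add_nonneg_nonneg)

lemma Lp_singular_program:
  assumes M: "standard_model M" and u: "roundoff M \<le> 1 / 4"
    and pos: "0 < \<alpha>" "0 < \<beta>" "0 < \<alpha> * \<beta> + \<gamma>" and B: "near_BD M n \<alpha> \<beta> \<gamma> B"
  obtains ss t where "singular_value_list (Lp n \<alpha> \<beta> \<gamma>) ss" "exec M (Lp_singular_program n) (initial_state B) t"
    "\<And>k. k < length ss \<Longrightarrow> near (singular_error n * roundoff M) (ss ! k) (t k)"
proof -
  let ?L = "Lp n \<alpha> \<beta> \<gamma>"
  let ?G = "transpose_mat ?L * ?L"
  have G: "?G \<in> carrier_mat (n + 1) (n + 1)"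
    by (rule mult_carrier_mat[OF transpose_carrier_mat[THEN iffD2, OF Lp_carrier] Lp_carrier])
  obtain t1 where t1: "exec M (load_minors (n + 1) (Lp_minor_expr (n + 1))) (initial_state B) t1"
    "near_minors (n + 1) (Lp_minors_error n * roundoff M) ?L t1"
    using exec_load_Lp_minors[OF M u pos(1,2) B] by blast
  obtain t2 where t2: "exec M (load_minors (n + 1) (Gram_expr (n + 1))) t1 t2" "t2 0 = 1"
    "near_minors (n + 1) (Gram_error n * roundoff M) ?G t2"
    unfolding Gram_error_def
  proof (rule exec_load_minors[OF M u Lp_minors_error_nonneg, where f = "Gram_expr (n + 1)" and N = "n + 1"
        and s = "minor_state ?L" and s' = t1 and X = ?G])
    fix k I J assume IJ: "I \<in> ksubsets (n + 1) k" "J \<in> ksubsets (n + 1) k"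
    note * = Gram_expr[OF Lp_carrier IJ]
    show "near (Lp_minors_error n * roundoff M) (minor_state ?L r) (t1 r)"
      if "r \<in> registers (Gram_expr (n + 1) I J)" for r
      by (rule *(3)[OF t1(2) that])
    show "subtraction_free (minor_state ?L) (Gram_expr (n + 1) I J)" by (rule *(1))
    show "exact_eval (Gram_expr (n + 1) I J) (minor_state ?L) = minor ?G I J" by (rule *(2))
  qed blast
  obtain es where es: "eigenvalue_list ?G es" "length es = n + 1" "\<And>x. x \<in> set es \<Longrightarrow> 0 < x" "sorted (rev es)"
    using Gram_eigenvalue_list[OF Lp_carrier det_Lp_nonzero, of \<alpha> \<beta> \<gamma> n] pos(3) by auto
  obtain t3 where t3: "exec M (eigenvalue_program (n + 1)) t2 t3"
    "\<And>k. k < n + 1 \<Longrightarrow> near (eigenvalue_error (n + 1) (Gram_error n) * roundoff M) (es ! k) (t3 k)"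
    unfolding eigenvalue_error_def
    using exec_eigenvalue_program[OF M u G es Gram_error_nonneg t2(3,2)] by blast
  obtain t where t: "exec M (emit (n + 1) (\<lambda>k. Root (Reg k))) t3 t"
    "\<And>k. k < n + 1 \<Longrightarrow> near (singular_error n * roundoff M) (exact_eval (Root (Reg k)) (nth es)) (t k)"
    unfolding singular_error_def
    by (rule exec_near_output[OF M u eigenvalue_error_nonneg[OF Gram_error_nonneg], where f = "\<lambda>k. Root (Reg k)"
          and L = "n + 1" and s = "nth es" and s' = t3]) (use t3(2) in auto)
  show ?thesis
  proof (rule that[of "map sqrt es"])
    show "singular_value_list ?L (map sqrt es)" using es(1) by (auto simp: singular_value_list_def)
    show "exec M (Lp_singular_program n) (initial_state B) t"
      unfolding Lp_singular_program_def using t1(1) t2(1) t3(1) t(1) by (blast intro: exec.Seq)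
    show "near (singular_error n * roundoff M) (map sqrt es ! k) (t k)" if "k < length (map sqrt es)" for k
      using t(2)[of k] that es(2) by simp
  qed
qed

definition Lp_inverse_program :: "nat \<Rightarrow> fp_prog" where
  "Lp_inverse_program n = emit ((n + 1) * (n + 1)) (\<lambda>r. signed_expr (even (r div (n + 1) + r mod (n + 1)))
     (inverse_expr (n + 1) (r div (n + 1)) (r mod (n + 1))))"

definition inverse_error :: "nat \<Rightarrow> real" where
  "inverse_error n = total_error (BD_error n) (\<lambda>r. inverse_expr (n + 1) (r div (n + 1)) (r mod (n + 1))) ((n + 1) * (n + 1))"

lemma Lp_inverse_program:
  assumes M: "standard_model M" and u: "roundoff M \<le> 1 / 4"
    and d: "0 < \<alpha> * \<beta> + \<gamma>" and B: "near_BD M n \<alpha> \<beta> \<gamma> B"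
  obtains t x b where "exec M (Lp_inverse_program n) (initial_state B) t"
    "\<And>r. r < (n + 1) * (n + 1) \<Longrightarrow> near (inverse_error n * roundoff M) (x r) (signed (b r) (t r))"
    "\<And>r. r < (n + 1) * (n + 1) \<Longrightarrow> entries (Lp_inverse n \<alpha> \<beta> \<gamma>) ! r = signed (b r) (x r)"
    "length (entries (Lp_inverse n \<alpha> \<beta> \<gamma>)) = (n + 1) * (n + 1)"
proof -
  let ?N = "n + 1" and ?s = "initial_state (entries (Lp_BD n \<alpha> \<beta> \<gamma>))"
  have ij: "r div ?N \<le> n" "r mod ?N \<le> n" if "r < ?N * ?N" for r
    using that less_mult_imp_div_less[of r ?N ?N] mod_less_divisor[of ?N r] by linarith+
  note e = inverse_expr[OF less_imp_neq[OF d, symmetric] holds_BD_initial_state]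
  obtain t where t: "exec M (Lp_inverse_program n) (initial_state B) t"
    "\<And>r. r < ?N * ?N \<Longrightarrow> near (inverse_error n * roundoff M)
      (exact_eval (inverse_expr ?N (r div ?N) (r mod ?N)) ?s) (signed (even (r div ?N + r mod ?N)) (t r))"
    unfolding Lp_inverse_program_def inverse_error_def
  proof (rule exec_signed_output[OF M u BD_error_nonneg, where s = ?s and s' = "initial_state B" and L = "?N * ?N"
        and f = "\<lambda>r. inverse_expr ?N (r div ?N) (r mod ?N)" and b = "\<lambda>r. even (r div ?N + r mod ?N)"])
    show "near (BD_error n * roundoff M) (?s k) (initial_state B k)" for k using B by (simp add: near_BD_def)
    show "subtraction_free ?s (inverse_expr ?N (r div ?N) (r mod ?N))" if "r < ?N * ?N" for r
      by (rule e(1)[OF ij[OF that]])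
  qed blast
  have X: "Lp_inverse n \<alpha> \<beta> \<gamma> \<in> carrier_mat ?N ?N" by (simp add: Lp_inverse_def)
  show ?thesis
  proof (rule that[OF t])
    show "entries (Lp_inverse n \<alpha> \<beta> \<gamma>) ! r =
      signed (even (r div ?N + r mod ?N)) (exact_eval (inverse_expr ?N (r div ?N) (r mod ?N)) ?s)"
      if r: "r < ?N * ?N" for r
      unfolding entries_eq[OF X] e(2)[OF ij[OF r], symmetric] using r by (simp del: mult_Suc mult_Suc_right)
    show "length (entries (Lp_inverse n \<alpha> \<beta> \<gamma>)) = ?N * ?N"
      unfolding entries_eq[OF X] by (simp only: length_map length_upt diff_zero)
  qed
qed

text \<open>The signs of \<open>b\<close> follow the checkerboard pattern of the inverse, hence \<open>x\<^sub>i\<close> is, up to sign, a sum of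
  nonnegative terms. The flag tells whether \<open>b\<^sub>0\<close> is positive.\<close>

definition solve_branch :: "nat \<Rightarrow> bool \<Rightarrow> fp_prog" where
  "solve_branch N p = Seq (emit (N * N + N) (\<lambda>r. signed_expr (r < N * N \<or> even (r - N * N) = p) (Reg r)))
     (emit N (\<lambda>i. signed_expr (even i = p) (solve_expr N i)))"

definition Lp_solve_program :: "nat \<Rightarrow> fp_prog" where
  "Lp_solve_program n = (let N = n + 1 in
     If_less Zero (Reg (N * N)) (solve_branch N True) (solve_branch N False))"

definition solve_error :: "nat \<Rightarrow> real" where
  "solve_error n = total_error (BD_error n + 2) (solve_expr (n + 1)) (n + 1)"

lemma signed_mult: "signed b x * signed c y = signed (b = c) (x * y)"
  by (simp add: signed_def)

text \<open>The sign of each entry is determined by that of the first. The weak inequality covers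
  \<open>n = 0\<close>, where alternation is vacuous and the entry may be 0.\<close>

lemma alternating_signs_signed:
  assumes b: "b \<in> carrier_vec (n + 1)" "alternating_signs b" and j: "j \<le> n"
  shows "0 \<le> signed (even j = (0 < b $ 0)) (b $ j)"
  using j
proof (induction j)
  case (Suc j)
  have "b $ j * b $ (j + 1) < 0" using b Suc.prems unfolding alternating_signs_def by simp
  then show ?case using Suc by (auto simp: signed_def mult_less_0_iff split: if_splits)
qed (simp add: signed_def)

lemma Lp_solve_program:
  assumes M: "standard_model M" and u: "roundoff M \<le> 1 / 4"
    and d: "0 < \<alpha> * \<beta> + \<gamma>" and B: "near_BD M n \<alpha> \<beta> \<gamma> B"
    and b: "b \<in> carrier_vec (n + 1)" "alternating_signs b"
  obtains t y c where "exec M (Lp_solve_program n) (initial_state (B @ list_of_vec b)) t"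
    "\<And>i. i < n + 1 \<Longrightarrow> near (solve_error n * roundoff M) (y i) (signed (c i) (t i))"
    "\<And>i. i < n + 1 \<Longrightarrow> (Lp_inverse n \<alpha> \<beta> \<gamma> *\<^sub>v b) $ i = signed (c i) (y i)"
proof -
  define N where "N = n + 1"
  define p where "p \<longleftrightarrow> 0 < b $ 0"
  let ?z = "initial_state (entries (Lp_BD n \<alpha> \<beta> \<gamma>))" and ?s = "initial_state (B @ list_of_vec b)"
  have u0: "0 < roundoff M" by (rule standard_modelD(1)[OF M])
  have len: "length B = N * N" using B by (simp add: near_BD_def N_def)
  have sB: "?s r = initial_state B r" if "r < N * N" for r
    using that by (simp add: initial_state_def len nth_append)
  have sb: "?s (N * N + j) = b $ j" if "j < N" for j
    using that b(1) by (simp add: initial_state_def len nth_append N_def list_of_vec_index)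
  \<comment> \<open>The ideal state after the change of signs, with the exact decomposition in place
    of the computed one. Negating entries of \<open>b\<close> is a rounded operation, which explains
    the 2 added to \<open>BD_error n\<close>.\<close>
  define s1 where "s1 = (\<lambda>r. if r < N * N then ?z r else \<bar>b $ (r - N * N)\<bar>)"
  have abs_b: "\<bar>b $ j\<bar> = signed (even j = p) (b $ j)" if "j < N" for j
    using alternating_signs_signed[OF b, of j] that by (auto simp: p_def N_def signed_def split: if_splits)
  obtain t1 where t1: "exec M (emit (N * N + N) (\<lambda>r. signed_expr (r < N * N \<or> even (r - N * N) = p) (Reg r))) ?s t1"
    "\<And>r. r < N * N + N \<Longrightarrow> t1 r = eval_expr M (signed_expr (r < N * N \<or> even (r - N * N) = p) (Reg r)) ?s"
    by (rule exec_output[of M "N * N + N" "\<lambda>r. signed_expr (r < N * N \<or> even (r - N * N) = p) (Reg r)" ?s]) blast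
  have n1: "near ((BD_error n + 2) * roundoff M) (s1 r) (t1 r)" if r: "r < N * N + N" for r
  proof (cases "r < N * N")
    case True
    have "near (BD_error n * roundoff M) (?z r) (initial_state B r)" using B by (simp add: near_BD_def)
    then show ?thesis using True t1(2)[OF r] sB[OF True] u0
      by (auto simp: s1_def signed_expr_def elim: near_mono)
  next
    case False
    define j where "j = r - N * N"
    have j: "j < N" "r = N * N + j" using False r by (auto simp: j_def)
    have "near (2 * roundoff M) \<bar>b $ j\<bar> (t1 r)"
    proof (cases "even j = p")
      case True
      then show ?thesis using t1(2)[OF r] j sb[OF j(1)] abs_b[OF j(1)] u0
        by (auto simp: signed_expr_def signed_def intro: near_refl)
    next
      case False
      then have "\<bar>b $ j\<bar> = exact_op Minus 0 (b $ j)" using abs_b[OF j(1)] by (simp add: signed_def)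
      moreover from this have "0 \<le> exact_op Minus 0 (b $ j)" by (metis abs_ge_zero)
      ultimately show ?thesis using False t1(2)[OF r] j sb[OF j(1)] near_fl_op[OF M, of Minus 0 "b $ j"] u
        by (simp add: signed_expr_def)
    qed
    moreover have "2 * roundoff M \<le> (BD_error n + 2) * roundoff M"
      using BD_error_nonneg[of n] u0 by (intro mult_right_mono) auto
    ultimately have "near ((BD_error n + 2) * roundoff M) \<bar>b $ j\<bar> (t1 r)" by (rule near_mono)
    then show ?thesis using False by (simp add: s1_def j_def)
  qed
  have h: "holds_BD n \<alpha> \<beta> (\<alpha> * \<beta> + \<gamma>) s1"
  proof -
    have "l * N + l < N * N" if "l \<le> n" for l
    proof -
      have "l * N + l < l * N + N" using that by (simp add: N_def)
      also have "\<dots> = (l + 1) * N" by simp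
      also have "\<dots> \<le> N * N" using that by (intro mult_right_mono) (auto simp: N_def)
      finally show ?thesis .
    qed
    moreover have "1 < N * N" "N < N * N" if "0 < n" using that by (auto simp: N_def)
    ultimately show ?thesis using holds_BD_initial_state[of n \<alpha> \<beta> \<gamma>]
      unfolding holds_BD_def s1_def N_def[symmetric] by auto
  qed
  note e = inverse_expr[OF less_imp_neq[OF d, symmetric] h, folded N_def]
  obtain t where t: "exec M (emit N (\<lambda>i. signed_expr (even i = p) (solve_expr N i))) t1 t"
    "\<And>i. i < N \<Longrightarrow> near (solve_error n * roundoff M) (exact_eval (solve_expr N i) s1) (signed (even i = p) (t i))"
    unfolding solve_error_def N_def[symmetric]
  proof (rule exec_signed_output[OF M u, where s = s1 and s' = t1 and c = "BD_error n + 2" and L = N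
        and f = "solve_expr N" and b = "\<lambda>i. even i = p"])
    show "0 \<le> BD_error n + 2" using BD_error_nonneg[of n] by simp
    show "near ((BD_error n + 2) * roundoff M) (s1 k) (t1 k)" if "k \<in> registers (solve_expr N i)" for i k
      using that registers_inverse_expr[of n i] by (intro n1) (auto simp: solve_expr_def N_def)
    show "subtraction_free s1 (solve_expr N i)" if "i < N" for i
      using that e(1) by (auto simp: solve_expr_def N_def)
  qed blast
  have x: "(Lp_inverse n \<alpha> \<beta> \<gamma> *\<^sub>v b) $ i = signed (even i = p) (exact_eval (solve_expr N i) s1)" if i: "i < N" for i
  proof -
    have "(Lp_inverse n \<alpha> \<beta> \<gamma> *\<^sub>v b) $ i = (\<Sum>j<N. Lp_inverse n \<alpha> \<beta> \<gamma> $$ (i, j) * b $ j)"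
      using i b(1) by (simp add: Lp_inverse_def scalar_prod_def atLeast0LessThan N_def)
    \<comment> \<open>The signs \<open>even (i + j)\<close> of the inverse and
      \<open>even j = p\<close> of \<open>b\<close> multiply to \<open>even i = p\<close>, which
      does not depend on \<open>j\<close>.\<close>
    also have "\<dots> = (\<Sum>j<N. signed (even i = p) (exact_eval (inverse_expr N i j) s1 * s1 (N * N + j)))"
    proof (rule sum.cong[OF refl])
      fix j assume "j \<in> {..<N}"
      then have j: "j < N" by simp
      have "b $ j = signed (even j = p) (s1 (N * N + j))"
        using abs_b[OF j] by (simp add: s1_def signed_def)
      then show "Lp_inverse n \<alpha> \<beta> \<gamma> $$ (i, j) * b $ j = signed (even i = p) (exact_eval (inverse_expr N i j) s1 * s1 (N * N + j))"
        using e(2)[of i j] i j by (auto simp: signed_mult N_def signed_def)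
    qed
    also have "\<dots> = signed (even i = p) (exact_eval (solve_expr N i) s1)"
      unfolding solve_expr_def exact_eval_sum_expr map_map interv_sum_list_conv_sum_set_nat atLeast0LessThan set_upt
      by (simp add: signed_def sum_negf)
    finally show ?thesis .
  qed
  have branch: "exec M (solve_branch N p) ?s t"
    unfolding solve_branch_def by (rule exec.Seq[OF t1(1) t(1)])
  have test: "eval_expr M Zero ?s < eval_expr M (Reg (N * N)) ?s \<longleftrightarrow> p" using sb[of 0] by (simp add: N_def p_def)
  have "exec M (Lp_solve_program n) ?s t"
    unfolding Lp_solve_program_def Let_def N_def[symmetric]
  proof (cases p)
    case True
    then show "exec M (If_less Zero (Reg (N * N)) (solve_branch N True) (solve_branch N False)) ?s t"
      using branch test by (intro exec.If_True) auto
  next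
    case False
    then show "exec M (If_less Zero (Reg (N * N)) (solve_branch N True) (solve_branch N False)) ?s t"
      using branch test by (intro exec.If_False) auto
  qed
  then show ?thesis
    by (rule that[of t "\<lambda>i. exact_eval (solve_expr N i) s1" "\<lambda>i. even i = p"]) (use t(2) x in \<open>simp_all add: N_def\<close>)
qed

text \<open>Being a sum of nonnegative constants it dominates each of them, so that one
  \<open>K\<close> and one bound on the round-off serve all five programs.\<close>

definition Lp_error :: "nat \<Rightarrow> real" where
  "Lp_error n = BD_error n + eigenvalue_error (n + 1) (Lp_minors_error n) + singular_error n + inverse_error n + solve_error n"

lemma signed_mult_self [simp]: "signed b (signed b x) = x"
  by (simp add: signed_def)

lemma Lp_high_relative_accuracy:
  assumes M: "standard_model M" and u: "roundoff M < 1 / (4 + Lp_error n)"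
    and pos: "0 < \<alpha>" "0 < \<beta>" "0 < \<alpha> * \<beta> + \<gamma>" "0 \<le> \<gamma>"
  defines "K \<equiv> 2 * Lp_error n + 1"
  shows "\<exists>B. returns M (BD_program n) [\<alpha>, \<beta>, \<gamma>] B \<and>
    list_all2 (hra K M) (entries (Lp_BD n \<alpha> \<beta> \<gamma>)) B \<and>
    (\<exists>es. eigenvalue_list (Lp n \<alpha> \<beta> \<gamma>) es \<and> obtains_hra K M (Lp_eigenvalue_program n) B es) \<and>
    (\<exists>ss. singular_value_list (Lp n \<alpha> \<beta> \<gamma>) ss \<and> obtains_hra K M (Lp_singular_program n) B ss) \<and>
    (\<exists>X. X \<in> carrier_mat (n + 1) (n + 1) \<and>
         inverts_mat (Lp n \<alpha> \<beta> \<gamma>) X \<and> inverts_mat X (Lp n \<alpha> \<beta> \<gamma>) \<and>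
         obtains_hra K M (Lp_inverse_program n) B (entries X)) \<and>
    (\<forall>b \<in> carrier_vec (n + 1). alternating_signs b \<longrightarrow>
       (\<exists>x \<in> carrier_vec (n + 1). Lp n \<alpha> \<beta> \<gamma> *\<^sub>v x = b \<and>
          obtains_hra K M (Lp_solve_program n) (B @ list_of_vec b) (list_of_vec x)))"
proof -
  have e0: "0 \<le> BD_error n" "0 \<le> eigenvalue_error (n + 1) (Lp_minors_error n)" "0 \<le> singular_error n"
    "0 \<le> inverse_error n" "0 \<le> solve_error n"
    by (simp_all add: BD_error_nonneg eigenvalue_error_nonneg Lp_minors_error_nonneg Gram_error_nonneg
        singular_error_def inverse_error_def solve_error_def total_error_nonneg)
  have u0: "0 < roundoff M" by (rule standard_modelD(1)[OF M])
  have C0: "0 \<le> Lp_error n" using e0 by (simp add: Lp_error_def)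
  \<comment> \<open>The 4 provides the round-off bound 1/4 for the programs, the other summand the
    smallness that \<open>hra_near\<close> asks for.\<close>
  then have "4 * roundoff M + Lp_error n * roundoff M < 1" using u by (simp add: field_simps)
  moreover have "0 \<le> Lp_error n * roundoff M" using u0 C0 by simp
  ultimately have u1: "roundoff M \<le> 1 / 4" and Cu: "Lp_error n * roundoff M \<le> 1" using u0 by linarith+
  have hra: "hra K M x y" if "near (C * roundoff M) x y" "0 \<le> C" "C \<le> Lp_error n" for C x y
  proof (rule hra_near[OF that(1) u0 that(2)])
    show "C * roundoff M \<le> 1" using mult_right_mono[OF that(3), of "roundoff M"] u0 Cu by linarith
    show "2 * C < K" using that(3) by (simp add: K_def)
  qed
  have le: "BD_error n \<le> Lp_error n" "eigenvalue_error (n + 1) (Lp_minors_error n) \<le> Lp_error n"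
    "singular_error n \<le> Lp_error n" "inverse_error n \<le> Lp_error n" "solve_error n \<le> Lp_error n"
    using e0 by (simp_all add: Lp_error_def)
  let ?L = "Lp n \<alpha> \<beta> \<gamma>" and ?X = "Lp_inverse n \<alpha> \<beta> \<gamma>"
  have X: "?X \<in> carrier_mat (n + 1) (n + 1)" by (simp add: Lp_inverse_def)
  note LX = Lp_inverse[OF less_imp_neq[OF pos(3), symmetric], of n]
  obtain B where B: "returns M (BD_program n) [\<alpha>, \<beta>, \<gamma>] B" "near_BD M n \<alpha> \<beta> \<gamma> B"
    using BD_program[OF M u1 pos(1,2,4)] by blast
  have "list_all2 (hra K M) (entries (Lp_BD n \<alpha> \<beta> \<gamma>)) B"
  proof (rule list_all2_all_nthI)
    have len: "length B = (n + 1) * (n + 1)" using B(2) by (simp only: near_BD_def)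
    then show "length (entries (Lp_BD n \<alpha> \<beta> \<gamma>)) = length B" by (simp only: length_entries_Lp_BD)
    fix r assume r: "r < length (entries (Lp_BD n \<alpha> \<beta> \<gamma>))"
    have "near (BD_error n * roundoff M) (initial_state (entries (Lp_BD n \<alpha> \<beta> \<gamma>)) r) (initial_state B r)"
      using B(2) by (simp add: near_BD_def)
    then have "near (BD_error n * roundoff M) (entries (Lp_BD n \<alpha> \<beta> \<gamma>) ! r) (B ! r)"
      using r len length_entries_Lp_BD[of n \<alpha> \<beta> \<gamma>] by (simp only: initial_state_def if_True)
    then show "hra K M (entries (Lp_BD n \<alpha> \<beta> \<gamma>) ! r) (B ! r)" by (rule hra[OF _ e0(1) le(1)])
  qed
  moreover have "\<exists>es. eigenvalue_list ?L es \<and> obtains_hra K M (Lp_eigenvalue_program n) B es"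
  proof -
    obtain es t where es: "eigenvalue_list ?L es" and t: "exec M (Lp_eigenvalue_program n) (initial_state B) t"
      "\<And>k. k < length es \<Longrightarrow> near (eigenvalue_error (n + 1) (Lp_minors_error n) * roundoff M) (es ! k) (t k)"
      using Lp_eigenvalue_program[OF M u1 pos(1-3) B(2)] by blast
    have "obtains_hra K M (Lp_eigenvalue_program n) B es"
      by (rule obtains_hraI[OF t(1)]) (rule hra[OF t(2) e0(2) le(2)])
    with es show ?thesis by blast
  qed
  moreover have "\<exists>ss. singular_value_list ?L ss \<and> obtains_hra K M (Lp_singular_program n) B ss"
  proof -
    obtain ss t where ss: "singular_value_list ?L ss" and t: "exec M (Lp_singular_program n) (initial_state B) t"
      "\<And>k. k < length ss \<Longrightarrow> near (singular_error n * roundoff M) (ss ! k) (t k)"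
      using Lp_singular_program[OF M u1 pos(1-3) B(2)] by blast
    have "obtains_hra K M (Lp_singular_program n) B ss"
      by (rule obtains_hraI[OF t(1)]) (rule hra[OF t(2) e0(3) le(3)])
    with ss show ?thesis by blast
  qed
  moreover have "obtains_hra K M (Lp_inverse_program n) B (entries ?X)"
  proof -
    obtain t x b where t: "exec M (Lp_inverse_program n) (initial_state B) t"
      "\<And>r. r < (n + 1) * (n + 1) \<Longrightarrow> near (inverse_error n * roundoff M) (x r) (signed (b r) (t r))"
      "\<And>r. r < (n + 1) * (n + 1) \<Longrightarrow> entries ?X ! r = signed (b r) (x r)"
      "length (entries ?X) = (n + 1) * (n + 1)"
      using Lp_inverse_program[OF M u1 pos(3) B(2)] by blast
    show ?thesis
    proof (rule obtains_hraI[OF t(1)])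
      fix r assume "r < length (entries ?X)"
      then have r: "r < (n + 1) * (n + 1)" by (simp only: t(4))
      have "hra K M (signed (b r) (x r)) (signed (b r) (signed (b r) (t r)))"
        unfolding hra_signed by (rule hra[OF t(2)[OF r] e0(4) le(4)])
      then show "hra K M (entries ?X ! r) (t r)" by (simp add: t(3)[OF r] signed_mult_self)
    qed
  qed
  moreover have "\<exists>x \<in> carrier_vec (n + 1). ?L *\<^sub>v x = b \<and>
      obtains_hra K M (Lp_solve_program n) (B @ list_of_vec b) (list_of_vec x)"
    if b: "b \<in> carrier_vec (n + 1)" "alternating_signs b" for b
  proof (intro bexI conjI)
    show "?X *\<^sub>v b \<in> carrier_vec (n + 1)" using X b(1) by simp
    have "?L *\<^sub>v (?X *\<^sub>v b) = (?L * ?X) *\<^sub>v b"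
      by (rule assoc_mult_mat_vec[OF Lp_carrier X b(1), symmetric])
    then show "?L *\<^sub>v (?X *\<^sub>v b) = b" using LX(1) b(1) by simp
    obtain t y c where t: "exec M (Lp_solve_program n) (initial_state (B @ list_of_vec b)) t"
      "\<And>i. i < n + 1 \<Longrightarrow> near (solve_error n * roundoff M) (y i) (signed (c i) (t i))"
      "\<And>i. i < n + 1 \<Longrightarrow> (?X *\<^sub>v b) $ i = signed (c i) (y i)"
      using Lp_solve_program[OF M u1 pos(3) B(2) b] by blast
    show "obtains_hra K M (Lp_solve_program n) (B @ list_of_vec b) (list_of_vec (?X *\<^sub>v b))"
    proof (rule obtains_hraI[OF t(1)])
      fix i assume "i < length (list_of_vec (?X *\<^sub>v b))"
      then have i: "i < n + 1" using X by simp
      have "hra K M (signed (c i) (y i)) (signed (c i) (signed (c i) (t i)))"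
        unfolding hra_signed by (rule hra[OF t(2)[OF i] e0(5) le(5)])
      then show "hra K M (list_of_vec (?X *\<^sub>v b) ! i) (t i)"
        by (simp only: list_of_vec_index t(3)[OF i] signed_mult_self)
    qed
  qed
  moreover have "inverts_mat ?L ?X" "inverts_mat ?X ?L"
    using LX X unfolding inverts_mat_def by simp_all
  ultimately show ?thesis using B(1) X by blast
qed

theorem corollary9:
  fixes n :: nat
  shows
    "(\<forall>\<alpha> \<beta> \<gamma>. \<alpha> > 0 \<and> \<beta> > 0 \<and> \<alpha> * \<beta> + \<gamma> > 0 \<longrightarrow> strictly_totally_positive (Lp n \<alpha> \<beta> \<gamma>)) \<and>
     (\<forall>\<alpha> \<beta> \<gamma>. \<alpha> > 0 \<and> \<beta> > 0 \<and> \<alpha> * \<beta> + \<gamma> > 0 \<and> \<gamma> \<ge> 0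
        \<longrightarrow> bidiagonal_decomposition (Lp n \<alpha> \<beta> \<gamma>) (Lp_BD n \<alpha> \<beta> \<gamma>)) \<and>
     (\<exists>P_bd P_eig P_sing P_inv P_solve K u0. K > 0 \<and> u0 > 0 \<and>
        (\<forall>M \<alpha> \<beta> \<gamma>. standard_model M \<and> roundoff M < u0 \<and>
           \<alpha> > 0 \<and> \<beta> > 0 \<and> \<alpha> * \<beta> + \<gamma> > 0 \<and> \<gamma> \<ge> 0 \<longrightarrow>
           (\<exists>B. returns M P_bd [\<alpha>, \<beta>, \<gamma>] B \<and>
                list_all2 (hra K M) (entries (Lp_BD n \<alpha> \<beta> \<gamma>)) B \<and>
                (\<exists>es. eigenvalue_list (Lp n \<alpha> \<beta> \<gamma>) es \<and> obtains_hra K M P_eig B es) \<and>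
                (\<exists>ss. singular_value_list (Lp n \<alpha> \<beta> \<gamma>) ss \<and> obtains_hra K M P_sing B ss) \<and>
                (\<exists>X. X \<in> carrier_mat (n + 1) (n + 1) \<and>
                     inverts_mat (Lp n \<alpha> \<beta> \<gamma>) X \<and> inverts_mat X (Lp n \<alpha> \<beta> \<gamma>) \<and>
                     obtains_hra K M P_inv B (entries X)) \<and>
                (\<forall>b \<in> carrier_vec (n + 1). alternating_signs b \<longrightarrow>
                   (\<exists>x \<in> carrier_vec (n + 1). Lp n \<alpha> \<beta> \<gamma> *\<^sub>v x = b \<and>
                      obtains_hra K M P_solve (B @ list_of_vec b) (list_of_vec x))))))"
proof -
  have "0 \<le> Lp_error n"
    by (simp add: Lp_error_def BD_error_nonneg eigenvalue_error_nonneg Lp_minors_error_nonneg Gram_error_nonneg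
        singular_error_def inverse_error_def solve_error_def total_error_nonneg)
  then have K: "0 < 2 * Lp_error n + 1" and u0: "0 < 1 / (4 + Lp_error n)" by auto
  show ?thesis
  proof (intro conjI)
    show "\<forall>\<alpha> \<beta> \<gamma>. \<alpha> > 0 \<and> \<beta> > 0 \<and> \<alpha> * \<beta> + \<gamma> > 0 \<longrightarrow> strictly_totally_positive (Lp n \<alpha> \<beta> \<gamma>)"
      by (intro allI impI, elim conjE) (rule Lp_strictly_totally_positive)
    show "\<forall>\<alpha> \<beta> \<gamma>. \<alpha> > 0 \<and> \<beta> > 0 \<and> \<alpha> * \<beta> + \<gamma> > 0 \<and> \<gamma> \<ge> 0
        \<longrightarrow> bidiagonal_decomposition (Lp n \<alpha> \<beta> \<gamma>) (Lp_BD n \<alpha> \<beta> \<gamma>)"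
      by (intro allI impI Lp_bidiagonal_decomposition)
  qed (rule exI[of _ "BD_program n"], rule exI[of _ "Lp_eigenvalue_program n"], rule exI[of _ "Lp_singular_program n"],
      rule exI[of _ "Lp_inverse_program n"], rule exI[of _ "Lp_solve_program n"], rule exI[of _ "2 * Lp_error n + 1"],
      rule exI[of _ "1 / (4 + Lp_error n)"], rule conjI[OF K conjI[OF u0]], intro allI impI, elim conjE,
      rule Lp_high_relative_accuracy)
qed

end
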